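(* Let $k$ be a field, let $n\ge 2$, and let $V$ be an $n$-dimensional vector space over $k$ (viewed as a $k$-central $k$-$k$-bimodule). Then there is an equivalence of categories $$\mathbb{P}^1_n\equiv\mathbb{P}^{nc}(V).$$
   Context: Definition of $\mathbb{P}^1_n$: let $A=k\langle x_1,\dots,x_n\rangle/(b)$ with all $x_i$ of degree one and $b=\sum_{i=1}^nx_i\sigma(x_{n+1-i})$ for some graded automorphism $\sigma$ of the free algebra $k\langle x_1,\dots,x_n\rangle$. Such $A$ is graded right-coherent (Piontkovski), and $\mathbb{P}^1_n:=\mathsf{cohproj}\,A$ is the quotient of the abelian category of coherent ($\mathbb{Z}$-)graded right $A$-modules by the Serre subcategory of those that are eventually zero. By a theorem of Piontkovski this depends, up to equivalence, only on $k$ and $n$. Definition of $\mathbb{P}^{nc}(V)$. For a finite-dimensional $k$-central $k$-$k$-bimodule $V$ put $V^{0*}=V$, $V^{i*}=(V^{(i-1)*})^*$ for $i>0$ and $V^{i*}={}^*(V^{(i+1)*})$ for $i<0$, where $(-)^*$, ${}^*(-)$ are right and left duals (here both the usual $k$-dual). Canonically $V^{(i+1)*}\cong(V^{i*})^*$. Let $Q_i\subset V^{i*}\otimes_kV^{(i+1)*}$ be the $k$-span of $\sum_p\phi_p\otimes\phi_p^*$, where $\{\phi_p\}$ is a basis of $V^{i*}$ and $\{\phi_p^*\}$ the dual basis. For $j>i$ let $T_{ij}=V^{i*}\otimes\cdots\otimes V^{(j-1)*}$, $R_{i,i+1}=0$ and, for $j\ge i+2$, $R_{ij}=\sum_{p=i}^{j-2}V^{i*}\otimes\cdots\otimes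 V^{(p-1)*}\otimes Q_p\otimes V^{(p+2)*}\otimes\cdots\otimes V^{(j-1)*}$. The noncommutative symmetric algebra is the $\mathbb{Z}$-algebra $\mathbb{S}^{nc}(V)=\bigoplus_{i,j}A_{ij}$ with $A_{ij}=0$ for $i>j$, $A_{ii}=k$ (with local unit $e_i$), $A_{ij}=T_{ij}/R_{ij}$ for $j>i$, and multiplication $A_{ij}\otimes A_{jl}\to A_{il}$ induced by scalar action and concatenation of tensors (products $A_{ij}A_{ml}$ with $j\ne m$ are zero). A graded right module over a $\mathbb{Z}$-algebra $A$ is $X=\bigoplus_iX_i$ with $X_iA_{ij}\subset X_j$, $X_iA_{jl}=0$ for $i\neq j$, $e_i$ acting as identity on $X_i$. With $P_i=e_iA$, $X$ is finitely generated if it is a quotient of a finite direct sum of $P_i$'s, and coherent if moreover every homomorphism from a finite direct sum of $P_i$'s to $X$ has finitely generated kernel. $\mathbb{P}^{nc}(V)$ is the quotient of the category of coherent graded right $\mathbb{S}^{nc}(V)$-modules by the subcategory of right-bounded ones ($X_m=0$ for $m\gg0$). *)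

theory Defs
  imports
    "HOL-Library.Poly_Mapping"
    "HOL-Algebra.QuotRing"
    "HOL-Algebra.Module"
begin

section \<open>Categories, localization, Serre quotients\<close>

text \<open>Hom-sets need not be disjoint; \<open>Comp C X Y Z g f\<close> is \<open>g \<circ> f\<close> for \<open>f : X \<rightarrow> Y\<close>, \<open>g : Y \<rightarrow> Z\<close>.\<close>

record ('o, 'm) cat =
  Ob :: "'o set"
  Hom :: "'o \<Rightarrow> 'o \<Rightarrow> 'm set"
  Ident :: "'o \<Rightarrow> 'm"
  Comp :: "'o \<Rightarrow> 'o \<Rightarrow> 'o \<Rightarrow> 'm \<Rightarrow> 'm \<Rightarrow> 'm"

definition category :: "('o, 'm) cat \<Rightarrow> bool" where
  "category C \<longleftrightarrow>
    (\<forall>X\<in>Ob C. Ident C X \<in> Hom C X X) \<and>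
    (\<forall>X\<in>Ob C. \<forall>Y\<in>Ob C. \<forall>Z\<in>Ob C. \<forall>f\<in>Hom C X Y. \<forall>g\<in>Hom C Y Z. Comp C X Y Z g f \<in> Hom C X Z) \<and>
    (\<forall>X\<in>Ob C. \<forall>Y\<in>Ob C. \<forall>f\<in>Hom C X Y.
      Comp C X X Y f (Ident C X) = f \<and> Comp C X Y Y (Ident C Y) f = f) \<and>
    (\<forall>W\<in>Ob C. \<forall>X\<in>Ob C. \<forall>Y\<in>Ob C. \<forall>Z\<in>Ob C. \<forall>f\<in>Hom C W X. \<forall>g\<in>Hom C X Y. \<forall>h\<in>Hom C Y Z.
      Comp C W Y Z h (Comp C W X Y g f) = Comp C W X Z (Comp C X Y Z h g) f)"

definition is_functor ::
  "('o, 'm) cat \<Rightarrow> ('p, 'n) cat \<Rightarrow> ('o \<Rightarrow> 'p) \<Rightarrow> ('o \<Rightarrow> 'o \<Rightarrow> 'm \<Rightarrow> 'n) \<Rightarrow> bool" where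
  "is_functor C D F F1 \<longleftrightarrow>
    (\<forall>X\<in>Ob C. F X \<in> Ob D) \<and>
    (\<forall>X\<in>Ob C. \<forall>Y\<in>Ob C. \<forall>f\<in>Hom C X Y. F1 X Y f \<in> Hom D (F X) (F Y)) \<and>
    (\<forall>X\<in>Ob C. F1 X X (Ident C X) = Ident D (F X)) \<and>
    (\<forall>X\<in>Ob C. \<forall>Y\<in>Ob C. \<forall>Z\<in>Ob C. \<forall>f\<in>Hom C X Y. \<forall>g\<in>Hom C Y Z.
      F1 X Z (Comp C X Y Z g f) = Comp D (F X) (F Y) (F Z) (F1 Y Z g) (F1 X Y f))"

definition is_iso :: "('o, 'm) cat \<Rightarrow> 'o \<Rightarrow> 'o \<Rightarrow> 'm \<Rightarrow> bool" where
  "is_iso C X Y f \<longleftrightarrow> f \<in> Hom C X Y \<and>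
    (\<exists>g\<in>Hom C Y X. Comp C X Y X g f = Ident C X \<and> Comp C Y X Y f g = Ident C Y)"

definition nat_iso ::
  "('o, 'm) cat \<Rightarrow> ('p, 'n) cat \<Rightarrow> ('o \<Rightarrow> 'p) \<Rightarrow> ('o \<Rightarrow> 'o \<Rightarrow> 'm \<Rightarrow> 'n) \<Rightarrow>
    ('o \<Rightarrow> 'p) \<Rightarrow> ('o \<Rightarrow> 'o \<Rightarrow> 'm \<Rightarrow> 'n) \<Rightarrow> ('o \<Rightarrow> 'n) \<Rightarrow> bool" where
  "nat_iso C D F F1 G G1 \<eta> \<longleftrightarrow>
    (\<forall>X\<in>Ob C. is_iso D (F X) (G X) (\<eta> X)) \<and>
    (\<forall>X\<in>Ob C. \<forall>Y\<in>Ob C. \<forall>f\<in>Hom C X Y.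
      Comp D (F X) (F Y) (G Y) (\<eta> Y) (F1 X Y f) = Comp D (F X) (G X) (G Y) (G1 X Y f) (\<eta> X))"

definition equivalent_categories :: "('o, 'm) cat \<Rightarrow> ('p, 'n) cat \<Rightarrow> bool" where
  "equivalent_categories C D \<longleftrightarrow> category C \<and> category D \<and>
    (\<exists>F F1 G G1 \<eta> \<epsilon>. is_functor C D F F1 \<and> is_functor D C G G1 \<and>
      nat_iso C C (\<lambda>X. G (F X)) (\<lambda>X Y f. G1 (F X) (F Y) (F1 X Y f)) (\<lambda>X. X) (\<lambda>X Y f. f) \<eta> \<and>
      nat_iso D D (\<lambda>X. F (G X)) (\<lambda>X Y f. F1 (G X) (G Y) (G1 X Y f)) (\<lambda>X. X) (\<lambda>X Y f. f) \<epsilon>)"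

definition is_zero_object :: "('o, 'm) cat \<Rightarrow> 'o \<Rightarrow> bool" where
  "is_zero_object C Z \<longleftrightarrow> Z \<in> Ob C \<and>
    (\<forall>X\<in>Ob C. (\<exists>!f. f \<in> Hom C X Z) \<and> (\<exists>!f. f \<in> Hom C Z X))"

definition is_zero_arrow :: "('o, 'm) cat \<Rightarrow> 'o \<Rightarrow> 'o \<Rightarrow> 'm \<Rightarrow> bool" where
  "is_zero_arrow C X Y f \<longleftrightarrow>
    (\<exists>Z. is_zero_object C Z \<and> (\<exists>g\<in>Hom C X Z. \<exists>h\<in>Hom C Z Y. f = Comp C X Z Y h g))"

definition is_kernel :: "('o, 'm) cat \<Rightarrow> 'o \<Rightarrow> 'o \<Rightarrow> 'm \<Rightarrow> 'o \<Rightarrow> 'm \<Rightarrow> bool" where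
  "is_kernel C X Y f K i \<longleftrightarrow> K \<in> Ob C \<and> i \<in> Hom C K X \<and>
    is_zero_arrow C K Y (Comp C K X Y f i) \<and>
    (\<forall>L\<in>Ob C. \<forall>g\<in>Hom C L X. is_zero_arrow C L Y (Comp C L X Y f g) \<longrightarrow>
      (\<exists>!u. u \<in> Hom C L K \<and> Comp C L K X i u = g))"

definition is_cokernel :: "('o, 'm) cat \<Rightarrow> 'o \<Rightarrow> 'o \<Rightarrow> 'm \<Rightarrow> 'o \<Rightarrow> 'm \<Rightarrow> bool" where
  "is_cokernel C X Y f K p \<longleftrightarrow> K \<in> Ob C \<and> p \<in> Hom C Y K \<and>
    is_zero_arrow C X K (Comp C X Y K p f) \<and>
    (\<forall>L\<in>Ob C. \<forall>g\<in>Hom C Y L. is_zero_arrow C X L (Comp C X Y L g f) \<longrightarrow>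
      (\<exists>!u. u \<in> Hom C K L \<and> Comp C Y K L u p = g))"

text \<open>
  The localization \<open>C[W\<^sup>-\<^sup>1]\<close> of Gabriel and Zisman. Its morphisms are zigzags of
  arrows of \<open>C\<close> and formal inverses of arrows in \<open>W\<close> (listed in the order in which they are
  traversed), modulo the congruence that makes \<open>C \<rightarrow> C[W\<^sup>-\<^sup>1]\<close> a functor and the formal
  inverses inverses. \<open>Bwd X Y s\<close> is the inverse, from \<open>Y\<close> to \<open>X\<close>, of \<open>s : X \<rightarrow> Y\<close>.
\<close>

datatype ('o, 'm) arrow_step = Fwd 'o 'o 'm | Bwd 'o 'o 'm

inductive zigzag ::
  "('o, 'm) cat \<Rightarrow> ('o \<Rightarrow> 'o \<Rightarrow> 'm \<Rightarrow> bool) \<Rightarrow> 'o \<Rightarrow> ('o, 'm) arrow_step list \<Rightarrow> 'o \<Rightarrow> bool"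
  for C W where
  nil: "X \<in> Ob C \<Longrightarrow> zigzag C W X [] X"
| fwd: "X \<in> Ob C \<Longrightarrow> f \<in> Hom C X Y \<Longrightarrow> zigzag C W Y p Z \<Longrightarrow> zigzag C W X (Fwd X Y f # p) Z"
| bwd: "Y \<in> Ob C \<Longrightarrow> s \<in> Hom C X Y \<Longrightarrow> W X Y s \<Longrightarrow> zigzag C W X p Z \<Longrightarrow> zigzag C W Y (Bwd X Y s # p) Z"

inductive zigzag_eq ::
  "('o, 'm) cat \<Rightarrow> ('o \<Rightarrow> 'o \<Rightarrow> 'm \<Rightarrow> bool) \<Rightarrow> 'o \<Rightarrow> 'o \<Rightarrow>
    ('o, 'm) arrow_step list \<Rightarrow> ('o, 'm) arrow_step list \<Rightarrow> bool"
  for C W where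
  refl: "zigzag C W X p Y \<Longrightarrow> zigzag_eq C W X Y p p"
| sym: "zigzag_eq C W X Y p q \<Longrightarrow> zigzag_eq C W X Y q p"
| trans: "zigzag_eq C W X Y p q \<Longrightarrow> zigzag_eq C W X Y q r \<Longrightarrow> zigzag_eq C W X Y p r"
| congr: "zigzag C W X p X' \<Longrightarrow> zigzag_eq C W X' Y' q q' \<Longrightarrow> zigzag C W Y' r Y \<Longrightarrow>
    zigzag_eq C W X Y (p @ q @ r) (p @ q' @ r)"
| ident: "X \<in> Ob C \<Longrightarrow> zigzag_eq C W X X [Fwd X X (Ident C X)] []"
| comp: "X \<in> Ob C \<Longrightarrow> Y \<in> Ob C \<Longrightarrow> Z \<in> Ob C \<Longrightarrow> f \<in> Hom C X Y \<Longrightarrow> g \<in> Hom C Y Z \<Longrightarrow>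
    zigzag_eq C W X Z [Fwd X Y f, Fwd Y Z g] [Fwd X Z (Comp C X Y Z g f)]"
| cancel: "X \<in> Ob C \<Longrightarrow> Y \<in> Ob C \<Longrightarrow> s \<in> Hom C X Y \<Longrightarrow> W X Y s \<Longrightarrow>
    zigzag_eq C W X X [Fwd X Y s, Bwd X Y s] []"
| cancel': "X \<in> Ob C \<Longrightarrow> Y \<in> Ob C \<Longrightarrow> s \<in> Hom C X Y \<Longrightarrow> W X Y s \<Longrightarrow>
    zigzag_eq C W Y Y [Bwd X Y s, Fwd X Y s] []"

definition localization ::
  "('o, 'm) cat \<Rightarrow> ('o \<Rightarrow> 'o \<Rightarrow> 'm \<Rightarrow> bool) \<Rightarrow> ('o, ('o, 'm) arrow_step list set) cat" where
  "localization C W =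
    \<lparr> Ob = Ob C,
      Hom = (\<lambda>X Y. {p. zigzag C W X p Y} // {(p, q). zigzag_eq C W X Y p q}),
      Ident = (\<lambda>X. {q. zigzag_eq C W X X [] q}),
      Comp = (\<lambda>X Y Z \<psi> \<phi>. \<Union>p\<in>\<phi>. \<Union>q\<in>\<psi>. {r. zigzag_eq C W X Z (p @ q) r}) \<rparr>"

text \<open>
  The quotient of an abelian category \<open>C\<close> by a Serre subcategory with object class \<open>T\<close>:
  the localization at the arrows whose kernel and cokernel lie in \<open>T\<close>.
\<close>

definition serre_quotient ::
  "('o, 'm) cat \<Rightarrow> 'o set \<Rightarrow> ('o, ('o, 'm) arrow_step list set) cat" where
  "serre_quotient C T = localization C (\<lambda>X Y s.
    (\<exists>K i. is_kernel C X Y s K i \<and> K \<in> T) \<and> (\<exists>K p. is_cokernel C X Y s K p \<and> K \<in> T))"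


section \<open>Families of abelian groups with an action\<close>

text \<open>
  The common data of the two kinds of graded right modules below: \<open>piece X i\<close> is the abelian
  group \<open>X\<^sub>i\<close> (of the ring record only the additive part is used, as in the record of modules
  of the library) and \<open>action X i j x a\<close> is \<open>x a\<close>, for \<open>x\<close> in \<open>X\<^sub>i\<close> and \<open>a\<close> in \<open>A\<^sub>j\<close> (graded
  algebra, with value in \<open>X\<^bsub>i+j\<^esub>\<close>) or in \<open>A\<^sub>i\<^sub>j\<close> (\<open>\<int>\<close>-algebra, with value in \<open>X\<^sub>j\<close>).
\<close>

record ('a, 'u) gmod =
  piece :: "int \<Rightarrow> 'u ring"
  action :: "int \<Rightarrow> int \<Rightarrow> 'u \<Rightarrow> 'a \<Rightarrow> 'u"

type_synonym ('u, 'w) gmap = "int \<Rightarrow> 'u \<Rightarrow> 'w"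

definition additive_family :: "('a, 'u) gmod \<Rightarrow> ('a, 'w) gmod \<Rightarrow> ('u, 'w) gmap set" where
  "additive_family X Y = {f. \<forall>i. f i \<in> extensional (carrier (piece X i)) \<and>
    f i \<in> hom (add_monoid (piece X i)) (add_monoid (piece Y i))}"

definition surjective_family :: "('a, 'u) gmod \<Rightarrow> ('a, 'w) gmod \<Rightarrow> ('u, 'w) gmap \<Rightarrow> bool" where
  "surjective_family X Y f \<longleftrightarrow> (\<forall>i. f i ` carrier (piece X i) = carrier (piece Y i))"

definition kernel_module ::
  "('a, 'u) gmod \<Rightarrow> ('a, 'w) gmod \<Rightarrow> ('u, 'w) gmap \<Rightarrow> ('a, 'u) gmod" where
  "kernel_module X Y f =
    \<lparr> piece = (\<lambda>i. (piece X i)\<lparr>carrier := a_kernel (piece X i) (piece Y i) (f i)\<rparr>),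
      action = action X \<rparr>"

definition right_bounded :: "('a, 'u) gmod \<Rightarrow> bool" where
  "right_bounded X \<longleftrightarrow> (\<exists>m0. \<forall>m\<ge>m0. carrier (piece X m) = {\<zero>\<^bsub>piece X m\<^esub>})"

definition module_category ::
  "('a, 'u) gmod set \<Rightarrow> (('a, 'u) gmod \<Rightarrow> ('a, 'u) gmod \<Rightarrow> ('u, 'u) gmap set) \<Rightarrow>
    (('a, 'u) gmod, ('u, 'u) gmap) cat" where
  "module_category Obs Homs =
    \<lparr> Ob = Obs,
      Hom = Homs,
      Ident = (\<lambda>X i. \<lambda>x\<in>carrier (piece X i). x),
      Comp = (\<lambda>X Y Z g f i. compose (carrier (piece X i)) (g i) (f i)) \<rparr>"


section \<open>Graded right modules over a graded algebra\<close>

record 'a graded_ring = "'a ring" +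
  grade :: "int \<Rightarrow> 'a set"

definition gr_module :: "'a graded_ring \<Rightarrow> ('a, 'u) gmod \<Rightarrow> bool" where
  "gr_module A X \<longleftrightarrow>
    (\<forall>i. abelian_group (piece X i)) \<and>
    (\<forall>i d. \<forall>x\<in>carrier (piece X i). \<forall>a\<in>grade A d. action X i d x a \<in> carrier (piece X (i + d))) \<and>
    (\<forall>i d. \<forall>x\<in>carrier (piece X i). \<forall>y\<in>carrier (piece X i). \<forall>a\<in>grade A d.
      action X i d (x \<oplus>\<^bsub>piece X i\<^esub> y) a = action X i d x a \<oplus>\<^bsub>piece X (i + d)\<^esub> action X i d y a) \<and>
    (\<forall>i d. \<forall>x\<in>carrier (piece X i). \<forall>a\<in>grade A d. \<forall>b\<in>grade A d.
      action X i d x (a \<oplus>\<^bsub>A\<^esub> b) = action X i d x a \<oplus>\<^bsub>piece X (i + d)\<^esub> action X i d x b) \<and>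
    (\<forall>i d e. \<forall>x\<in>carrier (piece X i). \<forall>a\<in>grade A d. \<forall>b\<in>grade A e.
      action X (i + d) e (action X i d x a) b = action X i (d + e) x (a \<otimes>\<^bsub>A\<^esub> b)) \<and>
    (\<forall>i. \<forall>x\<in>carrier (piece X i). action X i 0 x \<one>\<^bsub>A\<^esub> = x)"

definition gr_hom ::
  "'a graded_ring \<Rightarrow> ('a, 'u) gmod \<Rightarrow> ('a, 'w) gmod \<Rightarrow> ('u, 'w) gmap set" where
  "gr_hom A X Y = {f \<in> additive_family X Y. \<forall>i d. \<forall>x\<in>carrier (piece X i). \<forall>a\<in>grade A d.
    f (i + d) (action X i d x a) = action Y i d (f i x) a}"

text \<open>The direct sum of the modules \<open>A(-d)\<close>, with \<open>A(-d)\<^sub>j = A\<^bsub>j-d\<^esub>\<close>, over the entries \<open>d\<close> of a list.\<close>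

definition gr_free :: "'a graded_ring \<Rightarrow> int list \<Rightarrow> ('a, nat \<Rightarrow> 'a) gmod" where
  "gr_free A ds =
    \<lparr> piece = (\<lambda>j. \<lparr> carrier = (\<Pi>\<^sub>E p\<in>{..<length ds}. grade A (j - ds ! p)),
        mult = undefined, one = undefined,
        zero = (\<lambda>p\<in>{..<length ds}. \<zero>\<^bsub>A\<^esub>),
        add = (\<lambda>x y. \<lambda>p\<in>{..<length ds}. x p \<oplus>\<^bsub>A\<^esub> y p) \<rparr>),
      action = (\<lambda>i d x a. \<lambda>p\<in>{..<length ds}. x p \<otimes>\<^bsub>A\<^esub> a) \<rparr>"

definition gr_fg :: "'a graded_ring \<Rightarrow> ('a, 'u) gmod \<Rightarrow> bool" where
  "gr_fg A X \<longleftrightarrow> (\<exists>ds. \<exists>h\<in>gr_hom A (gr_free A ds) X. surjective_family (gr_free A ds) X h)"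

definition gr_coherent :: "'a graded_ring \<Rightarrow> ('a, 'u) gmod \<Rightarrow> bool" where
  "gr_coherent A X \<longleftrightarrow> gr_fg A X \<and>
    (\<forall>ds. \<forall>h\<in>gr_hom A (gr_free A ds) X. gr_fg A (kernel_module (gr_free A ds) X h))"

text \<open>
  In the two quotient categories below the groups \<open>X\<^sub>i\<close> have their elements in the universe type
  \<open>'u\<close>. Every coherent module occurs up to isomorphism once \<open>'u\<close> is infinite and at least as
  large as the ground field (the pieces of a coherent module are finite-dimensional vector
  spaces in the cases considered here).
\<close>

definition cohproj ::
  "'u itself \<Rightarrow> 'a graded_ring \<Rightarrow>
    (('a, 'u) gmod, (('a, 'u) gmod, ('u, 'u) gmap) arrow_step list set) cat" where
  "cohproj U A = serre_quotient
    (module_category {X. gr_module A X \<and> gr_coherent A X} (gr_hom A))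
    {X. gr_module A X \<and> gr_coherent A X \<and> right_bounded X}"


section \<open>Graded right modules over a \<open>\<int>\<close>-algebra\<close>

text \<open>\<open>zpart A i j\<close> is \<open>A\<^sub>i\<^sub>j\<close>, \<open>zmult A i j l\<close> the product \<open>A\<^sub>i\<^sub>j \<times> A\<^sub>j\<^sub>l \<rightarrow> A\<^sub>i\<^sub>l\<close>, \<open>zunit A i\<close> is \<open>e\<^sub>i\<close>.\<close>

record ('k, 'a) zalgebra =
  zpart :: "int \<Rightarrow> int \<Rightarrow> ('k, 'a) module"
  zmult :: "int \<Rightarrow> int \<Rightarrow> int \<Rightarrow> 'a \<Rightarrow> 'a \<Rightarrow> 'a"
  zunit :: "int \<Rightarrow> 'a"

definition z_module :: "('k, 'a) zalgebra \<Rightarrow> ('a, 'u) gmod \<Rightarrow> bool" where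
  "z_module A X \<longleftrightarrow>
    (\<forall>i. abelian_group (piece X i)) \<and>
    (\<forall>i j. \<forall>x\<in>carrier (piece X i). \<forall>a\<in>carrier (zpart A i j). action X i j x a \<in> carrier (piece X j)) \<and>
    (\<forall>i j. \<forall>x\<in>carrier (piece X i). \<forall>y\<in>carrier (piece X i). \<forall>a\<in>carrier (zpart A i j).
      action X i j (x \<oplus>\<^bsub>piece X i\<^esub> y) a = action X i j x a \<oplus>\<^bsub>piece X j\<^esub> action X i j y a) \<and>
    (\<forall>i j. \<forall>x\<in>carrier (piece X i). \<forall>a\<in>carrier (zpart A i j). \<forall>b\<in>carrier (zpart A i j).
      action X i j x (a \<oplus>\<^bsub>zpart A i j\<^esub> b) = action X i j x a \<oplus>\<^bsub>piece X j\<^esub> action X i j x b) \<and>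
    (\<forall>i j l. \<forall>x\<in>carrier (piece X i). \<forall>a\<in>carrier (zpart A i j). \<forall>b\<in>carrier (zpart A j l).
      action X j l (action X i j x a) b = action X i l x (zmult A i j l a b)) \<and>
    (\<forall>i. \<forall>x\<in>carrier (piece X i). action X i i x (zunit A i) = x)"

definition z_hom ::
  "('k, 'a) zalgebra \<Rightarrow> ('a, 'u) gmod \<Rightarrow> ('a, 'w) gmod \<Rightarrow> ('u, 'w) gmap set" where
  "z_hom A X Y = {f \<in> additive_family X Y.
    \<forall>i j. \<forall>x\<in>carrier (piece X i). \<forall>a\<in>carrier (zpart A i j).
      f j (action X i j x a) = action Y i j (f i x) a}"

text \<open>The direct sum of the modules \<open>P\<^sub>d = e\<^sub>d A\<close> over the entries \<open>d\<close> of a list.\<close>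

definition z_free :: "('k, 'a) zalgebra \<Rightarrow> int list \<Rightarrow> ('a, nat \<Rightarrow> 'a) gmod" where
  "z_free A ds =
    \<lparr> piece = (\<lambda>j. \<lparr> carrier = (\<Pi>\<^sub>E p\<in>{..<length ds}. carrier (zpart A (ds ! p) j)),
        mult = undefined, one = undefined,
        zero = (\<lambda>p\<in>{..<length ds}. \<zero>\<^bsub>zpart A (ds ! p) j\<^esub>),
        add = (\<lambda>x y. \<lambda>p\<in>{..<length ds}. x p \<oplus>\<^bsub>zpart A (ds ! p) j\<^esub> y p) \<rparr>),
      action = (\<lambda>i j x a. \<lambda>p\<in>{..<length ds}. zmult A (ds ! p) i j (x p) a) \<rparr>"

definition z_fg :: "('k, 'a) zalgebra \<Rightarrow> ('a, 'u) gmod \<Rightarrow> bool" where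
  "z_fg A X \<longleftrightarrow> (\<exists>ds. \<exists>h\<in>z_hom A (z_free A ds) X. surjective_family (z_free A ds) X h)"

definition z_coherent :: "('k, 'a) zalgebra \<Rightarrow> ('a, 'u) gmod \<Rightarrow> bool" where
  "z_coherent A X \<longleftrightarrow> z_fg A X \<and>
    (\<forall>ds. \<forall>h\<in>z_hom A (z_free A ds) X. z_fg A (kernel_module (z_free A ds) X h))"

definition z_cohproj ::
  "'u itself \<Rightarrow> ('k, 'a) zalgebra \<Rightarrow>
    (('a, 'u) gmod, (('a, 'u) gmod, ('u, 'u) gmap) arrow_step list set) cat" where
  "z_cohproj U A = serre_quotient
    (module_category {X. z_module A X \<and> z_coherent A X} (z_hom A))
    {X. z_module A X \<and> z_coherent A X \<and> right_bounded X}"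


section \<open>Formal combinations of words\<close>

definition word_scale :: "'k::field \<Rightarrow> ('x list \<Rightarrow>\<^sub>0 'k) \<Rightarrow> ('x list \<Rightarrow>\<^sub>0 'k)" where
  "word_scale c f = Poly_Mapping.map (\<lambda>x. c * x) f"

text \<open>The bilinear extension of concatenation.\<close>

definition word_mult :: "('x list \<Rightarrow>\<^sub>0 'k::field) \<Rightarrow> ('x list \<Rightarrow>\<^sub>0 'k) \<Rightarrow> ('x list \<Rightarrow>\<^sub>0 'k)" where
  "word_mult f g = (\<Sum>u\<in>Poly_Mapping.keys f. \<Sum>v\<in>Poly_Mapping.keys g.
    Poly_Mapping.single (u @ v) (Poly_Mapping.lookup f u * Poly_Mapping.lookup g v))"


section \<open>The category \<open>P\<^sup>1\<^sub>n\<close>\<close>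

text \<open>The word \<open>[i\<^sub>1, \<dots>, i\<^sub>m]\<close> with letters in \<open>{1..n}\<close> stands for the monomial \<open>x\<^sub>i\<^sub>1 \<cdots> x\<^sub>i\<^sub>m\<close>.\<close>

definition free_algebra :: "nat \<Rightarrow> (nat list \<Rightarrow>\<^sub>0 'k::field) ring" where
  "free_algebra n =
    \<lparr> carrier = {f. Poly_Mapping.keys f \<subseteq> lists {1..n}},
      mult = word_mult, one = Poly_Mapping.single [] 1, zero = 0, add = (+) \<rparr>"

definition free_grade :: "nat \<Rightarrow> int \<Rightarrow> (nat list \<Rightarrow>\<^sub>0 'k::field) set" where
  "free_grade n d =
    {f \<in> carrier (free_algebra n). \<forall>w\<in>Poly_Mapping.keys f. int (length w) = d}"

definition graded_automorphism ::
  "nat \<Rightarrow> ((nat list \<Rightarrow>\<^sub>0 'k::field) \<Rightarrow> (nat list \<Rightarrow>\<^sub>0 'k)) \<Rightarrow> bool" where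
  "graded_automorphism n \<sigma> \<longleftrightarrow>
    \<sigma> \<in> ring_iso (free_algebra n) (free_algebra n) \<and>
    (\<forall>c. \<sigma> (Poly_Mapping.single [] c) = Poly_Mapping.single [] c) \<and>
    (\<forall>d. \<sigma> ` free_grade n d = free_grade n d)"

definition relator ::
  "nat \<Rightarrow> ((nat list \<Rightarrow>\<^sub>0 'k::field) \<Rightarrow> (nat list \<Rightarrow>\<^sub>0 'k)) \<Rightarrow> (nat list \<Rightarrow>\<^sub>0 'k)" where
  "relator n \<sigma> = (\<Sum>i=1..n.
    word_mult (Poly_Mapping.single [i] 1) (\<sigma> (Poly_Mapping.single [n + 1 - i] 1)))"

definition P1_algebra ::
  "nat \<Rightarrow> ((nat list \<Rightarrow>\<^sub>0 'k::field) \<Rightarrow> (nat list \<Rightarrow>\<^sub>0 'k)) \<Rightarrow> (nat list \<Rightarrow>\<^sub>0 'k) set graded_ring" where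
  "P1_algebra n \<sigma> =
    (let F = free_algebra n; I = Idl\<^bsub>F\<^esub> {relator n \<sigma>}
     in ring.extend (F Quot I) \<lparr> grade = (\<lambda>d. (\<lambda>f. I +>\<^bsub>F\<^esub> f) ` free_grade n d) \<rparr>)"

definition P1 where
  "P1 U n \<sigma> = cohproj U (P1_algebra n \<sigma>)"


section \<open>Vector spaces and their iterated duals\<close>

definition ground :: "'k::field ring" where
  "ground = \<lparr> carrier = UNIV, mult = (*), one = 1, zero = 0, add = (+) \<rparr>"

definition is_basis :: "('k::field, 'v) module \<Rightarrow> 'v set \<Rightarrow> bool" where
  "is_basis V B \<longleftrightarrow> finite B \<and> B \<subseteq> carrier V \<and>
    (\<forall>v\<in>carrier V. \<exists>!a. a \<in> extensional B \<and> v = (\<Oplus>\<^bsub>V\<^esub>b\<in>B. a b \<odot>\<^bsub>V\<^esub> b))"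

definition vector_space_of_dim :: "('k::field, 'v) module \<Rightarrow> nat \<Rightarrow> bool" where
  "vector_space_of_dim V n \<longleftrightarrow> module ground V \<and> (\<exists>B. is_basis V B \<and> card B = n)"

definition functionals :: "('k::field, 'v) module \<Rightarrow> ('v \<Rightarrow> 'k) set" where
  "functionals V = {f \<in> extensional (carrier V).
    (\<forall>x\<in>carrier V. \<forall>y\<in>carrier V. f (x \<oplus>\<^bsub>V\<^esub> y) = f x + f y) \<and>
    (\<forall>c. \<forall>x\<in>carrier V. f (c \<odot>\<^bsub>V\<^esub> x) = c * f x)}"

text \<open>
  All iterated duals of \<open>V\<close> have to live in one type. A finite-dimensional space has no fewer
  elements than its dual, so the functionals can be stored, by an arbitrary injection, in the
  type of the elements of \<open>V\<close>; the linear structure of \<open>dual V\<close> is that of the functionals, and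
  \<open>functional_of V \<phi>\<close> is the functional stored as \<open>\<phi>\<close>.
\<close>

definition dual_code :: "('k::field, 'v) module \<Rightarrow> ('v \<Rightarrow> 'k) \<Rightarrow> 'v" where
  "dual_code V = (SOME c. inj_on c (functionals V))"

definition functional_of :: "('k::field, 'v) module \<Rightarrow> 'v \<Rightarrow> ('v \<Rightarrow> 'k)" where
  "functional_of V = inv_into (functionals V) (dual_code V)"

definition dual :: "('k::field, 'v) module \<Rightarrow> ('k, 'v) module" where
  "dual V =
    \<lparr> carrier = dual_code V ` functionals V, mult = undefined, one = undefined,
      zero = dual_code V (\<lambda>x\<in>carrier V. 0),
      add = (\<lambda>\<phi> \<psi>. dual_code V (\<lambda>x\<in>carrier V. functional_of V \<phi> x + functional_of V \<psi> x)),
      smult = (\<lambda>c \<phi>. dual_code V (\<lambda>x\<in>carrier V. c * functional_of V \<phi> x)) \<rparr>"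

lemma functional_finsum:
  fixes V :: "('k::field, 'v) module"
  assumes V: "module ground V" and f: "f \<in> functionals V"
    and "finite B" "B \<subseteq> carrier V"
  shows "f (\<Oplus>\<^bsub>V\<^esub>b\<in>B. a b \<odot>\<^bsub>V\<^esub> b) = (\<Sum>b\<in>B. a b * f b)"
proof -
  interpret V: module "ground :: 'k ring" V by (fact V)
  have smult_closed: "c \<odot>\<^bsub>V\<^esub> x \<in> carrier V" if "x \<in> carrier V" for c x
    using V.smult_closed[of c x] that by (simp add: ground_def)
  have f0: "f \<zero>\<^bsub>V\<^esub> = 0"
  proof -
    have "f (\<zero>\<^bsub>V\<^esub> \<oplus>\<^bsub>V\<^esub> \<zero>\<^bsub>V\<^esub>) = f \<zero>\<^bsub>V\<^esub> + f \<zero>\<^bsub>V\<^esub>"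
      using f V.zero_closed unfolding functionals_def by blast
    then show ?thesis
      by (metis V.r_zero V.zero_closed add_cancel_right_right)
  qed
  show ?thesis
    using \<open>finite B\<close> \<open>B \<subseteq> carrier V\<close>
  proof (induction B rule: finite_induct)
    case empty
    then show ?case by (simp add: f0)
  next
    case (insert x B)
    have closed: "(\<Oplus>\<^bsub>V\<^esub>b\<in>B. a b \<odot>\<^bsub>V\<^esub> b) \<in> carrier V"
      using insert.prems smult_closed by (intro V.finsum_closed) auto
    have "(\<Oplus>\<^bsub>V\<^esub>b\<in>insert x B. a b \<odot>\<^bsub>V\<^esub> b) = a x \<odot>\<^bsub>V\<^esub> x \<oplus>\<^bsub>V\<^esub> (\<Oplus>\<^bsub>V\<^esub>b\<in>B. a b \<odot>\<^bsub>V\<^esub> b)"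
      using insert smult_closed by (intro V.finsum_insert) auto
    then show ?case
      using insert f closed smult_closed by (simp add: functionals_def)
  qed
qed

lemma inj_on_dual_code:
  fixes V :: "('k::field, 'v) module"
  assumes V: "module ground V" and B: "is_basis V B"
  shows "inj_on (dual_code V) (functionals V)"
proof -
  interpret V: module "ground :: 'k ring" V by (fact V)
  have smult_closed: "c \<odot>\<^bsub>V\<^esub> x \<in> carrier V" if "x \<in> carrier V" for c x
    using V.smult_closed[of c x] that by (simp add: ground_def)
  have fin: "finite B" and sub: "B \<subseteq> carrier V"
    and uniq: "\<And>v. v \<in> carrier V \<Longrightarrow>
      \<exists>!a. a \<in> extensional B \<and> v = (\<Oplus>\<^bsub>V\<^esub>b\<in>B. a b \<odot>\<^bsub>V\<^esub> b)"
    using B by (auto simp: is_basis_def)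
  define c where "c f = (\<Oplus>\<^bsub>V\<^esub>b\<in>B. f b \<odot>\<^bsub>V\<^esub> b)" for f :: "'v \<Rightarrow> 'k"
  have c_closed: "c f \<in> carrier V" for f
    unfolding c_def using sub smult_closed by (intro V.finsum_closed) auto
  have c_restrict: "c (restrict f B) = c f" for f
    unfolding c_def using sub smult_closed by (intro V.finsum_cong') auto
  have "inj_on c (functionals V)"
  proof (rule inj_onI)
    fix f g assume f: "f \<in> functionals V" and g: "g \<in> functionals V" and eq: "c f = c g"
    have "\<exists>!a. a \<in> extensional B \<and> c f = c a"
      using uniq[OF c_closed[of f]] unfolding c_def .
    moreover have "c f = c (restrict f B)" "c f = c (restrict g B)"
      by (simp_all only: c_restrict eq)
    moreover have "restrict f B \<in> extensional B" "restrict g B \<in> extensional B"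
      by (rule restrict_extensional)+
    ultimately have "restrict f B = restrict g B"
      by blast
    then have on_B: "f b = g b" if "b \<in> B" for b
      using that by (metis restrict_apply')
    have "f v = g v" if v: "v \<in> carrier V" for v
    proof -
      from uniq[OF v] obtain a where "v = (\<Oplus>\<^bsub>V\<^esub>b\<in>B. a b \<odot>\<^bsub>V\<^esub> b)"
        by blast
      then show ?thesis
        using functional_finsum[OF V f fin sub] functional_finsum[OF V g fin sub] on_B
        by (simp cong: sum.cong)
    qed
    then show "f = g"
      using f g by (intro extensionalityI[of _ "carrier V"]) (auto simp: functionals_def)
  qed
  then show ?thesis
    unfolding dual_code_def by (rule someI[of "\<lambda>c. inj_on c (functionals V)"])
qed

text \<open>
  \<open>iterated_dual V i\<close> is \<open>V\<^bsup>i*\<^esup>\<close>. Left and right duals are both the \<open>k\<close>-dual, so for negative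
  \<open>i\<close> one dualizes \<open>-i\<close> times; there \<open>V\<^bsup>i*\<^esup>\<close> is the dual of \<open>V\<^bsup>(i+1)*\<^esup>\<close>, and
  the latter is identified with the dual of the former by evaluation, so that \<open>pairing V i\<close> is
  the canonical pairing of \<open>V\<^bsup>i*\<^esup>\<close> with \<open>V\<^bsup>(i+1)*\<^esup>\<close> in all cases.
\<close>

definition iterated_dual :: "('k::field, 'v) module \<Rightarrow> int \<Rightarrow> ('k, 'v) module" where
  "iterated_dual V i = (dual ^^ nat \<bar>i\<bar>) V"

definition pairing :: "('k::field, 'v) module \<Rightarrow> int \<Rightarrow> 'v \<Rightarrow> 'v \<Rightarrow> 'k" where
  "pairing V i x y =
    (if 0 \<le> i then functional_of (iterated_dual V i) y x
     else functional_of (iterated_dual V (i + 1)) x y)"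


section \<open>The noncommutative symmetric algebra\<close>

definition subspace_span :: "('k::field, 'a) module \<Rightarrow> 'a set \<Rightarrow> 'a set" where
  "subspace_span M S = \<Inter>{H. submodule H ground M \<and> S \<subseteq> H}"

definition quotient_space :: "('k::field, 'a) module \<Rightarrow> 'a set \<Rightarrow> ('k, 'a set) module" where
  "quotient_space M N =
    \<lparr> carrier = a_rcosets\<^bsub>M\<^esub> N, mult = undefined, one = undefined,
      zero = N, add = set_add M,
      smult = (\<lambda>c C. \<Union>x\<in>C. N +>\<^bsub>M\<^esub> (c \<odot>\<^bsub>M\<^esub> x)) \<rparr>"

text \<open>
  \<open>T\<^sub>i\<^sub>j\<close>, the tensor product of the spaces \<open>V\<^bsup>p*\<^esup>\<close> for \<open>i \<le> p < j\<close>, is the vector space with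
  basis the tuples \<open>[v\<^sub>i, \<dots>, v\<^bsub>j-1\<^esub>]\<close> modulo the relations of multilinearity. For \<open>i = j\<close> the
  only tuple is the empty one and \<open>T\<^sub>i\<^sub>i = k\<close>; for \<open>i > j\<close> there is none and \<open>T\<^sub>i\<^sub>j = 0\<close>.
\<close>

definition tuples :: "('k::field, 'v) module \<Rightarrow> int \<Rightarrow> int \<Rightarrow> 'v list set" where
  "tuples V i j = {vs. int (length vs) = j - i \<and>
    (\<forall>p<length vs. vs ! p \<in> carrier (iterated_dual V (i + int p)))}"

definition tuple_space :: "('k::field, 'v) module \<Rightarrow> int \<Rightarrow> int \<Rightarrow> ('k, 'v list \<Rightarrow>\<^sub>0 'k) module" where
  "tuple_space V i j =
    \<lparr> carrier = {f. Poly_Mapping.keys f \<subseteq> tuples V i j}, mult = undefined, one = undefined,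
      zero = 0, add = (+), smult = word_scale \<rparr>"

definition multilinear_relations ::
  "('k::field, 'v) module \<Rightarrow> int \<Rightarrow> int \<Rightarrow> ('v list \<Rightarrow>\<^sub>0 'k) set" where
  "multilinear_relations V i j = subspace_span (tuple_space V i j)
    ({Poly_Mapping.single (us @ (x \<oplus>\<^bsub>iterated_dual V (i + int (length us))\<^esub> y) # vs) 1
        - Poly_Mapping.single (us @ x # vs) 1 - Poly_Mapping.single (us @ y # vs) 1
      | us x y vs. us @ x # vs \<in> tuples V i j \<and> us @ y # vs \<in> tuples V i j} \<union>
     {Poly_Mapping.single (us @ (c \<odot>\<^bsub>iterated_dual V (i + int (length us))\<^esub> x) # vs) 1
        - Poly_Mapping.single (us @ x # vs) c
      | us c x vs. us @ x # vs \<in> tuples V i j})"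

definition tensor_class ::
  "('k::field, 'v) module \<Rightarrow> int \<Rightarrow> int \<Rightarrow> ('v list \<Rightarrow>\<^sub>0 'k) \<Rightarrow> ('v list \<Rightarrow>\<^sub>0 'k) set" where
  "tensor_class V i j f = multilinear_relations V i j +>\<^bsub>tuple_space V i j\<^esub> f"

definition tensor_space ::
  "('k::field, 'v) module \<Rightarrow> int \<Rightarrow> int \<Rightarrow> ('k, ('v list \<Rightarrow>\<^sub>0 'k) set) module" where
  "tensor_space V i j = quotient_space (tuple_space V i j) (multilinear_relations V i j)"

text \<open>The concatenation \<open>T\<^sub>i\<^sub>j \<times> T\<^sub>j\<^sub>l \<rightarrow> T\<^sub>i\<^sub>l\<close>, on cosets.\<close>

definition tensor_mult ::
  "('k::field, 'v) module \<Rightarrow> int \<Rightarrow> int \<Rightarrow>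
    ('v list \<Rightarrow>\<^sub>0 'k) set \<Rightarrow> ('v list \<Rightarrow>\<^sub>0 'k) set \<Rightarrow> ('v list \<Rightarrow>\<^sub>0 'k) set" where
  "tensor_mult V i l S T = (\<Union>f\<in>S. \<Union>g\<in>T. tensor_class V i l (word_mult f g))"

definition Q_space :: "('k::field, 'v) module \<Rightarrow> int \<Rightarrow> ('v list \<Rightarrow>\<^sub>0 'k) set set" where
  "Q_space V i = subspace_span (tensor_space V i (i + 2))
    {tensor_class V i (i + 2) (\<Sum>b\<in>B. Poly_Mapping.single [b, b' b] 1)
     | B b'. is_basis (iterated_dual V i) B \<and>
        (\<forall>b\<in>B. b' b \<in> carrier (iterated_dual V (i + 1)) \<and>
          (\<forall>c\<in>B. pairing V i c (b' b) = (if c = b then 1 else 0)))}"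

definition R_space :: "('k::field, 'v) module \<Rightarrow> int \<Rightarrow> int \<Rightarrow> ('v list \<Rightarrow>\<^sub>0 'k) set set" where
  "R_space V i j = subspace_span (tensor_space V i j)
    (\<Union>p\<in>{i..j - 2}. {tensor_mult V i j u (tensor_mult V p j q v)
      | u q v. u \<in> carrier (tensor_space V i p) \<and> q \<in> Q_space V p \<and>
          v \<in> carrier (tensor_space V (p + 2) j)})"

text \<open>\<open>R\<^sub>i\<^sub>j = 0\<close> for \<open>j \<le> i + 1\<close>, so that \<open>A\<^sub>i\<^sub>i = T\<^sub>i\<^sub>i = k\<close> and \<open>A\<^sub>i\<^sub>j = 0\<close> for \<open>i > j\<close>.\<close>

definition Snc ::
  "('k::field, 'v) module \<Rightarrow> ('k, ('v list \<Rightarrow>\<^sub>0 'k) set set) zalgebra" where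
  "Snc V =
    \<lparr> zpart = (\<lambda>i j. quotient_space (tensor_space V i j) (R_space V i j)),
      zmult = (\<lambda>i j l a b. \<Union>s\<in>a. \<Union>t\<in>b. R_space V i l +>\<^bsub>tensor_space V i l\<^esub> tensor_mult V i l s t),
      zunit = (\<lambda>i. R_space V i i +>\<^bsub>tensor_space V i i\<^esub>
        tensor_class V i i (Poly_Mapping.single [] 1)) \<rparr>"

definition Pnc where
  "Pnc U V = z_cohproj U (Snc V)"

end

theory Submission
  imports Defs
begin

text \<open>
  Write the relation of the graded algebra as \<open>b = \<Sum>\<^sub>a x\<^sub>a \<tau>(x\<^sub>a)\<close>, where \<open>\<tau>\<close> is the linear
  automorphism \<open>x\<^sub>a \<mapsto> \<sigma>(x\<^bsub>n+1-a\<^esub>)\<close> of the space \<open>W\<close> of letters. Starting from any isomorphism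
  \<open>V \<cong> W\<close> one finds, upwards and downwards in \<open>i\<close>, isomorphisms \<open>V\<^bsup>i*\<^esup> \<cong> W\<close> that carry
  the canonical element of \<open>V\<^bsup>i*\<^esup> \<otimes> V\<^bsup>(i+1)*\<^esup>\<close> to \<open>b\<close>: for the letters in \<open>V\<^bsup>i*\<^esup>\<close> the
  dual basis has to go to the elements \<open>\<tau>(x\<^sub>a)\<close>. Their tensor products identify \<open>A\<^sub>i\<^sub>j\<close> with the
  graded part of degree \<open>j - i\<close> of the graded algebra, compatibly with products and units. Graded modules
  over the two algebras are thus the same families of groups with reindexed actions, and coherence and
  right-boundedness agree. Since the Serre quotients are localizations, they are equivalent.
\<close>

section \<open>Localizations\<close>

text \<open>Two obstacles shape the argument. The twist is absorbed by identifications that depend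
  on the index: with \<open>l i\<close> the coordinates on \<open>iterated_dual V i\<close>, the
  recursions are set up so that the pairing of \<open>u\<close> and \<open>w\<close> is always the
  standard form applied to \<open>l i u\<close> and \<open>\<tau>_inv (l (i + 1) w)\<close>. This
  condition has the same shape for every \<open>i\<close>, which is why a single quadratic element
  can represent every \<open>Q_i\<close>. The other obstacle is the encoding: \<open>A_ij\<close> is
  a quotient of a quotient of formal combinations of tuples, while the graded part lies in a
  quotient by a two-sided ideal that is given as an intersection. Both are compared on
  representatives: evaluating tuples in the free algebra and lifting words to tuples are inverse to
  each other modulo multilinearity, and the relations are pulled back to combinations of tuples.
  Finite generation and coherence are tested on free modules whose elements have different types on
  the two sides, so they are transported along bijections.\<close>

lemma zigzag_ends:
  "zigzag C W X p Y \<Longrightarrow> X \<in> Ob C \<and> Y \<in> Ob C"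
  by (induction rule: zigzag.induct) auto

lemma zigzag_append:
  "zigzag C W X p Y \<Longrightarrow> zigzag C W Y q Z \<Longrightarrow> zigzag C W X (p @ q) Z"
  by (induction rule: zigzag.induct) (auto intro: zigzag.intros)

lemma zigzag_Fwd:
  "X \<in> Ob C \<Longrightarrow> Y \<in> Ob C \<Longrightarrow> f \<in> Hom C X Y \<Longrightarrow> zigzag C W X [Fwd X Y f] Y"
  by (auto intro: zigzag.intros)

lemma zigzag_Bwd:
  "X \<in> Ob C \<Longrightarrow> Y \<in> Ob C \<Longrightarrow> s \<in> Hom C X Y \<Longrightarrow> W X Y s \<Longrightarrow> zigzag C W Y [Bwd X Y s] X"
  by (auto intro: zigzag.intros)

lemma Ident_in_Hom: "category C \<Longrightarrow> X \<in> Ob C \<Longrightarrow> Ident C X \<in> Hom C X X"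
  by (simp add: category_def)

lemma Comp_in_Hom:
  "category C \<Longrightarrow> X \<in> Ob C \<Longrightarrow> Y \<in> Ob C \<Longrightarrow> Z \<in> Ob C \<Longrightarrow> f \<in> Hom C X Y \<Longrightarrow> g \<in> Hom C Y Z \<Longrightarrow>
    Comp C X Y Z g f \<in> Hom C X Z"
  by (simp add: category_def)

lemma Comp_Ident:
  assumes "category C" "X \<in> Ob C" "Y \<in> Ob C" "f \<in> Hom C X Y"
  shows "Comp C X X Y f (Ident C X) = f" and "Comp C X Y Y (Ident C Y) f = f"
  using assms by (simp_all add: category_def)

text \<open>The generating rules are typed, so both sides of an equation are paths with the given
  ends. The rules for identities and composites are where the category axioms enter.\<close>

lemma zigzag_eq_zigzag:
  assumes "category C" "zigzag_eq C W X Y p q"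
  shows "zigzag C W X p Y \<and> zigzag C W X q Y"
  using assms(2)
proof (induction rule: zigzag_eq.induct)
  case (congr X p X' Y' q q' r Y)
  then show ?case by (blast intro: zigzag_append)
next
  case (comp X Y Z f g)
  then show ?case
    using Comp_in_Hom[OF assms(1)] by (auto intro!: zigzag.intros)
qed (auto intro!: zigzag.intros Ident_in_Hom assms(1))

text \<open>\<open>congr\<close> exchanges one block inside a path. Here two blocks are exchanged in
  turn: \<open>p\<close> in front of \<open>q\<close>, then \<open>q\<close> behind
  \<open>p'\<close>, with an empty outer block each time.\<close>

lemma zigzag_eq_append:
  assumes "category C" "zigzag_eq C W X Y p p'" "zigzag_eq C W Y Z q q'"
  shows "zigzag_eq C W X Z (p @ q) (p' @ q')"
proof -
  have zz: "zigzag C W X p' Y" "zigzag C W Y q Z"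
    using zigzag_eq_zigzag[OF assms(1,2)] zigzag_eq_zigzag[OF assms(1,3)] by auto
  have Ob: "X \<in> Ob C" "Z \<in> Ob C"
    using zigzag_ends[OF zz(1)] zigzag_ends[OF zz(2)] by auto
  have "zigzag_eq C W X Z ([] @ p @ q) ([] @ p' @ q)"
    by (rule zigzag_eq.congr[OF zigzag.nil[OF Ob(1)] assms(2) zz(2)])
  moreover have "zigzag_eq C W X Z (p' @ q @ []) (p' @ q' @ [])"
    by (rule zigzag_eq.congr[OF zz(1) assms(3) zigzag.nil[OF Ob(2)]])
  ultimately show ?thesis
    by (auto intro: zigzag_eq.trans)
qed

text \<open>The end points stay as arguments because the empty list is a path at every object and
  the congruence is typed.\<close>

definition zigzag_class ::
  "('o, 'm) cat \<Rightarrow> ('o \<Rightarrow> 'o \<Rightarrow> 'm \<Rightarrow> bool) \<Rightarrow> 'o \<Rightarrow> 'o \<Rightarrow>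
    ('o, 'm) arrow_step list \<Rightarrow> ('o, 'm) arrow_step list set" where
  "zigzag_class C W X Y p = {q. zigzag_eq C W X Y p q}"

lemma zigzag_class_eqI:
  "zigzag_eq C W X Y p q \<Longrightarrow> zigzag_class C W X Y p = zigzag_class C W X Y q"
  unfolding zigzag_class_def by (blast intro: zigzag_eq.sym zigzag_eq.trans)

lemma Ob_localization [simp]: "Ob (localization C W) = Ob C"
  by (simp add: localization_def)

lemma Ident_localization [simp]: "Ident (localization C W) X = zigzag_class C W X X []"
  by (simp add: localization_def zigzag_class_def)

lemma Hom_localization:
  "Hom (localization C W) X Y = zigzag_class C W X Y ` {p. zigzag C W X p Y}"
  by (auto simp: localization_def zigzag_class_def quotient_def)

text \<open>Operations on classes are written as unions over representatives, here as in
  \<open>localization\<close>. If \<open>h\<close> is constant on the class, which is nonempty, the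
  union collapses to its value.\<close>

lemma Union_zigzag_class:
  assumes C: "category C" and p: "zigzag C W X p Y"
    and eq: "\<And>q. zigzag_eq C W X Y p q \<Longrightarrow> h q = h p"
  shows "(\<Union>q\<in>zigzag_class C W X Y p. h q) = h p"
  using zigzag_eq.refl[OF p] eq unfolding zigzag_class_def by blast

lemma Comp_localization:
  assumes C: "category C" and p: "zigzag C W X p Y" and q: "zigzag C W Y q Z"
  shows "Comp (localization C W) X Y Z (zigzag_class C W Y Z q) (zigzag_class C W X Y p) =
    zigzag_class C W X Z (p @ q)"
proof -
  have *: "zigzag_class C W X Z (p' @ q') = zigzag_class C W X Z (p @ q)"
    if "zigzag_eq C W X Y p p'" "zigzag_eq C W Y Z q q'" for p' q'
    by (rule zigzag_class_eqI[OF zigzag_eq.sym[OF zigzag_eq_append[OF C that]]])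
  have "Comp (localization C W) X Y Z (zigzag_class C W Y Z q) (zigzag_class C W X Y p) =
    (\<Union>p'\<in>zigzag_class C W X Y p. \<Union>q'\<in>zigzag_class C W Y Z q. zigzag_class C W X Z (p' @ q'))"
    by (simp add: localization_def zigzag_class_def)
  also have "\<dots> = (\<Union>p'\<in>zigzag_class C W X Y p. zigzag_class C W X Z (p' @ q))"
  proof (rule SUP_cong[OF HOL.refl])
    fix p' assume "p' \<in> zigzag_class C W X Y p"
    then have p': "zigzag_eq C W X Y p p'" by (simp add: zigzag_class_def)
    show "(\<Union>q'\<in>zigzag_class C W Y Z q. zigzag_class C W X Z (p' @ q')) = zigzag_class C W X Z (p' @ q)"
      using *[OF p'] zigzag_eq.refl[OF q] by (intro Union_zigzag_class[OF C q]) auto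
  qed
  also have "\<dots> = zigzag_class C W X Z (p @ q)"
    using * zigzag_eq.refl[OF q] by (intro Union_zigzag_class[OF C p]) auto
  finally show ?thesis .
qed

lemma category_localization:
  assumes C: "category C"
  shows "category (localization C W)"
  unfolding category_def
  by (auto simp: Hom_localization Comp_localization[OF C] zigzag.nil zigzag_append
      dest: zigzag_ends)

section \<open>Twin categories\<close>

text \<open>
  The equivalence between graded modules and modules over the \<open>\<int>\<close>-algebra does not change the
  underlying families of maps, so that the Hom-sets of the two categories agree literally.
  Since the junk values of the actions prevent an isomorphism of categories, the objects are only
  related and not in bijection.
\<close>

locale twin_categories =
  fixes C :: "('o, 'm) cat" and D :: "('p, 'm) cat" and R :: "'o \<Rightarrow> 'p \<Rightarrow> bool"
  assumes category_C: "category C" and category_D: "category D"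
    and R_Ob: "R X X' \<Longrightarrow> X \<in> Ob C \<and> X' \<in> Ob D"
    and R_total: "X \<in> Ob C \<Longrightarrow> \<exists>X'. R X X'"
    and R_onto: "X' \<in> Ob D \<Longrightarrow> \<exists>X. R X X'"
    and Hom_eq: "R X X' \<Longrightarrow> R Y Y' \<Longrightarrow> Hom C X Y = Hom D X' Y'"
    and Ident_eq: "R X X' \<Longrightarrow> Ident C X = Ident D X'"
    and Comp_eq: "R X X' \<Longrightarrow> R Y Y' \<Longrightarrow> R Z Z' \<Longrightarrow> Comp C X Y Z = Comp D X' Y' Z'"
begin

text \<open>The axioms are symmetric in the two categories, so every implication from
  \<open>C\<close> to \<open>D\<close> proved below also yields its converse.\<close>

lemma flip: "twin_categories D C (\<lambda>X X'. R X' X)"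
  using category_C category_D R_Ob R_total R_onto Hom_eq Ident_eq Comp_eq
  by unfold_locales (metis | blast)+

lemma zero_object_twin:
  assumes "R Z Z'" "is_zero_object C Z"
  shows "is_zero_object D Z'"
  unfolding is_zero_object_def
proof (intro conjI ballI)
  show "Z' \<in> Ob D" using R_Ob assms(1) by blast
next
  fix X' assume "X' \<in> Ob D"
  then obtain X where X: "R X X'" using R_onto by blast
  then have "X \<in> Ob C" using R_Ob by blast
  then have "(\<exists>!f. f \<in> Hom C X Z) \<and> (\<exists>!f. f \<in> Hom C Z X)"
    using assms(2) unfolding is_zero_object_def by blast
  then show "\<exists>!f. f \<in> Hom D X' Z'" "\<exists>!f. f \<in> Hom D Z' X'"
    unfolding Hom_eq[OF X assms(1)] Hom_eq[OF assms(1) X] by blast+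
qed

lemma zero_arrow_twin_imp:
  assumes "R X X'" "R Y Y'" "is_zero_arrow C X Y f"
  shows "is_zero_arrow D X' Y' f"
proof -
  obtain Z g h where Z: "is_zero_object C Z" "g \<in> Hom C X Z" "h \<in> Hom C Z Y" "f = Comp C X Z Y h g"
    using assms(3) by (auto simp: is_zero_arrow_def)
  then have "Z \<in> Ob C" by (simp only: is_zero_object_def)
  then obtain Z' where Z': "R Z Z'"
    using R_total by blast
  show ?thesis
    unfolding is_zero_arrow_def
    using zero_object_twin[OF Z' Z(1)] Z(2-) Hom_eq[OF assms(1) Z'] Hom_eq[OF Z' assms(2)]
      Comp_eq[OF assms(1) Z' assms(2)]
    by auto
qed

lemma zero_arrow_twin:
  assumes "R X X'" "R Y Y'"
  shows "is_zero_arrow C X Y f \<longleftrightarrow> is_zero_arrow D X' Y' f"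
  using zero_arrow_twin_imp[OF assms] twin_categories.zero_arrow_twin_imp[OF flip] assms by blast

text \<open>A test object of \<open>D\<close> is replaced by an object of \<open>C\<close> related
  to it. Hom-sets, compositions and zero arrows agree, so the same arrow solves both universal
  problems.\<close>

lemma kernel_twin:
  assumes R: "R X X'" "R Y Y'" "R K K'" and K: "is_kernel C X Y f K i"
  shows "is_kernel D X' Y' f K' i"
  unfolding is_kernel_def
proof (intro conjI ballI impI)
  show "K' \<in> Ob D" using R_Ob R by blast
  show "i \<in> Hom D K' X'" using K R Hom_eq by (auto simp: is_kernel_def)
  show "is_zero_arrow D K' Y' (Comp D K' X' Y' f i)"
    using K zero_arrow_twin[OF R(3,2)] Comp_eq[OF R(3,1,2)] by (simp add: is_kernel_def)
next
  fix L' g assume L': "L' \<in> Ob D" and g: "g \<in> Hom D L' X'"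
    and z: "is_zero_arrow D L' Y' (Comp D L' X' Y' f g)"
  obtain L where L: "R L L'" using R_onto L' by blast
  have "\<exists>!u. u \<in> Hom C L K \<and> Comp C L K X i u = g"
    using K g z R_Ob[OF L] zero_arrow_twin[OF L R(2)] Comp_eq[OF L R(1,2)] Hom_eq[OF L R(1)]
    by (simp add: is_kernel_def)
  then show "\<exists>!u. u \<in> Hom D L' K' \<and> Comp D L' K' X' i u = g"
    using Hom_eq[OF L R(3)] Comp_eq[OF L R(3,1)] by simp
qed

lemma cokernel_twin:
  assumes R: "R X X'" "R Y Y'" "R K K'" and K: "is_cokernel C X Y f K i"
  shows "is_cokernel D X' Y' f K' i"
  unfolding is_cokernel_def
proof (intro conjI ballI impI)
  show "K' \<in> Ob D" using R_Ob R by blast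
  show "i \<in> Hom D Y' K'" using K R Hom_eq by (auto simp: is_cokernel_def)
  show "is_zero_arrow D X' K' (Comp D X' Y' K' i f)"
    using K zero_arrow_twin[OF R(1,3)] Comp_eq[OF R(1,2,3)] by (simp add: is_cokernel_def)
next
  fix L' g assume L': "L' \<in> Ob D" and g: "g \<in> Hom D Y' L'"
    and z: "is_zero_arrow D X' L' (Comp D X' Y' L' g f)"
  obtain L where L: "R L L'" using R_onto L' by blast
  have "\<exists>!u. u \<in> Hom C K L \<and> Comp C Y K L u i = g"
    using K g z R_Ob[OF L] zero_arrow_twin[OF R(1) L] Comp_eq[OF R(1,2) L] Hom_eq[OF R(2) L]
    by (simp add: is_cokernel_def)
  then show "\<exists>!u. u \<in> Hom D K' L' \<and> Comp D Y' K' L' u i = g"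
    using Hom_eq[OF R(3) L] Comp_eq[OF R(2,3) L] by simp
qed

text \<open>A kernel or cokernel object found in \<open>C\<close> is moved to any object of
  \<open>D\<close> related to it, and the assumption on \<open>T\<close> puts that object into
  \<open>T'\<close>.\<close>

lemma serre_arrow_twin_imp:
  assumes R: "R X X'" "R Y Y'" and T: "\<And>K K'. R K K' \<Longrightarrow> K \<in> T \<longleftrightarrow> K' \<in> T'"
    and "(\<exists>K i. is_kernel C X Y s K i \<and> K \<in> T) \<and> (\<exists>K p. is_cokernel C X Y s K p \<and> K \<in> T)"
  shows "(\<exists>K i. is_kernel D X' Y' s K i \<and> K \<in> T') \<and> (\<exists>K p. is_cokernel D X' Y' s K p \<and> K \<in> T')"
proof -
  obtain K i L p where *: "is_kernel C X Y s K i" "K \<in> T" "is_cokernel C X Y s L p" "L \<in> T"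
    using assms(4) by blast
  obtain K' L' where "R K K'" "R L L'"
    using R_total *(1,3) by (meson is_kernel_def is_cokernel_def)
  then show ?thesis
    using kernel_twin[OF R] cokernel_twin[OF R] * T by blast
qed

end

section \<open>Localizations of twin categories\<close>

locale twin_localizations = twin_categories C D R
  for C :: "('o, 'm) cat" and D :: "('p, 'm) cat" and R +
  fixes W :: "'o \<Rightarrow> 'o \<Rightarrow> 'm \<Rightarrow> bool" and W' :: "'p \<Rightarrow> 'p \<Rightarrow> 'm \<Rightarrow> bool"
  assumes W_eq: "R X X' \<Longrightarrow> R Y Y' \<Longrightarrow> W X Y s \<longleftrightarrow> W' X' Y' s"
begin

lemma flip_localizations: "twin_localizations D C (\<lambda>X X'. R X' X) W' W"
  using flip W_eq by (auto simp: twin_localizations_def twin_localizations_axioms_def)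

text \<open>\<open>R\<close> is not a function, so a choice is made. Going forth and back with the
  two choices returns only an object with the same twin; the lemmas on common twins below repair
  this.\<close>

definition twin :: "'o \<Rightarrow> 'p" where
  "twin X = (SOME X'. R X X')"

lemma R_twin: "X \<in> Ob C \<Longrightarrow> R X (twin X)"
  unfolding twin_def by (rule someI_ex) (rule R_total)

lemma twin_Ob: "X \<in> Ob C \<Longrightarrow> twin X \<in> Ob D"
  using R_twin R_Ob by blast

lemma twin_Hom: "X \<in> Ob C \<Longrightarrow> Y \<in> Ob C \<Longrightarrow> Hom D (twin X) (twin Y) = Hom C X Y"
  using Hom_eq R_twin by metis

text \<open>Only the objects recorded in the steps change: the arrows are kept, as the Hom-sets
  agree literally.\<close>

abbreviation twin_path where
  "twin_path \<equiv> map (map_arrow_step twin (\<lambda>f. f))"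

lemma zigzag_twin: "zigzag C W X p Y \<Longrightarrow> zigzag D W' (twin X) (twin_path p) (twin Y)"
proof (induction rule: zigzag.induct)
  case (fwd X f Y p Z)
  then show ?case
    using zigzag_ends[OF fwd(3)] by (auto intro!: zigzag.intros simp: twin_Ob twin_Hom)
next
  case (bwd Y s X p Z)
  then show ?case
    using zigzag_ends[OF bwd(4)]
    by (auto intro!: zigzag.intros simp: twin_Ob twin_Hom W_eq[OF R_twin R_twin, symmetric])
qed (auto intro: zigzag.intros twin_Ob)

lemma zigzag_eq_twin:
  "zigzag_eq C W X Y p q \<Longrightarrow> zigzag_eq D W' (twin X) (twin Y) (twin_path p) (twin_path q)"
proof (induction rule: zigzag_eq.induct)
  case (sym X Y p q)
  then show ?case by (blast intro: zigzag_eq.sym)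
next
  case (trans X Y p q r)
  then show ?case by (blast intro: zigzag_eq.trans)
next
  case (ident X)
  then show ?case
    using zigzag_eq.ident[OF twin_Ob[OF ident], of W'] by (simp add: Ident_eq[OF R_twin[OF ident]])
next
  case (comp X Y Z f g)
  then show ?case
    using zigzag_eq.comp[of "twin X" D "twin Y" "twin Z" f g W']
    by (simp add: twin_Ob twin_Hom Comp_eq[OF R_twin R_twin R_twin])
next
  case (cancel X Y s)
  then show ?case
    using zigzag_eq.cancel[of "twin X" D "twin Y" s W']
    by (simp add: twin_Ob twin_Hom W_eq[OF R_twin R_twin])
next
  case (cancel' X Y s)
  then show ?case
    using zigzag_eq.cancel'[of "twin X" D "twin Y" s W']
    by (simp add: twin_Ob twin_Hom W_eq[OF R_twin R_twin])
next
  case (congr X p X' Y' q q' r Y)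
  then show ?case
    using zigzag_eq.congr[OF zigzag_twin[OF congr(1)] congr.IH zigzag_twin[OF congr(3)]] by simp
qed (auto intro: zigzag_eq.refl zigzag_twin)

definition twin_class where
  "twin_class X Y \<phi> = (\<Union>p\<in>\<phi>. zigzag_class D W' (twin X) (twin Y) (twin_path p))"

lemma twin_class_zigzag_class:
  assumes "zigzag C W X p Y"
  shows "twin_class X Y (zigzag_class C W X Y p) =
    zigzag_class D W' (twin X) (twin Y) (twin_path p)"
  unfolding twin_class_def
  by (rule Union_zigzag_class[OF category_C assms])
    (rule zigzag_class_eqI[OF zigzag_eq.sym[OF zigzag_eq_twin]])

lemma functor_twin: "is_functor (localization C W) (localization D W') twin twin_class"
  unfolding is_functor_def
  by (auto simp: twin_Ob Hom_localization twin_class_zigzag_class zigzag.nil zigzag_append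
      Comp_localization[OF category_C] Comp_localization[OF category_D] zigzag_twin)

text \<open>Both \<open>Hom C X X\<close> and \<open>Hom C X Y\<close> equal the endomorphisms of
  the common twin. Hence the identity of \<open>X\<close> is also an arrow from \<open>X\<close> to
  \<open>Y\<close>, the candidate for an isomorphism.\<close>

lemma same_twin_Hom:
  assumes "R X X'" "R Y X'"
  shows "Ident C X \<in> Hom C X Y"
  using Hom_eq[OF assms(1,1)] Hom_eq[OF assms] R_Ob[OF assms(1)] category_C
  by (auto simp: category_def)

text \<open>\<open>Comp\<close> depends on the objects only through their twins, so composing with
  this arrow is computed as composing with a true identity.\<close>

lemma same_twin_Comp_Ident:
  assumes R: "R X Z" "R Y Z'" "R Y' Z'" and f: "f \<in> Hom C X Y"
  shows "Comp C X Y Y' (Ident C Y) f = f"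
  using Comp_Ident(2)[OF category_C, of X Y f] Comp_eq[OF R(1,2,2)] Comp_eq[OF R] R_Ob[OF R(1)]
    R_Ob[OF R(2)] f
  by simp

lemma same_twin_Comp_Ident':
  assumes R: "R X Z" "R X' Z" "R Y Z'" and f: "f \<in> Hom C X' Y"
  shows "Comp C X X' Y f (Ident C X) = f"
  using Comp_Ident(1)[OF category_C, of X Y f] Comp_eq[OF R(1,1,3)] Comp_eq[OF R] R_Ob[OF R(1)]
    R_Ob[OF R(3)] f Hom_eq[OF R(1,3)] Hom_eq[OF R(2,3)]
  by simp

text \<open>Both sides compose to the one arrow \<open>f\<close>, read as an arrow from
  \<open>X'\<close> to \<open>Y\<close>.\<close>

lemma same_twin_square:
  assumes R: "R X Z" "R X' Z" "R Y Z'" "R Y' Z'" and f: "f \<in> Hom C X Y"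
  shows "zigzag_eq C W X' Y [Fwd X' X (Ident C X'), Fwd X Y f] [Fwd X' Y' f, Fwd Y' Y (Ident C Y')]"
proof -
  have f': "f \<in> Hom C X' Y'"
    using f Hom_eq[OF R(1,3)] Hom_eq[OF R(2,4)] by simp
  have Ob: "X \<in> Ob C" "X' \<in> Ob C" "Y \<in> Ob C" "Y' \<in> Ob C"
    using R R_Ob by blast+
  have "zigzag_eq C W X' Y [Fwd X' X (Ident C X'), Fwd X Y f] [Fwd X' Y f]"
    using zigzag_eq.comp[OF Ob(2,1,3) same_twin_Hom[OF R(2,1)] f, of W]
      same_twin_Comp_Ident'[OF R(2,1,3) f]
    by simp
  moreover have "zigzag_eq C W X' Y [Fwd X' Y' f, Fwd Y' Y (Ident C Y')] [Fwd X' Y f]"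
    using zigzag_eq.comp[OF Ob(2,4,3) f' same_twin_Hom[OF R(4,3)], of W]
      same_twin_Comp_Ident[OF R(2,4,3) f']
    by simp
  ultimately show ?thesis
    by (blast intro: zigzag_eq.sym zigzag_eq.trans)
qed

lemma same_twin_square_Bwd:
  assumes R: "R X Z" "R X' Z" "R Y Z'" "R Y' Z'" and s: "s \<in> Hom C X Y" and W: "W X Y s"
  shows "zigzag_eq C W Y' X [Fwd Y' Y (Ident C Y'), Bwd X Y s] [Bwd X' Y' s, Fwd X' X (Ident C X')]"
proof -
  have s': "s \<in> Hom C X' Y'"
    using s Hom_eq[OF R(1,3)] Hom_eq[OF R(2,4)] by simp
  have W': "W X' Y' s"
    using W W_eq[OF R(1,3)] W_eq[OF R(2,4)] by simp
  have Ob: "X \<in> Ob C" "X' \<in> Ob C" "Y \<in> Ob C" "Y' \<in> Ob C"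
    using R R_Ob by blast+
  note zz = zigzag_Bwd[where W = W, OF Ob(2,4) s' W'] zigzag_Bwd[where W = W, OF Ob(1,3) s W]
    zigzag_Fwd[OF Ob(2,1) same_twin_Hom[OF R(2,1)]]
    zigzag_Fwd[OF Ob(4,3) same_twin_Hom[OF R(4,3)]]
  let ?i = "Fwd X' X (Ident C X')" and ?j = "Fwd Y' Y (Ident C Y')"
  \<comment> \<open>Inverting the square takes three moves: insert \<open>s\<close> followed by its
    inverse at the end, push \<open>s\<close> through the square for forward arrows, cancel at the
    front.\<close>
  have "zigzag_eq C W Y' X ([Bwd X' Y' s, ?i] @ [Fwd X Y s, Bwd X Y s] @ []) ([Bwd X' Y' s, ?i] @ [] @ [])"
    using zigzag_append[OF zz(1,3)]
    by (intro zigzag_eq.congr[OF _ zigzag_eq.cancel[where W = W, OF Ob(1,3) s W] zigzag.nil[OF Ob(1)]]) simp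
  moreover have "zigzag_eq C W Y' X ([Bwd X' Y' s] @ [?i, Fwd X Y s] @ [Bwd X Y s])
      ([Bwd X' Y' s] @ [Fwd X' Y' s, ?j] @ [Bwd X Y s])"
    by (rule zigzag_eq.congr[OF zz(1) same_twin_square[OF R s] zz(2)])
  moreover have "zigzag_eq C W Y' X ([] @ [Bwd X' Y' s, Fwd X' Y' s] @ [?j, Bwd X Y s]) ([] @ [] @ [?j, Bwd X Y s])"
    using zigzag_append[OF zz(4,2)]
    by (intro zigzag_eq.congr[OF zigzag.nil[OF Ob(4)] zigzag_eq.cancel'[where W = W, OF Ob(2,4) s' W']]) simp
  ultimately show ?thesis
    by simp (metis zigzag_eq.sym zigzag_eq.trans)
qed

text \<open>Squares are pasted along the path. \<open>H\<close> is any choice of objects with common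
  twins, later the round trip of \<open>twin\<close>; the second conjunct records that the image is
  a path, which is required to compose its class.\<close>

lemma same_twin_natural:
  assumes H: "\<And>X. X \<in> Ob C \<Longrightarrow> \<exists>Z. R X Z \<and> R (H X) Z"
    and "zigzag C W X p Y"
  shows "zigzag_eq C W (H X) Y (map (map_arrow_step H (\<lambda>f. f)) p @ [Fwd (H Y) Y (Ident C (H Y))])
    (Fwd (H X) X (Ident C (H X)) # p) \<and> zigzag C W (H X) (map (map_arrow_step H (\<lambda>f. f)) p) (H Y)"
  using assms(2)
proof (induction rule: zigzag.induct)
  case (nil X)
  then obtain Z where Z: "R X Z" "R (H X) Z" using H by blast
  then have "H X \<in> Ob C" using R_Ob by blast
  then show ?case
    using zigzag_Fwd[OF _ nil same_twin_Hom[OF Z(2,1)], of W] by (auto intro: zigzag_eq.refl zigzag.nil)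
next
  case (fwd X f Y p Z)
  have Ob: "Y \<in> Ob C" "Z \<in> Ob C" using zigzag_ends[OF fwd(3)] by auto
  obtain X' Y' where R: "R X X'" "R (H X) X'" "R Y Y'" "R (H Y) Y'"
    using H Ob fwd by metis
  have f: "f \<in> Hom C (H X) (H Y)"
    using fwd(2) Hom_eq[OF R(1,3)] Hom_eq[OF R(2,4)] by simp
  have zf: "zigzag C W (H X) [Fwd (H X) (H Y) f] (H Y)"
    using R R_Ob f by (blast intro: zigzag_Fwd)
  have "zigzag_eq C W (H X) Z
      ([Fwd (H X) (H Y) f] @ (map (map_arrow_step H (\<lambda>f. f)) p @ [Fwd (H Z) Z (Ident C (H Z))]))
      ([Fwd (H X) (H Y) f] @ (Fwd (H Y) Y (Ident C (H Y)) # p))"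
    using fwd.IH by (intro zigzag_eq_append[OF category_C zigzag_eq.refl[OF zf]]) simp
  moreover have "zigzag_eq C W (H X) Z
      ([Fwd (H X) X (Ident C (H X)), Fwd X Y f] @ p)
      ([Fwd (H X) (H Y) f, Fwd (H Y) Y (Ident C (H Y))] @ p)"
    by (intro zigzag_eq_append[OF category_C _ zigzag_eq.refl[OF fwd(3)]]
        same_twin_square[OF R] fwd)
  moreover have "zigzag C W (H X) ([Fwd (H X) (H Y) f] @ map (map_arrow_step H (\<lambda>f. f)) p) (H Z)"
    using fwd.IH zf by (blast intro: zigzag_append)
  ultimately show ?case
    by simp (blast intro: zigzag_eq.sym zigzag_eq.trans)
next
  case (bwd Y s X p Z)
  have Ob: "X \<in> Ob C" "Z \<in> Ob C" using zigzag_ends[OF bwd(4)] by auto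
  obtain X' Y' where R: "R X X'" "R (H X) X'" "R Y Y'" "R (H Y) Y'"
    using H Ob bwd by metis
  have s: "s \<in> Hom C (H X) (H Y)"
    using bwd(2) Hom_eq[OF R(1,3)] Hom_eq[OF R(2,4)] by simp
  have W: "W (H X) (H Y) s"
    using bwd(3) W_eq[OF R(1,3)] W_eq[OF R(2,4)] by simp
  have zs: "zigzag C W (H Y) [Bwd (H X) (H Y) s] (H X)"
    using R R_Ob s W by (blast intro: zigzag_Bwd)
  have "zigzag_eq C W (H Y) Z
      ([Bwd (H X) (H Y) s] @ (map (map_arrow_step H (\<lambda>f. f)) p @ [Fwd (H Z) Z (Ident C (H Z))]))
      ([Bwd (H X) (H Y) s] @ (Fwd (H X) X (Ident C (H X)) # p))"
    using bwd.IH by (intro zigzag_eq_append[OF category_C zigzag_eq.refl[OF zs]]) simp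
  moreover have "zigzag_eq C W (H Y) Z
      ([Fwd (H Y) Y (Ident C (H Y)), Bwd X Y s] @ p)
      ([Bwd (H X) (H Y) s, Fwd (H X) X (Ident C (H X))] @ p)"
    by (intro zigzag_eq_append[OF category_C _ zigzag_eq.refl[OF bwd(4)]]
        same_twin_square_Bwd[OF R] bwd)
  moreover have "zigzag C W (H Y) ([Bwd (H X) (H Y) s] @ map (map_arrow_step H (\<lambda>f. f)) p) (H Z)"
    using bwd.IH zs by (blast intro: zigzag_append)
  ultimately show ?case
    by simp (blast intro: zigzag_eq.sym zigzag_eq.trans)
qed

lemma same_twin_iso:
  assumes R: "R X Z" "R X' Z"
  shows "is_iso (localization C W) X X' (zigzag_class C W X X' [Fwd X X' (Ident C X)])"
proof -
  have Ob: "X \<in> Ob C" "X' \<in> Ob C"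
    using R R_Ob by blast+
  \<comment> \<open>Stated for arbitrary pairs, so that exchanging the two objects gives the other
    composite as well.\<close>
  have inverse: "zigzag_eq C W X X [Fwd X X' (Ident C X), Fwd X' X (Ident C X')] []"
    if R: "R X Z" "R X' Z" and Ob: "X \<in> Ob C" "X' \<in> Ob C" for X X'
  proof -
    have "Ident C X = Ident C X'" using Ident_eq[OF R(1)] Ident_eq[OF R(2)] by simp
    then have "Comp C X X' X (Ident C X') (Ident C X) = Ident C X"
      using same_twin_Comp_Ident[OF R(1,2,1) same_twin_Hom[OF R]] by simp
    then show ?thesis
      using zigzag_eq.comp[OF Ob(1,2,1) same_twin_Hom[OF R(1,2)] same_twin_Hom[OF R(2,1)], of W]
        zigzag_eq.ident[OF Ob(1), of W]
      by (metis zigzag_eq.trans)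
  qed
  note zz = zigzag_Fwd[OF Ob(1,2) same_twin_Hom[OF R], of W]
    zigzag_Fwd[OF Ob(2,1) same_twin_Hom[OF R(2,1)], of W]
  show ?thesis
    unfolding is_iso_def
  proof (intro conjI bexI)
    show "zigzag_class C W X X' [Fwd X X' (Ident C X)] \<in> Hom (localization C W) X X'"
      "zigzag_class C W X' X [Fwd X' X (Ident C X')] \<in> Hom (localization C W) X' X"
      using zz by (auto simp: Hom_localization)
  qed (simp_all add: Comp_localization[OF category_C] zz zigzag_class_eqI inverse R Ob)
qed

end

context twin_localizations
begin

interpretation bwd: twin_localizations D C "\<lambda>X X'. R X' X" W' W
  by (rule flip_localizations)

text \<open>One of the two natural isomorphisms of the equivalence; the other is this statement for
  the flipped locale.\<close>

lemma nat_iso_twin: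
  "nat_iso (localization C W) (localization C W) (\<lambda>X. bwd.twin (twin X))
    (\<lambda>X Y f. bwd.twin_class (twin X) (twin Y) (twin_class X Y f)) (\<lambda>X. X) (\<lambda>X Y f. f)
    (\<lambda>X. zigzag_class C W (bwd.twin (twin X)) X [Fwd (bwd.twin (twin X)) X (Ident C (bwd.twin (twin X)))])"
proof -
  define H where "H = (\<lambda>X. bwd.twin (twin X))"
  have H: "R X (twin X)" "R (H X) (twin X)" if "X \<in> Ob C" for X
    using R_twin bwd.R_twin twin_Ob that by (auto simp: H_def)
  have H': "\<exists>Z. R X Z \<and> R (H X) Z" if "X \<in> Ob C" for X
    using H[OF that] by blast
  have paths: "bwd.twin_path (twin_path p) = map (map_arrow_step H (\<lambda>f. f)) p" for p
    by (simp add: H_def arrow_step.map_comp o_def)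
  show ?thesis
    unfolding nat_iso_def
  proof (intro conjI ballI)
    fix X assume "X \<in> Ob (localization C W)"
    then show "is_iso (localization C W) (bwd.twin (twin X)) X
       (zigzag_class C W (bwd.twin (twin X)) X [Fwd (bwd.twin (twin X)) X (Ident C (bwd.twin (twin X)))])"
      using same_twin_iso[OF H(2,1)] by (simp add: H_def)
  next
    fix X Y \<phi> assume Ob: "X \<in> Ob (localization C W)" "Y \<in> Ob (localization C W)"
      and "\<phi> \<in> Hom (localization C W) X Y"
    then obtain p where p: "zigzag C W X p Y" and \<phi>: "\<phi> = zigzag_class C W X Y p"
      by (auto simp: Hom_localization)
    have image: "bwd.twin_class (twin X) (twin Y) (twin_class X Y \<phi>) =
        zigzag_class C W (H X) (H Y) (map (map_arrow_step H (\<lambda>f. f)) p)"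
      unfolding \<phi> by (simp add: twin_class_zigzag_class p bwd.twin_class_zigzag_class zigzag_twin
          paths[unfolded map_map] H_def)
    note nat = same_twin_natural[OF H' p]
    have zz: "zigzag C W (H X) [Fwd (H X) X (Ident C (H X))] X"
      "zigzag C W (H Y) [Fwd (H Y) Y (Ident C (H Y))] Y"
      using Ob R_Ob[OF H(2)] same_twin_Hom[OF H(2,1)] by (auto intro: zigzag_Fwd)
    show "Comp (localization C W) (bwd.twin (twin X)) (bwd.twin (twin Y)) Y
        (zigzag_class C W (bwd.twin (twin Y)) Y [Fwd (bwd.twin (twin Y)) Y (Ident C (bwd.twin (twin Y)))])
        (bwd.twin_class (twin X) (twin Y) (twin_class X Y \<phi>)) =
      Comp (localization C W) (bwd.twin (twin X)) X Y \<phi>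
        (zigzag_class C W (bwd.twin (twin X)) X [Fwd (bwd.twin (twin X)) X (Ident C (bwd.twin (twin X)))])"
      unfolding image unfolding H_def[symmetric, THEN fun_cong] \<phi>
      using nat zz p by (simp add: Comp_localization[OF category_C] zigzag_class_eqI)
  qed
qed

end

lemma (in twin_localizations) equivalent_localizations:
  "equivalent_categories (localization C W) (localization D W')"
proof -
  interpret bwd: twin_localizations D C "\<lambda>X X'. R X' X" W' W
    by (rule flip_localizations)
  show ?thesis
    unfolding equivalent_categories_def
    using category_localization[OF category_C] category_localization[OF category_D]
      functor_twin bwd.functor_twin nat_iso_twin bwd.nat_iso_twin
    by blast
qed

lemma (in twin_categories) equivalent_serre_quotients:
  assumes T: "\<And>K K'. R K K' \<Longrightarrow> K \<in> T \<longleftrightarrow> K' \<in> T'"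
  shows "equivalent_categories (serre_quotient C T) (serre_quotient D T')"
  unfolding serre_quotient_def
proof (rule twin_localizations.equivalent_localizations, unfold_locales)
  fix X X' Y Y' s assume R: "R X X'" "R Y Y'"
  show "((\<exists>K i. is_kernel C X Y s K i \<and> K \<in> T) \<and> (\<exists>K p. is_cokernel C X Y s K p \<and> K \<in> T)) \<longleftrightarrow>
    ((\<exists>K i. is_kernel D X' Y' s K i \<and> K \<in> T') \<and> (\<exists>K p. is_cokernel D X' Y' s K p \<and> K \<in> T'))"
    using serre_arrow_twin_imp[OF R T] twin_categories.serre_arrow_twin_imp[OF flip, OF R T[symmetric]]
    by blast
qed

section \<open>Categories of graded modules\<close>

text \<open>The category laws hold as equations of functions because homomorphisms are extensional:
  off the carriers both sides are undefined.\<close>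

lemma category_module_category:
  fixes Homs :: "('a, 'u) gmod \<Rightarrow> ('a, 'u) gmod \<Rightarrow> ('u, 'u) gmap set"
  assumes additive: "\<And>X Y. X \<in> Obs \<Longrightarrow> Y \<in> Obs \<Longrightarrow> Homs X Y \<subseteq> additive_family X Y"
    and id: "\<And>X. X \<in> Obs \<Longrightarrow> (\<lambda>i. \<lambda>x\<in>carrier (piece X i). x) \<in> Homs X X"
    and comp: "\<And>X Y Z f g. X \<in> Obs \<Longrightarrow> Y \<in> Obs \<Longrightarrow> Z \<in> Obs \<Longrightarrow> f \<in> Homs X Y \<Longrightarrow> g \<in> Homs Y Z \<Longrightarrow>
      (\<lambda>i. compose (carrier (piece X i)) (g i) (f i)) \<in> Homs X Z"
  shows "category (module_category Obs Homs)"
proof -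
  have maps: "f i x \<in> carrier (piece Y i)"
    if "X \<in> Obs" "Y \<in> Obs" "f \<in> Homs X Y" "x \<in> carrier (piece X i)" for X Y f i x
    using additive[OF that(1,2)] that(3,4) by (auto simp: additive_family_def hom_def)
  have ext: "f i \<in> extensional (carrier (piece X i))"
    if "X \<in> Obs" "Y \<in> Obs" "f \<in> Homs X Y" for X Y f i
    using additive[OF that(1,2)] that(3) by (auto simp: additive_family_def)
  show ?thesis
    unfolding category_def module_category_def
    by (auto simp: id comp)
      (auto simp: compose_def restrict_def maps fun_eq_iff dest: extensional_arb[OF ext])
qed

lemma additive_family_id:
  "(\<And>i. abelian_group (piece X i)) \<Longrightarrow> (\<lambda>i. \<lambda>x\<in>carrier (piece X i). x) \<in> additive_family X X"
  by (auto simp: additive_family_def hom_def abelian_group.axioms abelian_monoid.a_closed)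

lemma additive_family_compose:
  assumes "\<And>i. abelian_group (piece X i)" and "f \<in> additive_family X Y" "g \<in> additive_family Y Z"
  shows "(\<lambda>i. compose (carrier (piece X i)) (g i) (f i)) \<in> additive_family X Z"
  using assms(2,3) abelian_monoid.a_closed[OF abelian_group.axioms(1)[OF assms(1)]]
  by (auto simp: additive_family_def hom_def compose_def Pi_iff)

lemma additive_familyD:
  assumes "f \<in> additive_family X Y" "x \<in> carrier (piece X i)"
  shows "f i x \<in> carrier (piece Y i)"
    and "y \<in> carrier (piece X i) \<Longrightarrow> f i (x \<oplus>\<^bsub>piece X i\<^esub> y) = f i x \<oplus>\<^bsub>piece Y i\<^esub> f i y"
  using assms by (auto simp: additive_family_def hom_def)

lemma category_gr_modules:
  assumes "\<And>X. X \<in> Obs \<Longrightarrow> gr_module A X"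
  shows "category (module_category Obs (gr_hom A))"
proof (rule category_module_category)
  fix X Y Z f g assume Ob: "X \<in> Obs" "Y \<in> Obs" "Z \<in> Obs" and f: "f \<in> gr_hom A X Y" and g: "g \<in> gr_hom A Y Z"
  have X: "gr_module A X" by (rule assms) (rule Ob)
  then have "abelian_group (piece X i)" for i by (simp add: gr_module_def)
  moreover have "action X i d x a \<in> carrier (piece X (i + d))"
    if "x \<in> carrier (piece X i)" "a \<in> grade A d" for i d x a
    using X that by (simp add: gr_module_def)
  ultimately show "(\<lambda>i. compose (carrier (piece X i)) (g i) (f i)) \<in> gr_hom A X Z"
    using f g additive_family_compose[of X f Y g Z] additive_familyD(1)[of f X Y]
    by (auto simp: gr_hom_def compose_eq)
next
  fix X assume "X \<in> Obs"
  then have "gr_module A X" by (rule assms)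
  then show "(\<lambda>i. \<lambda>x\<in>carrier (piece X i). x) \<in> gr_hom A X X"
    using additive_family_id[of X] by (auto simp: gr_hom_def gr_module_def)
qed (auto simp: gr_hom_def)

lemma category_z_modules:
  assumes "\<And>X. X \<in> Obs \<Longrightarrow> z_module A X"
  shows "category (module_category Obs (z_hom A))"
proof (rule category_module_category)
  fix X Y Z f g assume Ob: "X \<in> Obs" "Y \<in> Obs" "Z \<in> Obs" and f: "f \<in> z_hom A X Y" and g: "g \<in> z_hom A Y Z"
  have X: "z_module A X" by (rule assms) (rule Ob)
  then have "abelian_group (piece X i)" for i by (simp add: z_module_def)
  moreover have "action X i j x a \<in> carrier (piece X j)"
    if "x \<in> carrier (piece X i)" "a \<in> carrier (zpart A i j)" for i j x a
    using X that by (simp add: z_module_def)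
  ultimately show "(\<lambda>i. compose (carrier (piece X i)) (g i) (f i)) \<in> z_hom A X Z"
    using f g additive_family_compose[of X f Y g Z] additive_familyD(1)[of f X Y]
    by (auto simp: z_hom_def compose_eq)
next
  fix X assume "X \<in> Obs"
  then have "z_module A X" by (rule assms)
  then show "(\<lambda>i. \<lambda>x\<in>carrier (piece X i). x) \<in> z_hom A X X"
    using additive_family_id[of X] by (auto simp: z_hom_def z_module_def)
qed (auto simp: z_hom_def)

section \<open>Graded algebras as \<open>\<int>\<close>-algebras\<close>

text \<open>A graded algebra becomes a \<int>-algebra by putting its degree \<open>j - i\<close>
  part at position \<open>(i, j)\<close>. Here \<open>\<phi>\<close> identifies \<open>S\<close>
  with it in the structure that the module definitions see: sums, products and units.\<close>

locale regrading =
  fixes A :: "'a graded_ring" and S :: "('k, 's) zalgebra" and \<phi> :: "int \<Rightarrow> int \<Rightarrow> 's \<Rightarrow> 'a"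
  assumes bij: "bij_betw (\<phi> i j) (carrier (zpart S i j)) (grade A (j - i))"
    and zadd_closed: "a \<in> carrier (zpart S i j) \<Longrightarrow> b \<in> carrier (zpart S i j) \<Longrightarrow>
      a \<oplus>\<^bsub>zpart S i j\<^esub> b \<in> carrier (zpart S i j)"
    and \<phi>_add: "a \<in> carrier (zpart S i j) \<Longrightarrow> b \<in> carrier (zpart S i j) \<Longrightarrow>
      \<phi> i j (a \<oplus>\<^bsub>zpart S i j\<^esub> b) = \<phi> i j a \<oplus>\<^bsub>A\<^esub> \<phi> i j b"
    and zmult_closed: "a \<in> carrier (zpart S i j) \<Longrightarrow> b \<in> carrier (zpart S j l) \<Longrightarrow>
      zmult S i j l a b \<in> carrier (zpart S i l)"
    and \<phi>_mult: "a \<in> carrier (zpart S i j) \<Longrightarrow> b \<in> carrier (zpart S j l) \<Longrightarrow>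
      \<phi> i l (zmult S i j l a b) = \<phi> i j a \<otimes>\<^bsub>A\<^esub> \<phi> j l b"
    and zunit_closed: "zunit S i \<in> carrier (zpart S i i)"
    and \<phi>_unit: "\<phi> i i (zunit S i) = \<one>\<^bsub>A\<^esub>"
begin

definition \<psi> :: "int \<Rightarrow> int \<Rightarrow> 'a \<Rightarrow> 's" where
  "\<psi> i j = inv_into (carrier (zpart S i j)) (\<phi> i j)"

lemma \<phi>_grade: "a \<in> carrier (zpart S i j) \<Longrightarrow> \<phi> i j a \<in> grade A (j - i)"
  using bij by (rule bij_betw_apply)

lemma \<psi>_closed: "a \<in> grade A d \<Longrightarrow> \<psi> i (i + d) a \<in> carrier (zpart S i (i + d))"
  using bij_betw_apply[OF bij_betw_inv_into[OF bij[of i "i + d"]]] by (simp add: \<psi>_def)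

lemma \<phi>_\<psi>: "a \<in> grade A d \<Longrightarrow> \<phi> i (i + d) (\<psi> i (i + d) a) = a"
  using bij_betw_inv_into_right[OF bij[of i "i + d"]] by (simp add: \<psi>_def)

lemma \<psi>_\<phi>: "a \<in> carrier (zpart S i j) \<Longrightarrow> \<psi> i j (\<phi> i j a) = a"
  using bij_betw_inv_into_left[OF bij] by (simp add: \<psi>_def)

lemma \<psi>_unit: "\<psi> i i \<one>\<^bsub>A\<^esub> = zunit S i"
  using \<psi>_\<phi>[OF zunit_closed] \<phi>_unit by simp

lemma \<psi>_add:
  assumes "a \<in> grade A d" "b \<in> grade A d"
  shows "\<psi> i (i + d) (a \<oplus>\<^bsub>A\<^esub> b) = \<psi> i (i + d) a \<oplus>\<^bsub>zpart S i (i + d)\<^esub> \<psi> i (i + d) b"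
  using \<psi>_\<phi>[OF zadd_closed] \<phi>_add \<psi>_closed \<phi>_\<psi> assms by metis

lemma \<psi>_mult:
  assumes "a \<in> grade A d" "b \<in> grade A e"
  shows "\<psi> i (i + (d + e)) (a \<otimes>\<^bsub>A\<^esub> b) =
    zmult S i (i + d) (i + (d + e)) (\<psi> i (i + d) a) (\<psi> (i + d) (i + (d + e)) b)"
  using \<psi>_\<phi>[OF zmult_closed, of "\<psi> i (i + d) a" i "i + d" "\<psi> (i + d) (i + d + e) b" "i + d + e"]
    \<phi>_mult[of "\<psi> i (i + d) a" i "i + d" "\<psi> (i + d) (i + d + e) b" "i + d + e"]
    \<psi>_closed[OF assms(1)] \<psi>_closed[OF assms(2), of "i + d"] \<phi>_\<psi>[OF assms(1)] \<phi>_\<psi>[OF assms(2), of "i + d"]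
  by (simp add: add.assoc)

lemma grade_add: "a \<in> grade A d \<Longrightarrow> b \<in> grade A d \<Longrightarrow> a \<oplus>\<^bsub>A\<^esub> b \<in> grade A d"
  using \<phi>_grade[OF zadd_closed[OF \<psi>_closed \<psi>_closed], of a d b 0] \<phi>_add[OF \<psi>_closed \<psi>_closed, of a d b 0]
    \<phi>_\<psi>[of a d 0] \<phi>_\<psi>[of b d 0]
  by simp

lemma grade_mult:
  assumes "a \<in> grade A d" "b \<in> grade A e"
  shows "a \<otimes>\<^bsub>A\<^esub> b \<in> grade A (d + e)"
  using \<phi>_grade[OF zmult_closed[OF \<psi>_closed[OF assms(1), of 0] \<psi>_closed[OF assms(2)]]]
    \<phi>_mult[OF \<psi>_closed[OF assms(1), of 0] \<psi>_closed[OF assms(2)]]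
    \<phi>_\<psi>[OF assms(1), of 0] \<phi>_\<psi>[OF assms(2), of "0 + d"]
  by simp

text \<open>An isomorphism between a family acted on by \<open>S\<close> and one acted on by
  \<open>A\<close>. The elements may have different types, as for free modules; closure is included
  because kernels and free modules enter without a proof that they are modules.\<close>

definition regraded :: "('s, 'w) gmod \<Rightarrow> ('a, 'u) gmod \<Rightarrow> ('w, 'u) gmap \<Rightarrow> bool" where
  "regraded Y X \<theta> \<longleftrightarrow>
    (\<forall>i. bij_betw (\<theta> i) (carrier (piece Y i)) (carrier (piece X i))) \<and>
    (\<forall>i. \<forall>x\<in>carrier (piece Y i). \<forall>y\<in>carrier (piece Y i).
      x \<oplus>\<^bsub>piece Y i\<^esub> y \<in> carrier (piece Y i) \<and>
      \<theta> i (x \<oplus>\<^bsub>piece Y i\<^esub> y) = \<theta> i x \<oplus>\<^bsub>piece X i\<^esub> \<theta> i y) \<and>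
    (\<forall>i j. \<forall>x\<in>carrier (piece Y i). \<forall>a\<in>carrier (zpart S i j).
      action Y i j x a \<in> carrier (piece Y j) \<and>
      \<theta> j (action Y i j x a) = action X i (j - i) (\<theta> i x) (\<phi> i j a))"

definition unregrade :: "('s, 'w) gmod \<Rightarrow> ('w, 'u) gmap \<Rightarrow> ('u, 'w) gmap" where
  "unregrade Y \<theta> i = inv_into (carrier (piece Y i)) (\<theta> i)"

context
  fixes Y :: "('s, 'w) gmod" and X :: "('a, 'u) gmod" and \<theta> :: "('w, 'u) gmap"
  assumes YX: "regraded Y X \<theta>"
begin

lemma regraded_bij: "bij_betw (\<theta> i) (carrier (piece Y i)) (carrier (piece X i))"
  using YX by (simp add: regraded_def)

lemma regraded_closed: "y \<in> carrier (piece Y i) \<Longrightarrow> \<theta> i y \<in> carrier (piece X i)"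
  using regraded_bij by (rule bij_betw_apply)

lemma unregrade_closed: "x \<in> carrier (piece X i) \<Longrightarrow> unregrade Y \<theta> i x \<in> carrier (piece Y i)"
  unfolding unregrade_def using bij_betw_inv_into[OF regraded_bij] by (rule bij_betw_apply)

lemma regrade_unregrade: "x \<in> carrier (piece X i) \<Longrightarrow> \<theta> i (unregrade Y \<theta> i x) = x"
  unfolding unregrade_def using regraded_bij by (rule bij_betw_inv_into_right)

lemma unregrade_regrade: "y \<in> carrier (piece Y i) \<Longrightarrow> unregrade Y \<theta> i (\<theta> i y) = y"
  unfolding unregrade_def using regraded_bij by (rule bij_betw_inv_into_left)

lemma regraded_add:
  assumes "x \<in> carrier (piece Y i)" "y \<in> carrier (piece Y i)"
  shows "x \<oplus>\<^bsub>piece Y i\<^esub> y \<in> carrier (piece Y i)"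
    and "\<theta> i (x \<oplus>\<^bsub>piece Y i\<^esub> y) = \<theta> i x \<oplus>\<^bsub>piece X i\<^esub> \<theta> i y"
  using YX assms by (auto simp: regraded_def)

lemma unregrade_add:
  assumes "x \<in> carrier (piece X i)" "y \<in> carrier (piece X i)"
  shows "x \<oplus>\<^bsub>piece X i\<^esub> y \<in> carrier (piece X i)"
    and "unregrade Y \<theta> i (x \<oplus>\<^bsub>piece X i\<^esub> y) = unregrade Y \<theta> i x \<oplus>\<^bsub>piece Y i\<^esub> unregrade Y \<theta> i y"
proof -
  note * = regraded_add[OF unregrade_closed[OF assms(1)] unregrade_closed[OF assms(2)]]
  have eq: "\<theta> i (unregrade Y \<theta> i x \<oplus>\<^bsub>piece Y i\<^esub> unregrade Y \<theta> i y) = x \<oplus>\<^bsub>piece X i\<^esub> y"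
    using *(2) assms by (simp add: regrade_unregrade)
  show "x \<oplus>\<^bsub>piece X i\<^esub> y \<in> carrier (piece X i)"
    using regraded_closed[OF *(1)] by (simp add: eq)
  show "unregrade Y \<theta> i (x \<oplus>\<^bsub>piece X i\<^esub> y) = unregrade Y \<theta> i x \<oplus>\<^bsub>piece Y i\<^esub> unregrade Y \<theta> i y"
    using unregrade_regrade[OF *(1)] by (simp add: eq)
qed

lemma regraded_action:
  assumes "x \<in> carrier (piece Y i)" "a \<in> carrier (zpart S i j)"
  shows "action Y i j x a \<in> carrier (piece Y j)"
    and "\<theta> j (action Y i j x a) = action X i (j - i) (\<theta> i x) (\<phi> i j a)"
  using YX assms by (auto simp: regraded_def)

lemma unregrade_action:
  assumes "x \<in> carrier (piece X i)" "a \<in> grade A d"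
  shows "action X i d x a \<in> carrier (piece X (i + d))"
    and "unregrade Y \<theta> (i + d) (action X i d x a) =
      action Y i (i + d) (unregrade Y \<theta> i x) (\<psi> i (i + d) a)"
proof -
  note * = regraded_action[OF unregrade_closed[OF assms(1)] \<psi>_closed[OF assms(2)]]
  have eq: "\<theta> (i + d) (action Y i (i + d) (unregrade Y \<theta> i x) (\<psi> i (i + d) a)) = action X i d x a"
    using *(2) assms by (simp add: regrade_unregrade \<phi>_\<psi>)
  show "action X i d x a \<in> carrier (piece X (i + d))"
    using regraded_closed[OF *(1)] by (simp add: eq)
  show "unregrade Y \<theta> (i + d) (action X i d x a) =
      action Y i (i + d) (unregrade Y \<theta> i x) (\<psi> i (i + d) a)"
    using unregrade_regrade[OF *(1)] by (simp add: eq)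
qed

end

text \<open>Conjugation with \<open>\<theta>\<close> and the inverse of \<open>\<eta>\<close>;
  restricting to the carrier restores the extensionality demanded of homomorphisms.\<close>

lemma hom_to_z:
  assumes FE: "regraded E F \<theta>" and YX: "regraded Y X \<eta>" and h: "h \<in> gr_hom A F X"
  shows "(\<lambda>i. \<lambda>x\<in>carrier (piece E i). unregrade Y \<eta> i (h i (\<theta> i x))) \<in> z_hom S E Y"
proof -
  have add: "h \<in> additive_family F X" using h by (simp add: gr_hom_def)
  have act: "h j (action F i (j - i) x a) = action X i (j - i) (h i x) a"
    if "x \<in> carrier (piece F i)" "a \<in> grade A (j - i)" for i j x a
    using h that by (force simp: gr_hom_def)
  have "\<psi> i j (\<phi> i j a) = a" if "a \<in> carrier (zpart S i j)" for i j a
    using \<psi>_\<phi> that .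
  moreover have "unregrade Y \<eta> j (action X i (j - i) x (\<phi> i j a)) = action Y i j (unregrade Y \<eta> i x) a"
    if "x \<in> carrier (piece X i)" "a \<in> carrier (zpart S i j)" for i j x a
    using unregrade_action(2)[OF YX that(1) \<phi>_grade[OF that(2)]] that by (simp add: \<psi>_\<phi>)
  ultimately show ?thesis
    by (auto simp: z_hom_def additive_family_def hom_def regraded_add[OF FE] regraded_action[OF FE]
        regraded_closed[OF FE] additive_familyD[OF add] act \<phi>_grade
        unregrade_add(2)[OF YX] intro!: unregrade_closed[OF YX])
qed

lemma hom_to_gr:
  assumes FE: "regraded E F \<theta>" and YX: "regraded Y X \<eta>" and h: "h \<in> z_hom S E Y"
  shows "(\<lambda>i. \<lambda>x\<in>carrier (piece F i). \<eta> i (h i (unregrade E \<theta> i x))) \<in> gr_hom A F X"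
proof -
  have add: "h \<in> additive_family E Y" using h by (simp add: z_hom_def)
  have act: "h j (action E i j x a) = action Y i j (h i x) a"
    if "x \<in> carrier (piece E i)" "a \<in> carrier (zpart S i j)" for i j x a
    using h that by (simp add: z_hom_def)
  show ?thesis
    by (auto simp: gr_hom_def additive_family_def hom_def unregrade_add[OF FE] unregrade_action[OF FE]
        unregrade_closed[OF FE] additive_familyD[OF add] act \<psi>_closed \<phi>_\<psi>
        regraded_add(2)[OF YX] regraded_action(2)[OF YX] intro!: regraded_closed[OF YX])
qed

text \<open>For a list entry \<open>d\<close> the piece in position \<open>j\<close> is
  \<open>A_dj\<close> on one side and the degree \<open>j - d\<close> part on the other, so the same
  list of degrees serves both free modules.\<close>

definition free_regrade :: "int list \<Rightarrow> (nat \<Rightarrow> 's, nat \<Rightarrow> 'a) gmap" where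
  "free_regrade ds j x = (\<lambda>p\<in>{..<length ds}. \<phi> (ds ! p) j (x p))"

lemma regraded_free: "regraded (z_free S ds) (gr_free A ds) (free_regrade ds)"
  unfolding regraded_def
proof (intro conjI allI ballI)
  fix j
  show "bij_betw (free_regrade ds j) (carrier (piece (z_free S ds) j)) (carrier (piece (gr_free A ds) j))"
  proof (rule bij_betw_byWitness[where f' = "\<lambda>x. \<lambda>p\<in>{..<length ds}. \<psi> (ds ! p) j (x p)"])
    have "\<psi> i j a \<in> carrier (zpart S i j)" "\<phi> i j (\<psi> i j a) = a" if "a \<in> grade A (j - i)" for i a
      using \<psi>_closed[OF that, of i] \<phi>_\<psi>[OF that, of i] by simp_all
    then show "\<forall>a\<in>carrier (piece (gr_free A ds) j).
        free_regrade ds j (\<lambda>p\<in>{..<length ds}. \<psi> (ds ! p) j (a p)) = a"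
      "(\<lambda>x. \<lambda>p\<in>{..<length ds}. \<psi> (ds ! p) j (x p)) ` carrier (piece (gr_free A ds) j) \<subseteq>
        carrier (piece (z_free S ds) j)"
      by (auto simp: gr_free_def z_free_def free_regrade_def fun_eq_iff PiE_def Pi_iff extensional_def)
  qed (auto simp: gr_free_def z_free_def free_regrade_def fun_eq_iff PiE_def Pi_iff extensional_def
      \<psi>_\<phi> \<phi>_grade)
qed (auto simp: gr_free_def z_free_def free_regrade_def fun_eq_iff zadd_closed zmult_closed \<phi>_add
    \<phi>_mult PiE_iff)

text \<open>A surjection from a free module is conjugated with \<open>free_regrade\<close> and
  \<open>\<eta>\<close>. Bijections on all pieces keep it surjective.\<close>

lemma fg_iff:
  fixes Y :: "('s, 'w) gmod" and X :: "('a, 'u) gmod"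
  assumes YX: "regraded Y X \<eta>"
  shows "gr_fg A X \<longleftrightarrow> z_fg S Y"
proof
  assume "gr_fg A X"
  then obtain ds h where h: "h \<in> gr_hom A (gr_free A ds) X" "surjective_family (gr_free A ds) X h"
    by (auto simp: gr_fg_def)
  let ?h = "\<lambda>i. \<lambda>x\<in>carrier (piece (z_free S ds) i). unregrade Y \<eta> i (h i (free_regrade ds i x))"
  have "?h i ` carrier (piece (z_free S ds) i) = carrier (piece Y i)" for i
  proof -
    have "?h i ` carrier (piece (z_free S ds) i) =
        unregrade Y \<eta> i ` h i ` free_regrade ds i ` carrier (piece (z_free S ds) i)"
      by (simp add: image_image)
    also have "\<dots> = carrier (piece Y i)"
      using h(2) bij_betw_imp_surj_on[OF regraded_bij[OF regraded_free, of ds i]]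
        bij_betw_imp_surj_on[OF bij_betw_inv_into[OF regraded_bij[OF YX, of i]]]
      by (simp add: surjective_family_def unregrade_def)
    finally show ?thesis .
  qed
  then have "surjective_family (z_free S ds) Y ?h"
    by (simp only: surjective_family_def simp_thms)
  then show "z_fg S Y"
    using hom_to_z[OF regraded_free YX h(1)] unfolding z_fg_def by (intro exI bexI)
next
  assume "z_fg S Y"
  then obtain ds h where h: "h \<in> z_hom S (z_free S ds) Y" "surjective_family (z_free S ds) Y h"
    by (auto simp: z_fg_def)
  let ?u = "unregrade (z_free S ds) (free_regrade ds)"
  let ?h = "\<lambda>i. \<lambda>x\<in>carrier (piece (gr_free A ds) i). \<eta> i (h i (?u i x))"
  have "?h i ` carrier (piece (gr_free A ds) i) = carrier (piece X i)" for i
  proof -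
    have "?h i ` carrier (piece (gr_free A ds) i) = \<eta> i ` h i ` ?u i ` carrier (piece (gr_free A ds) i)"
      by (simp add: image_image)
    also have "\<dots> = carrier (piece X i)"
      using h(2) bij_betw_imp_surj_on[OF regraded_bij[OF YX, of i]]
        bij_betw_imp_surj_on[OF bij_betw_inv_into[OF regraded_bij[OF regraded_free, of ds i]]]
      by (simp add: surjective_family_def unregrade_def)
    finally show ?thesis .
  qed
  then have "surjective_family (gr_free A ds) X ?h"
    by (simp only: surjective_family_def simp_thms)
  then show "gr_fg A X"
    using hom_to_gr[OF regraded_free YX h(1)] unfolding gr_fg_def by (intro exI bexI)
qed

text \<open>Unlike \<open>regraded\<close> this demands equal pieces, which makes Hom-sets equal.
  Actions are compared on carriers only, since their other values are arbitrary.\<close>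

definition same_module :: "('a, 'u) gmod \<Rightarrow> ('s, 'u) gmod \<Rightarrow> bool" where
  "same_module X Y \<longleftrightarrow> piece X = piece Y \<and>
    (\<forall>i j. \<forall>x\<in>carrier (piece X i). \<forall>a\<in>carrier (zpart S i j).
      action Y i j x a = action X i (j - i) x (\<phi> i j a))"

context
  fixes X :: "('a, 'u) gmod" and Y :: "('s, 'u) gmod"
  assumes same: "same_module X Y"
begin

lemma same_piece: "piece Y = piece X"
  using same by (simp add: same_module_def)

lemma same_action:
  "x \<in> carrier (piece X i) \<Longrightarrow> a \<in> carrier (zpart S i j) \<Longrightarrow>
    action Y i j x a = action X i (j - i) x (\<phi> i j a)"
  using same by (simp add: same_module_def)

lemma same_action':
  "x \<in> carrier (piece X i) \<Longrightarrow> a \<in> grade A d \<Longrightarrow> action X i d x a = action Y i (i + d) x (\<psi> i (i + d) a)"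
  using same_action[OF _ \<psi>_closed] by (simp add: \<phi>_\<psi>)

lemma module_iff: "gr_module A X \<longleftrightarrow> z_module S Y"
proof
  assume X: "gr_module A X"
  \<comment> \<open>The graded laws with the target index \<open>j\<close> in place of
    \<open>i + d\<close>, so that they match the two-index form of the laws over
    \<open>S\<close>.\<close>
  have c: "action X i (j - i) x a \<in> carrier (piece X j)"
    if "x \<in> carrier (piece X i)" "a \<in> grade A (j - i)" for i j x a
    using X that unfolding gr_module_def by (metis add.commute diff_add_cancel)
  have l: "action X i (j - i) (x \<oplus>\<^bsub>piece X i\<^esub> y) a =
      action X i (j - i) x a \<oplus>\<^bsub>piece X j\<^esub> action X i (j - i) y a"
    if "x \<in> carrier (piece X i)" "y \<in> carrier (piece X i)" "a \<in> grade A (j - i)" for i j x y a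
    using X that unfolding gr_module_def by (metis add.commute diff_add_cancel)
  have r: "action X i (j - i) x (a \<oplus>\<^bsub>A\<^esub> b) =
      action X i (j - i) x a \<oplus>\<^bsub>piece X j\<^esub> action X i (j - i) x b"
    if "x \<in> carrier (piece X i)" "a \<in> grade A (j - i)" "b \<in> grade A (j - i)" for i j x a b
    using X that unfolding gr_module_def by (metis add.commute diff_add_cancel)
  have m: "action X j (l - j) (action X i (j - i) x a) b = action X i (l - i) x (a \<otimes>\<^bsub>A\<^esub> b)"
    if x: "x \<in> carrier (piece X i)" and a: "a \<in> grade A (j - i)" and b: "b \<in> grade A (l - j)" for i j l x a b
  proof -
    have "action X (i + (j - i)) (l - j) (action X i (j - i) x a) b =
        action X i ((j - i) + (l - j)) x (a \<otimes>\<^bsub>A\<^esub> b)"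
      using X x a b unfolding gr_module_def by blast
    then show ?thesis by simp
  qed
  have ab: "abelian_group (piece X i)" and u: "\<forall>x\<in>carrier (piece X i). action X i 0 x \<one>\<^bsub>A\<^esub> = x" for i
    using X by (simp_all add: gr_module_def)
  note closed = abelian_monoid.a_closed[OF abelian_group.axioms(1)[OF ab]]
  show "z_module S Y"
    unfolding z_module_def same_piece
    by (auto simp: same_action closed ab c l r m u \<phi>_grade \<phi>_add zadd_closed \<phi>_mult zmult_closed
        zunit_closed \<phi>_unit)
next
  assume Y: "z_module S Y"
  have ab: "abelian_group (piece X i)" for i
    using Y by (simp add: z_module_def same_piece)
  note closed = abelian_monoid.a_closed[OF abelian_group.axioms(1)[OF ab]]
  have c: "action Y i j x a \<in> carrier (piece X j)"
    if "x \<in> carrier (piece X i)" "a \<in> carrier (zpart S i j)" for i j x a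
    using Y that by (simp add: z_module_def same_piece)
  have l: "action Y i j (x \<oplus>\<^bsub>piece X i\<^esub> y) a = action Y i j x a \<oplus>\<^bsub>piece X j\<^esub> action Y i j y a"
    if "x \<in> carrier (piece X i)" "y \<in> carrier (piece X i)" "a \<in> carrier (zpart S i j)" for i j x y a
    using Y that by (simp add: z_module_def same_piece)
  have r: "action Y i j x (a \<oplus>\<^bsub>zpart S i j\<^esub> b) = action Y i j x a \<oplus>\<^bsub>piece X j\<^esub> action Y i j x b"
    if "x \<in> carrier (piece X i)" "a \<in> carrier (zpart S i j)" "b \<in> carrier (zpart S i j)" for i j x a b
    using Y that by (simp add: z_module_def same_piece)
  have m: "action Y j l (action Y i j x a) b = action Y i l x (zmult S i j l a b)"
    if "x \<in> carrier (piece X i)" "a \<in> carrier (zpart S i j)" "b \<in> carrier (zpart S j l)" for i j l x a b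
    using Y that by (simp add: z_module_def same_piece)
  have u: "action Y i i x (zunit S i) = x" if "x \<in> carrier (piece X i)" for i x
    using Y that by (simp add: z_module_def same_piece)
  have one: "\<one>\<^bsub>A\<^esub> \<in> grade A 0"
    using \<phi>_grade[OF zunit_closed[of 0]] \<phi>_unit[of 0] by simp
  show "gr_module A X"
    unfolding gr_module_def
    using u[folded \<psi>_unit] same_action'[OF _ one]
    by (auto simp: same_action' closed ab c l r m \<psi>_closed grade_add grade_mult \<psi>_add \<psi>_mult
        add.assoc) (use m[OF _ \<psi>_closed \<psi>_closed] in \<open>simp add: add.assoc\<close>)
qed

lemma regraded_same:
  assumes "gr_module A X"
  shows "regraded Y X (\<lambda>i x. x)"
proof -
  have "z_module S Y" using assms module_iff by simp
  then have "action Y i j x a \<in> carrier (piece X j)"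
    if "x \<in> carrier (piece X i)" "a \<in> carrier (zpart S i j)" for i j x a
    using that by (simp add: z_module_def same_piece)
  moreover have "abelian_group (piece X i)" for i
    using assms by (simp add: gr_module_def)
  then have "x \<oplus>\<^bsub>piece X i\<^esub> y \<in> carrier (piece X i)"
    if "x \<in> carrier (piece X i)" "y \<in> carrier (piece X i)" for i x y
    using abelian_monoid.a_closed[OF abelian_group.axioms(1)] that by metis
  ultimately show ?thesis
    unfolding regraded_def same_piece by (simp add: same_action bij_betw_def)
qed

end

text \<open>Since \<open>g\<close> is \<open>h\<close> after \<open>\<theta>\<close>, the bijection
  \<open>\<theta>\<close> restricts to one between the kernels. Both kernels keep the ambient
  actions, so only closure remains to be checked.\<close>

lemma regraded_kernel:
  assumes FE: "regraded E F \<theta>" and same: "same_module X Y" and X: "gr_module A X"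
    and h: "h \<in> gr_hom A F X" and g: "g \<in> z_hom S E Y"
    and gh: "\<And>i x. x \<in> carrier (piece E i) \<Longrightarrow> g i x = h i (\<theta> i x)"
  shows "regraded (kernel_module E Y g) (kernel_module F X h) \<theta>"
proof -
  have addg: "g \<in> additive_family E Y" using g by (simp add: z_hom_def)
  have act: "g j (action E i j x a) = action Y i j (g i x) a"
    if "x \<in> carrier (piece E i)" "a \<in> carrier (zpart S i j)" for i j x a
    using g that by (simp add: z_hom_def)
  have Y: "z_module S Y" using X module_iff[OF same] by simp
  then have ab: "abelian_group (piece Y i)" for i by (simp add: z_module_def)
  \<comment> \<open>Closure of the kernel under the action: if \<open>g i x\<close> vanishes, the
    image of \<open>x a\<close> is the result of \<open>a\<close> acting on zero.\<close>
  have zero: "action Y i j \<zero>\<^bsub>piece Y i\<^esub> a = \<zero>\<^bsub>piece Y j\<^esub>" if a: "a \<in> carrier (zpart S i j)" for i j a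
  proof -
    interpret i: abelian_group "piece Y i" by (rule ab)
    interpret j: abelian_group "piece Y j" by (rule ab)
    have "action Y i j (\<zero>\<^bsub>piece Y i\<^esub> \<oplus>\<^bsub>piece Y i\<^esub> \<zero>\<^bsub>piece Y i\<^esub>) a =
      action Y i j \<zero>\<^bsub>piece Y i\<^esub> a \<oplus>\<^bsub>piece Y j\<^esub> action Y i j \<zero>\<^bsub>piece Y i\<^esub> a"
      and "action Y i j \<zero>\<^bsub>piece Y i\<^esub> a \<in> carrier (piece Y j)"
      using Y a i.zero_closed by (simp_all add: z_module_def del: i.l_zero i.r_zero)
    then show ?thesis
      by simp
  qed
  have add0: "\<zero>\<^bsub>piece Y i\<^esub> \<oplus>\<^bsub>piece Y i\<^esub> \<zero>\<^bsub>piece Y i\<^esub> = \<zero>\<^bsub>piece Y i\<^esub>" for i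
  proof -
    interpret i: abelian_group "piece Y i" by (rule ab)
    show ?thesis by simp
  qed
  show ?thesis
    unfolding regraded_def kernel_module_def
  proof (intro conjI allI ballI, goal_cases)
    case (1 i)
    have "\<theta> i ` {x \<in> carrier (piece E i). g i x = \<zero>\<^bsub>piece X i\<^esub>} =
      {x \<in> carrier (piece F i). h i x = \<zero>\<^bsub>piece X i\<^esub>}"
      using bij_betw_imp_surj_on[OF regraded_bij[OF FE, of i]] gh by (auto simp: image_iff) force
    then show ?case
      using bij_betw_subset[OF regraded_bij[OF FE, of i]]
      by (auto simp: a_kernel_def' same_piece[OF same])
  qed (auto simp: a_kernel_def' regraded_add[OF FE] regraded_action[OF FE] act zero add0
      additive_familyD[OF addg])
qed

lemma coherent_iff:
  fixes X :: "('a, 'u) gmod" and Y :: "('s, 'u) gmod"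
  assumes same: "same_module X Y" and X: "gr_module A X"
  shows "gr_coherent A X \<longleftrightarrow> z_coherent S Y"
proof -
  note YX = regraded_same[OF same X]
  have un: "unregrade Y (\<lambda>i x. x) i x = x" if "x \<in> carrier (piece X i)" for i x
    using regrade_unregrade[OF YX that] .
  have "(\<forall>h\<in>gr_hom A (gr_free A ds) X. gr_fg A (kernel_module (gr_free A ds) X h)) \<longleftrightarrow>
    (\<forall>h\<in>z_hom S (z_free S ds) Y. z_fg S (kernel_module (z_free S ds) Y h))" for ds
  proof (intro iffI ballI)
    fix g assume *: "\<forall>h\<in>gr_hom A (gr_free A ds) X. gr_fg A (kernel_module (gr_free A ds) X h)"
      and g: "g \<in> z_hom S (z_free S ds) Y"
    \<comment> \<open>The target keeps its groups, so only the free source is changed back.\<close>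
    let ?h = "\<lambda>i. \<lambda>x\<in>carrier (piece (gr_free A ds) i). g i (unregrade (z_free S ds) (free_regrade ds) i x)"
    have h: "?h \<in> gr_hom A (gr_free A ds) X"
      using hom_to_gr[OF regraded_free YX g] .
    have "regraded (kernel_module (z_free S ds) Y g) (kernel_module (gr_free A ds) X ?h) (free_regrade ds)"
      by (rule regraded_kernel[OF regraded_free same X h g])
        (simp add: regraded_closed[OF regraded_free] unregrade_regrade[OF regraded_free])
    then show "z_fg S (kernel_module (z_free S ds) Y g)"
      using fg_iff * h by blast
  next
    fix h assume *: "\<forall>h\<in>z_hom S (z_free S ds) Y. z_fg S (kernel_module (z_free S ds) Y h)"
      and h: "h \<in> gr_hom A (gr_free A ds) X"
    have add: "h \<in> additive_family (gr_free A ds) X" using h by (simp add: gr_hom_def)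
    let ?g = "\<lambda>i. \<lambda>x\<in>carrier (piece (z_free S ds) i). unregrade Y (\<lambda>i x. x) i (h i (free_regrade ds i x))"
    have g: "?g \<in> z_hom S (z_free S ds) Y"
      using hom_to_z[OF regraded_free YX h] .
    have "regraded (kernel_module (z_free S ds) Y ?g) (kernel_module (gr_free A ds) X h) (free_regrade ds)"
      by (rule regraded_kernel[OF regraded_free same X h g])
        (simp add: un additive_familyD[OF add] regraded_closed[OF regraded_free])
    then show "gr_fg A (kernel_module (gr_free A ds) X h)"
      using fg_iff * g by blast
  qed
  then show ?thesis
    using fg_iff[OF YX] by (simp add: gr_coherent_def z_coherent_def)
qed

text \<open>Compatibility with all \<open>A_ij\<close> and with all graded parts are the same
  condition because every \<open>\<phi> i j\<close> is onto its graded part.\<close>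

lemma same_hom:
  assumes X: "same_module X X'" and Y: "same_module Y Y'"
  shows "gr_hom A X Y = z_hom S X' Y'"
proof (intro Set.equalityI subsetI)
  fix f assume f: "f \<in> gr_hom A X Y"
  then have add: "f \<in> additive_family X Y" by (simp add: gr_hom_def)
  have act: "f j (action X i (j - i) x a) = action Y i (j - i) (f i x) a"
    if "x \<in> carrier (piece X i)" "a \<in> grade A (j - i)" for i j x a
    using f that by (force simp: gr_hom_def)
  show "f \<in> z_hom S X' Y'"
    using add by (simp add: z_hom_def additive_family_def same_piece[OF X] same_piece[OF Y])
      (simp add: same_action[OF X] same_action[OF Y] additive_familyD[OF add] \<phi>_grade act)
next
  fix f assume f: "f \<in> z_hom S X' Y'"
  then have add: "f \<in> additive_family X Y"
    by (simp add: z_hom_def additive_family_def same_piece[OF X] same_piece[OF Y])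
  have act: "f j (action X' i j x a) = action Y' i j (f i x) a"
    if "x \<in> carrier (piece X i)" "a \<in> carrier (zpart S i j)" for i j x a
    using f that by (simp add: z_hom_def same_piece[OF X])
  show "f \<in> gr_hom A X Y"
    using add
    by (simp add: gr_hom_def same_action'[OF X] same_action'[OF Y] additive_familyD[OF add] \<psi>_closed act)
qed

theorem equivalent_cohproj:
  "equivalent_categories (cohproj TYPE('u) A) (z_cohproj TYPE('u) S)"
proof -
  let ?C = "{X :: ('a, 'u) gmod. gr_module A X \<and> gr_coherent A X}"
    and ?D = "{X :: ('s, 'u) gmod. z_module S X \<and> z_coherent S X}"
  let ?R = "\<lambda>X Y. X \<in> ?C \<and> Y \<in> ?D \<and> same_module X Y"
  interpret twin_categories "module_category ?C (gr_hom A)" "module_category ?D (z_hom S)" ?R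
  proof
    show "category (module_category ?C (gr_hom A))" by (rule category_gr_modules) simp
    show "category (module_category ?D (z_hom S))" by (rule category_z_modules) simp
  next
    fix X assume "X \<in> Ob (module_category ?C (gr_hom A))"
    then have X: "X \<in> ?C" by (simp add: module_category_def)
    \<comment> \<open>The related module has the same groups and the action reindexed through
      \<open>\<phi>\<close>; for the converse direction \<open>\<psi>\<close> is used.\<close>
    have "same_module X \<lparr> piece = piece X, action = (\<lambda>i j x a. action X i (j - i) x (\<phi> i j a)) \<rparr>"
      by (simp add: same_module_def)
    then show "\<exists>Y. ?R X Y"
      using X module_iff coherent_iff by blast
  next
    fix Y assume "Y \<in> Ob (module_category ?D (z_hom S))"
    then have Y: "Y \<in> ?D" by (simp add: module_category_def)
    have "same_module \<lparr> piece = piece Y, action = (\<lambda>i d x a. action Y i (i + d) x (\<psi> i (i + d) a)) \<rparr> Y"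
      by (simp add: same_module_def \<psi>_\<phi>)
    then show "\<exists>X. ?R X Y"
      using Y module_iff coherent_iff by blast
  qed (auto simp: module_category_def same_hom same_piece)
  have "right_bounded X \<longleftrightarrow> right_bounded Y" if "same_module X Y"
    for X :: "('a, 'u) gmod" and Y :: "('s, 'u) gmod"
    by (simp add: right_bounded_def same_piece[OF that])
  then show ?thesis
    unfolding cohproj_def z_cohproj_def by (intro equivalent_serre_quotients) auto
qed

end

section \<open>Linear algebra of words\<close>

lemma lookup_word_scale [simp]: "Poly_Mapping.lookup (word_scale c f) u = c * Poly_Mapping.lookup f u"
  by (simp add: word_scale_def Poly_Mapping.map.rep_eq when_def)

lemma word_scale_simps [simp]:
  "word_scale c (f + g) = word_scale c f + word_scale c g"
  "word_scale (c + d) f = word_scale c f + word_scale d f"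
  "word_scale c (word_scale d f) = word_scale (c * d) f"
  "word_scale 1 f = f" "word_scale 0 f = 0" "word_scale c 0 = 0"
  "word_scale c (f - g) = word_scale c f - word_scale c g"
  "word_scale c (Poly_Mapping.single u d) = Poly_Mapping.single u (c * d)"
  by (rule poly_mapping_eqI;
      simp add: lookup_add lookup_minus algebra_simps lookup_single when_def)+

lemma keys_word_scale: "Poly_Mapping.keys (word_scale c f) \<subseteq> Poly_Mapping.keys f"
  by (auto simp: in_keys_iff)

lemma word_scale_sum: "word_scale c (sum h S) = (\<Sum>x\<in>S. word_scale c (h x))"
  by (induction S rule: infinite_finite_induct) auto

text \<open>Concatenation, evaluation of tuples and lifting of words are all linear extensions from
  a basis, so that linearity is established once.\<close>

definition lin_ext :: "('x \<Rightarrow> ('y list \<Rightarrow>\<^sub>0 'k::field)) \<Rightarrow> ('x \<Rightarrow>\<^sub>0 'k) \<Rightarrow> ('y list \<Rightarrow>\<^sub>0 'k)" where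
  "lin_ext L f = (\<Sum>u\<in>Poly_Mapping.keys f. word_scale (Poly_Mapping.lookup f u) (L u))"

lemma lin_ext_superset:
  assumes "finite S" "Poly_Mapping.keys f \<subseteq> S"
  shows "lin_ext L f = (\<Sum>u\<in>S. word_scale (Poly_Mapping.lookup f u) (L u))"
  unfolding lin_ext_def using assms
  by (intro sum.mono_neutral_left) (auto simp: in_keys_iff)

lemma lin_ext_zero [simp]: "lin_ext L 0 = 0"
  by (simp add: lin_ext_def)

lemma lin_ext_single [simp]: "lin_ext L (Poly_Mapping.single u c) = word_scale c (L u)"
  by (subst lin_ext_superset[of "{u}"]) auto

lemma lin_ext_add [simp]: "lin_ext L (f + g) = lin_ext L f + lin_ext L g"
proof -
  let ?S = "Poly_Mapping.keys f \<union> Poly_Mapping.keys g"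
  have "Poly_Mapping.keys (f + g) \<subseteq> ?S" by (rule Poly_Mapping.keys_add)
  then show ?thesis
    by (simp add: lin_ext_superset[of ?S] lookup_add sum.distrib)
qed

lemma lin_ext_scale [simp]: "lin_ext L (word_scale c f) = word_scale c (lin_ext L f)"
  by (simp add: lin_ext_superset[OF _ keys_word_scale] lin_ext_def[of L f] word_scale_sum)

lemma lin_ext_minus [simp]: "lin_ext L (f - g) = lin_ext L f - lin_ext L g"
  using lin_ext_add[of L "f - g" g] by (simp add: algebra_simps)

lemma lin_ext_sum: "lin_ext L (sum h S) = (\<Sum>x\<in>S. lin_ext L (h x))"
  by (induction S rule: infinite_finite_induct) auto

lemma lin_ext_fun_add: "lin_ext (\<lambda>u. L u + M u) f = lin_ext L f + lin_ext M f"
  by (simp add: lin_ext_def sum.distrib)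

lemma lin_ext_fun_scale: "lin_ext (\<lambda>u. word_scale c (L u)) f = word_scale c (lin_ext L f)"
  by (simp add: lin_ext_def word_scale_sum mult.commute)

lemma lin_ext_id: "lin_ext (\<lambda>u. Poly_Mapping.single u 1) f = f"
  by (rule poly_mapping_eqI)
    (simp add: lin_ext_def lookup_sum lookup_single when_def in_keys_iff)

lemma combination_induct [consumes 1, case_names zero single add]:
  fixes f :: "'x list \<Rightarrow>\<^sub>0 'k::field"
  assumes "Poly_Mapping.keys f \<subseteq> S" and "P 0"
    and single: "\<And>u c. u \<in> S \<Longrightarrow> P (Poly_Mapping.single u c)"
    and add: "\<And>f g. Poly_Mapping.keys f \<subseteq> S \<Longrightarrow> Poly_Mapping.keys g \<subseteq> S \<Longrightarrow> P f \<Longrightarrow> P g \<Longrightarrow> P (f + g)"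
  shows "P f"
proof -
  let ?part = "\<lambda>T. \<Sum>u\<in>T. Poly_Mapping.single u (Poly_Mapping.lookup f u)"
  have "P (?part T) \<and> Poly_Mapping.keys (?part T) \<subseteq> S" if "finite T" "T \<subseteq> S" for T
    using that
  proof (induction T rule: finite_induct)
    case (insert x T)
    let ?x = "Poly_Mapping.single x (Poly_Mapping.lookup f x)"
    have x: "Poly_Mapping.keys ?x \<subseteq> S" "P ?x"
      using insert.prems single by auto
    have T: "Poly_Mapping.keys (?part T) \<subseteq> S" "P (?part T)"
      using insert by auto
    have "?part (insert x T) = ?x + ?part T"
      using insert.hyps by simp
    moreover have "P (?x + ?part T)"
      by (rule add[OF x(1) T(1) x(2) T(2)])
    moreover have "Poly_Mapping.keys (?x + ?part T) \<subseteq> S"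
      using keys_add[of ?x "?part T"] x(1) T(1) by blast
    ultimately show ?case by simp
  qed (use assms(2) in auto)
  then have "P (?part (Poly_Mapping.keys f))"
    using assms(1) finite_keys by blast
  moreover have "?part (Poly_Mapping.keys f) = f"
    using lin_ext_id[of f] by (simp add: lin_ext_def)
  ultimately show ?thesis
    by (simp only:)
qed

lemma word_induct [case_names zero single add]:
  fixes f :: "'x list \<Rightarrow>\<^sub>0 'k::field"
  assumes "P 0" "\<And>u c. P (Poly_Mapping.single u c)" "\<And>f g. P f \<Longrightarrow> P g \<Longrightarrow> P (f + g)"
  shows "P f"
  by (rule combination_induct[of f UNIV]) (use assms in auto)

text \<open>An iterated linear extension is visibly bilinear, which avoids arguments about supports
  of products.\<close>

lemma word_mult_lin_ext:
  "word_mult f g = lin_ext (\<lambda>u. lin_ext (\<lambda>v. Poly_Mapping.single (u @ v) 1) g) f"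
  by (simp add: word_mult_def lin_ext_def word_scale_sum)

lemma word_mult_simps [simp]:
  "word_mult (f + f') g = word_mult f g + word_mult f' g"
  "word_mult (f - f') g = word_mult f g - word_mult f' g"
  "word_mult (word_scale c f) g = word_scale c (word_mult f g)"
  "word_mult 0 g = 0"
  "word_mult f (g + g') = word_mult f g + word_mult f g'"
  "word_mult f (word_scale c g) = word_scale c (word_mult f g)"
  "word_mult f 0 = 0"
  "word_mult (Poly_Mapping.single u c) (Poly_Mapping.single v d) = Poly_Mapping.single (u @ v) (c * d)"
  by (simp_all add: word_mult_lin_ext lin_ext_fun_add lin_ext_fun_scale) (simp_all add: lin_ext_def)

lemma word_mult_minus_right [simp]: "word_mult f (g - g') = word_mult f g - word_mult f g'"
  using word_mult_simps(5)[of f "g - g'" g'] by (simp add: algebra_simps)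

lemma word_mult_sum_right: "word_mult f (sum h S) = (\<Sum>x\<in>S. word_mult f (h x))"
  by (induction S rule: infinite_finite_induct) auto

lemma word_mult_sum_left: "word_mult (sum h S) f = (\<Sum>x\<in>S. word_mult (h x) f)"
  by (induction S rule: infinite_finite_induct) auto

lemma word_mult_assoc: "word_mult (word_mult f g) h = word_mult f (word_mult g h)"
proof (induction f rule: word_induct)
  case (single u c)
  show ?case
  proof (induction g rule: word_induct)
    case (single v d)
    show ?case by (induction h rule: word_induct) (auto simp: mult.assoc)
  qed auto
qed auto

lemma word_mult_one [simp]:
  "word_mult (Poly_Mapping.single [] 1) f = f" "word_mult f (Poly_Mapping.single [] 1) = f"
  by (induction f rule: word_induct) auto

lemma word_mult_scalar: "word_mult (Poly_Mapping.single [] c) f = word_scale c f"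
  by (induction f rule: word_induct) auto

text \<open>The support sets are arbitrary so that one statement serves the free algebra, its
  grading and the spaces of tuples.\<close>

lemma keys_word_mult:
  assumes "Poly_Mapping.keys f \<subseteq> S" "Poly_Mapping.keys g \<subseteq> T"
    and "\<And>u v. u \<in> S \<Longrightarrow> v \<in> T \<Longrightarrow> u @ v \<in> R"
  shows "Poly_Mapping.keys (word_mult f g) \<subseteq> R"
  using assms(1)
proof (induction f rule: combination_induct)
  case (single u c)
  show ?case
    using assms(2)
  proof (induction g rule: combination_induct)
    case (single v d)
    then show ?case using assms(3) \<open>u \<in> S\<close> by auto
  next
    case (add g1 g2)
    then show ?case
      using keys_add[of "word_mult (Poly_Mapping.single u c) g1" "word_mult (Poly_Mapping.single u c) g2"]
      by auto
  qed auto
next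
  case (add f1 f2)
  then show ?case using keys_add[of "word_mult f1 g" "word_mult f2 g"] by auto
qed auto

section \<open>The free algebra\<close>

lemma carrier_free_algebra: "carrier (free_algebra n) = {f. Poly_Mapping.keys f \<subseteq> lists {1..n}}"
  by (simp add: free_algebra_def)

lemma free_algebra_simps [simp]:
  "mult (free_algebra n) = word_mult" "one (free_algebra n) = Poly_Mapping.single [] 1"
  "zero (free_algebra n) = 0" "add (free_algebra n) = (+)"
  by (simp_all add: free_algebra_def)

lemma word_scale_closed:
  "f \<in> carrier (free_algebra n) \<Longrightarrow> word_scale c f \<in> carrier (free_algebra n)"
  using keys_word_scale by (fastforce simp: carrier_free_algebra)

lemma ring_free_algebra: "ring (free_algebra n :: (nat list \<Rightarrow>\<^sub>0 'k::field) ring)"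
proof (rule ringI)
  show "abelian_group (free_algebra n :: (nat list \<Rightarrow>\<^sub>0 'k) ring)"
  proof (rule abelian_groupI; simp add: ac_simps)
    fix x y :: "nat list \<Rightarrow>\<^sub>0 'k" assume "x \<in> carrier (free_algebra n)" "y \<in> carrier (free_algebra n)"
    then show "x + y \<in> carrier (free_algebra n)"
      using keys_add[of x y] by (auto simp: carrier_free_algebra)
  next
    fix x :: "nat list \<Rightarrow>\<^sub>0 'k" assume x: "x \<in> carrier (free_algebra n)"
    have "word_scale (- 1) x + x = 0"
      using word_scale_simps(2)[of "- 1" 1 x] by simp
    then show "\<exists>y\<in>carrier (free_algebra n). x + y = 0"
      using word_scale_closed[OF x] by (metis add.commute)
  qed (simp add: carrier_free_algebra)
  show "monoid (free_algebra n :: (nat list \<Rightarrow>\<^sub>0 'k) ring)"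
  proof (rule monoidI; simp add: word_mult_assoc)
    fix x y :: "nat list \<Rightarrow>\<^sub>0 'k" assume "x \<in> carrier (free_algebra n)" "y \<in> carrier (free_algebra n)"
    then show "word_mult x y \<in> carrier (free_algebra n)"
      using keys_word_mult[of x "lists {1..n}" y "lists {1..n}" "lists {1..n}"]
      by (auto simp: carrier_free_algebra)
  qed (simp add: carrier_free_algebra)
qed simp_all

text \<open>The ring record subtracts through its own additive inverse; on the carrier this is the
  subtraction of the underlying type.\<close>

lemma a_minus_free_algebra:
  fixes x y :: "nat list \<Rightarrow>\<^sub>0 'k::field"
  assumes "x \<in> carrier (free_algebra n)" "y \<in> carrier (free_algebra n)"
  shows "x \<ominus>\<^bsub>free_algebra n\<^esub> y = x - y"
proof -
  interpret ring "free_algebra n :: (nat list \<Rightarrow>\<^sub>0 'k) ring" by (rule ring_free_algebra)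
  have "(x \<ominus>\<^bsub>free_algebra n\<^esub> y) \<oplus>\<^bsub>free_algebra n\<^esub> y = x"
    using assms by (simp del: free_algebra_simps add: a_minus_def a_assoc l_neg r_zero)
  then show ?thesis by (simp add: algebra_simps eq_diff_eq)
qed

lemma free_grade_carrier: "f \<in> free_grade n d \<Longrightarrow> f \<in> carrier (free_algebra n)"
  by (simp add: free_grade_def)

lemma free_grade_alt:
  "free_grade n d = {f. Poly_Mapping.keys f \<subseteq> {w \<in> lists {1..n}. int (length w) = d}}"
  by (auto simp: free_grade_def carrier_free_algebra)

lemma free_grade_zero [simp]: "0 \<in> free_grade n d"
  by (simp add: free_grade_alt)

lemma free_grade_add: "f \<in> free_grade n d \<Longrightarrow> g \<in> free_grade n d \<Longrightarrow> f + g \<in> free_grade n d"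
  using keys_add[of f g] unfolding free_grade_alt by blast

lemma free_grade_scale: "f \<in> free_grade n d \<Longrightarrow> word_scale c f \<in> free_grade n d"
  using keys_word_scale[of c f] unfolding free_grade_alt by blast

lemma free_grade_sum: "(\<And>x. x \<in> S \<Longrightarrow> h x \<in> free_grade n d) \<Longrightarrow> sum h S \<in> free_grade n d"
  by (induction S rule: infinite_finite_induct) (auto intro: free_grade_add)

lemma free_grade_single: "w \<in> lists {1..n} \<Longrightarrow> int (length w) = d \<Longrightarrow> Poly_Mapping.single w c \<in> free_grade n d"
  by (auto simp: free_grade_alt)

lemma free_grade_mult:
  assumes "f \<in> free_grade n d" "g \<in> free_grade n e"
  shows "word_mult f g \<in> free_grade n (d + e)"
proof -
  let ?W = "\<lambda>d. {w \<in> lists {1..n}. int (length w) = d}"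
  have "Poly_Mapping.keys (word_mult f g) \<subseteq> ?W (d + e)"
    by (rule keys_word_mult[of _ "?W d" _ "?W e"]) (use assms in \<open>auto simp: free_grade_alt\<close>)
  then show ?thesis by (simp add: free_grade_alt)
qed

lemma free_grade_induct [consumes 1, case_names zero single add]:
  assumes "f \<in> free_grade n d" "P 0"
    and "\<And>w c. w \<in> lists {1..n} \<Longrightarrow> int (length w) = d \<Longrightarrow> P (Poly_Mapping.single w c)"
    and "\<And>f g. f \<in> free_grade n d \<Longrightarrow> g \<in> free_grade n d \<Longrightarrow> P f \<Longrightarrow> P g \<Longrightarrow> P (f + g)"
  shows "P f"
proof -
  have "Poly_Mapping.keys f \<subseteq> {w \<in> lists {1..n}. int (length w) = d}"
    using assms(1) by (simp add: free_grade_alt)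
  then show ?thesis
    by (induction f rule: combination_induct) (use assms(2-) in \<open>auto simp: free_grade_alt\<close>)
qed

section \<open>The degree one part: the span of the letters\<close>

abbreviation letter :: "nat \<Rightarrow> (nat list \<Rightarrow>\<^sub>0 'k::field)" where
  "letter a \<equiv> Poly_Mapping.single [a] 1"

abbreviation coord :: "(nat list \<Rightarrow>\<^sub>0 'k::field) \<Rightarrow> nat \<Rightarrow> 'k" where
  "coord f a \<equiv> Poly_Mapping.lookup f [a]"

lemma letter_grade: "a \<in> {1..n} \<Longrightarrow> letter a \<in> free_grade n 1"
  by (rule free_grade_single) auto

lemma coord_letter: "coord (letter a) b = (if a = b then 1 else 0)"
  by (simp add: lookup_single when_def)

lemma coord_sum_letter:
  assumes "a \<in> {1..n}"
  shows "coord (\<Sum>b=1..n. word_scale (c b) (letter b)) a = c a"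
  using assms by (simp add: lookup_sum lookup_single when_def)

lemma free_grade_one_eqI:
  assumes "f \<in> free_grade n 1" "g \<in> free_grade n 1" "\<And>a. a \<in> {1..n} \<Longrightarrow> coord f a = coord g a"
  shows "f = g"
proof (rule poly_mapping_eqI)
  fix w
  have "w \<in> (\<lambda>a. [a]) ` {1..n} \<or> w \<notin> Poly_Mapping.keys f \<and> w \<notin> Poly_Mapping.keys g"
    using assms(1,2) by (auto simp: free_grade_alt length_Suc_conv in_keys_iff dest!: subsetD)
  then show "Poly_Mapping.lookup f w = Poly_Mapping.lookup g w"
    using assms(3) by (auto simp: in_keys_iff)
qed

lemma letter_sum_grade: "(\<Sum>a=1..n. word_scale (c a) (letter a)) \<in> free_grade n 1"
  by (intro free_grade_sum free_grade_scale letter_grade)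

lemma free_grade_one_expand:
  assumes "f \<in> free_grade n 1"
  shows "f = (\<Sum>a=1..n. word_scale (coord f a) (letter a))"
  by (rule free_grade_one_eqI[OF assms letter_sum_grade]) (simp only: coord_sum_letter)

section \<open>Spans and quotients\<close>

lemma cring_ground: "cring (ground :: 'k::field ring)"
proof (rule cringI)
  show "abelian_group (ground :: 'k ring)"
    by (rule abelian_groupI) (auto simp: ground_def algebra_simps intro: exI[of _ "- x" for x])
  show "comm_monoid (ground :: 'k ring)"
    by (rule comm_monoidI) (auto simp: ground_def)
qed (auto simp: ground_def algebra_simps)

lemma ground_simps [simp]:
  "carrier ground = UNIV" "mult ground = (*)" "one ground = 1" "zero ground = 0" "add ground = (+)"
  by (simp_all add: ground_def)

lemma ground_uminus: "\<ominus>\<^bsub>ground\<^esub> (c :: 'k::field) = - c"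
proof -
  interpret cring "ground :: 'k ring" by (rule cring_ground)
  show ?thesis using l_neg[of c] by (simp add: eq_neg_iff_add_eq_0)
qed

text \<open>Closure under negatives comes from the scalar -1.\<close>

lemma submodule_groundI:
  assumes "module ground M" and "H \<subseteq> carrier M" "\<zero>\<^bsub>M\<^esub> \<in> H"
    and "\<And>x y. x \<in> H \<Longrightarrow> y \<in> H \<Longrightarrow> x \<oplus>\<^bsub>M\<^esub> y \<in> H" and smult: "\<And>c x. x \<in> H \<Longrightarrow> c \<odot>\<^bsub>M\<^esub> x \<in> H"
  shows "submodule H ground M"
proof -
  interpret module ground M by (fact assms(1))
  have "\<ominus>\<^bsub>M\<^esub> x \<in> H" if x: "x \<in> H" for x
  proof -
    have xM: "x \<in> carrier M" using x assms(2) by auto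
    then have "(- 1) \<odot>\<^bsub>M\<^esub> x = \<ominus>\<^bsub>M\<^esub> x"
      using smult_l_minus[of 1 x] smult_one[OF xM] by (simp add: ground_uminus)
    then show ?thesis using smult[OF x] by metis
  qed
  then show ?thesis
    using assms(2-) by (intro submoduleI) auto
qed

lemma submodule_groundD:
  assumes "module ground M" "submodule H ground M"
  shows "H \<subseteq> carrier M" "\<zero>\<^bsub>M\<^esub> \<in> H" "x \<in> H \<Longrightarrow> y \<in> H \<Longrightarrow> x \<oplus>\<^bsub>M\<^esub> y \<in> H"
    "x \<in> H \<Longrightarrow> c \<odot>\<^bsub>M\<^esub> x \<in> H" "x \<in> H \<Longrightarrow> y \<in> H \<Longrightarrow> x \<ominus>\<^bsub>M\<^esub> y \<in> H"
proof -
  interpret module ground M by (fact assms(1))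
  show "H \<subseteq> carrier M" "x \<in> H \<Longrightarrow> y \<in> H \<Longrightarrow> x \<oplus>\<^bsub>M\<^esub> y \<in> H" "x \<in> H \<Longrightarrow> c \<odot>\<^bsub>M\<^esub> x \<in> H"
    "x \<in> H \<Longrightarrow> y \<in> H \<Longrightarrow> x \<ominus>\<^bsub>M\<^esub> y \<in> H"
    using submoduleE[OF assms(2)] by (simp_all add: a_minus_def)
  show "\<zero>\<^bsub>M\<^esub> \<in> H"
    using subgroup.one_closed[OF submodule.axioms(1)[OF assms(2)]] by simp
qed

lemma module_groundD:
  fixes M :: "('k::field, 'a) module"
  assumes "module ground M"
  shows "\<zero>\<^bsub>M\<^esub> \<in> carrier M" "x \<in> carrier M \<Longrightarrow> y \<in> carrier M \<Longrightarrow> x \<oplus>\<^bsub>M\<^esub> y \<in> carrier M"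
    "x \<in> carrier M \<Longrightarrow> c \<odot>\<^bsub>M\<^esub> x \<in> carrier M" "x \<in> carrier M \<Longrightarrow> 0 \<odot>\<^bsub>M\<^esub> x = \<zero>\<^bsub>M\<^esub>"
proof -
  interpret module ground M by (fact assms)
  show "\<zero>\<^bsub>M\<^esub> \<in> carrier M" "x \<in> carrier M \<Longrightarrow> y \<in> carrier M \<Longrightarrow> x \<oplus>\<^bsub>M\<^esub> y \<in> carrier M"
    "x \<in> carrier M \<Longrightarrow> c \<odot>\<^bsub>M\<^esub> x \<in> carrier M" "x \<in> carrier M \<Longrightarrow> 0 \<odot>\<^bsub>M\<^esub> x = \<zero>\<^bsub>M\<^esub>"
    using smult_closed[of c x] smult_l_null[of x] by simp_all
qed

lemma subspace_span_superset: "S \<subseteq> subspace_span M S"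
  by (auto simp: subspace_span_def)

lemma subspace_span_minimal: "submodule H ground M \<Longrightarrow> S \<subseteq> H \<Longrightarrow> subspace_span M S \<subseteq> H"
  by (auto simp: subspace_span_def)

lemma subspace_span_submodule:
  assumes M: "module ground M" and S: "S \<subseteq> carrier M"
  shows "submodule (subspace_span M S) ground M"
proof (rule submodule_groundI[OF M])
  have "submodule (carrier M) ground M"
    using M by (rule module.carrier_is_submodule)
  then show "subspace_span M S \<subseteq> carrier M"
    using S by (rule subspace_span_minimal)
qed (auto simp: subspace_span_def intro: submodule_groundD[OF M])

lemma subspace_span_induct [consumes 3, case_names zero gen add smult]:
  assumes M: "module ground M" and S: "S \<subseteq> carrier M" and x: "x \<in> subspace_span M S"
    and "P \<zero>\<^bsub>M\<^esub>" and "\<And>x. x \<in> S \<Longrightarrow> P x"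
    and "\<And>x y. x \<in> subspace_span M S \<Longrightarrow> y \<in> subspace_span M S \<Longrightarrow> P x \<Longrightarrow> P y \<Longrightarrow> P (x \<oplus>\<^bsub>M\<^esub> y)"
    and "\<And>c x. x \<in> subspace_span M S \<Longrightarrow> P x \<Longrightarrow> P (c \<odot>\<^bsub>M\<^esub> x)"
  shows "P x"
proof -
  note span = submodule_groundD[OF M subspace_span_submodule[OF M S]]
  have "submodule {x \<in> subspace_span M S. P x} ground M"
    using assms(4-) span by (intro submodule_groundI[OF M]) auto
  then have "subspace_span M S \<subseteq> {x \<in> subspace_span M S. P x}"
    using assms(5) by (intro subspace_span_minimal) (auto intro: subsetD[OF subspace_span_superset])
  then show ?thesis using x by auto
qed

text \<open>Used twice in succession: for combinations of tuples modulo multilinearity, and for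
  tensors modulo \<open>R_space\<close>.\<close>

locale quotient_by_submodule =
  fixes M :: "('k::field, 'a) module" and N :: "'a set"
  assumes module_M: "module ground M" and submodule_N: "submodule N ground M"
begin

sublocale M: module ground M by (fact module_M)

sublocale N: abelian_subgroup N M
  by (rule abelian_subgroupI2[OF M.a_comm_group submodule.axioms(1)[OF submodule_N]])

lemmas in_N = submodule_groundD[OF module_M submodule_N]

lemma coset_eq_iff:
  assumes "x \<in> carrier M" "y \<in> carrier M"
  shows "N +>\<^bsub>M\<^esub> x = N +>\<^bsub>M\<^esub> y \<longleftrightarrow> x \<ominus>\<^bsub>M\<^esub> y \<in> N"
proof
  assume eq: "N +>\<^bsub>M\<^esub> x = N +>\<^bsub>M\<^esub> y"
  have "x \<in> N +>\<^bsub>M\<^esub> y" using N.a_rcos_self[OF assms(1)] eq by simp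
  then obtain m where m: "m \<in> N" "x = m \<oplus>\<^bsub>M\<^esub> y" by (auto simp: a_r_coset_def')
  then have "x \<ominus>\<^bsub>M\<^esub> y = m"
    using in_N(1) assms by (simp add: a_minus_def M.a_assoc M.r_neg subset_iff)
  then show "x \<ominus>\<^bsub>M\<^esub> y \<in> N" using m by simp
next
  assume *: "x \<ominus>\<^bsub>M\<^esub> y \<in> N"
  have "x = (x \<ominus>\<^bsub>M\<^esub> y) \<oplus>\<^bsub>M\<^esub> y"
    using assms by (simp add: a_minus_def M.a_assoc M.l_neg)
  then have "x \<in> N +>\<^bsub>M\<^esub> y" using * by (auto simp: a_r_coset_def')
  then show "N +>\<^bsub>M\<^esub> x = N +>\<^bsub>M\<^esub> y"
    using M.a_repr_independence[OF _ assms(2) N.a_subgroup] by simp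
qed

lemma in_coset:
  assumes "x \<in> carrier M" "y \<in> N +>\<^bsub>M\<^esub> x"
  shows "y \<in> carrier M" "N +>\<^bsub>M\<^esub> y = N +>\<^bsub>M\<^esub> x"
  using assms in_N(1) M.a_repr_independence[OF assms(2,1) N.a_subgroup]
  by (auto simp: a_r_coset_def')

lemma coset_smult_well_defined:
  assumes x: "x \<in> carrier M" and y: "y \<in> N +>\<^bsub>M\<^esub> x"
  shows "N +>\<^bsub>M\<^esub> (c \<odot>\<^bsub>M\<^esub> y) = N +>\<^bsub>M\<^esub> (c \<odot>\<^bsub>M\<^esub> x)"
proof -
  note y' = in_coset[OF x y]
  have "c \<odot>\<^bsub>M\<^esub> y \<ominus>\<^bsub>M\<^esub> c \<odot>\<^bsub>M\<^esub> x = c \<odot>\<^bsub>M\<^esub> (y \<ominus>\<^bsub>M\<^esub> x)"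
    using x y' M.smult_r_minus[of c x] M.smult_r_distr[of c y "\<ominus>\<^bsub>M\<^esub> x"] by (simp add: a_minus_def)
  moreover have "y \<ominus>\<^bsub>M\<^esub> x \<in> N"
    using coset_eq_iff[OF y'(1) x] y'(2) by simp
  ultimately show ?thesis
    using coset_eq_iff x y' module_groundD(3)[OF module_M] in_N(4) by simp
qed

lemma quotient_carrier: "carrier (quotient_space M N) = (\<lambda>x. N +>\<^bsub>M\<^esub> x) ` carrier M"
  by (auto simp: quotient_space_def A_RCOSETS_def')

lemma quotient_zero: "\<zero>\<^bsub>quotient_space M N\<^esub> = N +>\<^bsub>M\<^esub> \<zero>\<^bsub>M\<^esub>"
  using in_N(1) by (simp add: quotient_space_def)

lemma quotient_add:
  "x \<in> carrier M \<Longrightarrow> y \<in> carrier M \<Longrightarrow>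
    (N +>\<^bsub>M\<^esub> x) \<oplus>\<^bsub>quotient_space M N\<^esub> (N +>\<^bsub>M\<^esub> y) = N +>\<^bsub>M\<^esub> (x \<oplus>\<^bsub>M\<^esub> y)"
  by (simp add: quotient_space_def N.a_rcos_sum)

lemma quotient_smult:
  assumes x: "x \<in> carrier M"
  shows "c \<odot>\<^bsub>quotient_space M N\<^esub> (N +>\<^bsub>M\<^esub> x) = N +>\<^bsub>M\<^esub> (c \<odot>\<^bsub>M\<^esub> x)"
proof -
  have "(\<Union>y\<in>N +>\<^bsub>M\<^esub> x. N +>\<^bsub>M\<^esub> (c \<odot>\<^bsub>M\<^esub> y)) = (\<Union>y\<in>N +>\<^bsub>M\<^esub> x. N +>\<^bsub>M\<^esub> (c \<odot>\<^bsub>M\<^esub> x))"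
    by (rule SUP_cong[OF HOL.refl]) (rule coset_smult_well_defined[OF x])
  moreover have "N +>\<^bsub>M\<^esub> x \<noteq> {}"
    using N.a_rcos_self[OF x] by blast
  ultimately show ?thesis
    by (simp add: quotient_space_def)
qed

lemma module_quotient: "module ground (quotient_space M N)"
proof (rule moduleI[OF cring_ground])
  let ?Q = "quotient_space M N"
  have obtain_rep: "\<exists>x\<in>carrier M. a = N +>\<^bsub>M\<^esub> x" if "a \<in> carrier ?Q" for a
    using that by (auto simp: quotient_carrier)
  have closed: "N +>\<^bsub>M\<^esub> x \<in> carrier ?Q" if "x \<in> carrier M" for x
    using that by (auto simp: quotient_carrier)
  have scale: "c \<odot>\<^bsub>M\<^esub> x \<in> carrier M" if "x \<in> carrier M" for c x
    using that by (rule module_groundD[OF module_M])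
  show "abelian_group ?Q"
  proof (rule abelian_groupI)
    fix a b c assume "a \<in> carrier ?Q" "b \<in> carrier ?Q" "c \<in> carrier ?Q"
    then obtain x y z where "x \<in> carrier M" "a = N +>\<^bsub>M\<^esub> x" "y \<in> carrier M" "b = N +>\<^bsub>M\<^esub> y"
      "z \<in> carrier M" "c = N +>\<^bsub>M\<^esub> z"
      using obtain_rep by metis
    then show "a \<oplus>\<^bsub>?Q\<^esub> b \<oplus>\<^bsub>?Q\<^esub> c = a \<oplus>\<^bsub>?Q\<^esub> (b \<oplus>\<^bsub>?Q\<^esub> c)"
      by (simp add: quotient_add M.a_assoc)
  next
    fix a b assume "a \<in> carrier ?Q" "b \<in> carrier ?Q"
    then obtain x y where *: "x \<in> carrier M" "a = N +>\<^bsub>M\<^esub> x" "y \<in> carrier M" "b = N +>\<^bsub>M\<^esub> y"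
      using obtain_rep by metis
    then show "a \<oplus>\<^bsub>?Q\<^esub> b \<in> carrier ?Q"
      by (simp add: quotient_add closed)
    show "a \<oplus>\<^bsub>?Q\<^esub> b = b \<oplus>\<^bsub>?Q\<^esub> a"
      using * by (simp add: quotient_add M.a_comm)
  next
    fix a assume "a \<in> carrier ?Q"
    then obtain x where x: "x \<in> carrier M" "a = N +>\<^bsub>M\<^esub> x" using obtain_rep by blast
    then show "\<zero>\<^bsub>?Q\<^esub> \<oplus>\<^bsub>?Q\<^esub> a = a"
      by (simp add: quotient_zero quotient_add)
    have "(N +>\<^bsub>M\<^esub> (\<ominus>\<^bsub>M\<^esub> x)) \<oplus>\<^bsub>?Q\<^esub> a = \<zero>\<^bsub>?Q\<^esub>"
      using x by (simp add: quotient_zero quotient_add M.l_neg)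
    then show "\<exists>b\<in>carrier ?Q. b \<oplus>\<^bsub>?Q\<^esub> a = \<zero>\<^bsub>?Q\<^esub>"
      using closed[of "\<ominus>\<^bsub>M\<^esub> x"] x by blast
  qed (simp add: quotient_zero closed)
  fix c d a b
  assume "a \<in> carrier ?Q" "b \<in> carrier ?Q"
  then obtain x y where xy: "x \<in> carrier M" "a = N +>\<^bsub>M\<^esub> x" "y \<in> carrier M" "b = N +>\<^bsub>M\<^esub> y"
    using obtain_rep by metis
  show "c \<odot>\<^bsub>?Q\<^esub> (a \<oplus>\<^bsub>?Q\<^esub> b) = c \<odot>\<^bsub>?Q\<^esub> a \<oplus>\<^bsub>?Q\<^esub> c \<odot>\<^bsub>?Q\<^esub> b"
    using xy M.smult_r_distr[of c x y] by (simp add: quotient_add quotient_smult scale)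
next
  let ?Q = "quotient_space M N"
  fix c d a assume "a \<in> carrier ?Q"
  then obtain x where x: "x \<in> carrier M" "a = N +>\<^bsub>M\<^esub> x" by (auto simp: quotient_carrier)
  have scale: "c \<odot>\<^bsub>M\<^esub> x \<in> carrier M" for c
    using x(1) by (rule module_groundD[OF module_M])
  show "c \<odot>\<^bsub>?Q\<^esub> a \<in> carrier ?Q"
    using x scale by (simp add: quotient_smult quotient_carrier)
  show "(c \<oplus>\<^bsub>ground\<^esub> d) \<odot>\<^bsub>?Q\<^esub> a = c \<odot>\<^bsub>?Q\<^esub> a \<oplus>\<^bsub>?Q\<^esub> d \<odot>\<^bsub>?Q\<^esub> a"
    using x scale M.smult_l_distr[of c d x] by (simp add: quotient_smult quotient_add)
  show "(c \<otimes>\<^bsub>ground\<^esub> d) \<odot>\<^bsub>?Q\<^esub> a = c \<odot>\<^bsub>?Q\<^esub> (d \<odot>\<^bsub>?Q\<^esub> a)"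
    using x scale M.smult_assoc1[of c d x] by (simp add: quotient_smult)
  show "\<one>\<^bsub>ground\<^esub> \<odot>\<^bsub>?Q\<^esub> a = a"
    using x M.smult_one[of x] by (simp add: quotient_smult)
qed

text \<open>The preimage of a span of cosets is the span of \<open>N\<close> together with the
  representatives. This turns \<open>Q_space\<close> and \<open>R_space\<close>, which live in a
  quotient, into spans of concrete combinations of tuples.\<close>

lemma coset_in_span_iff:
  assumes S: "S \<subseteq> carrier M" and x: "x \<in> carrier M"
  shows "N +>\<^bsub>M\<^esub> x \<in> subspace_span (quotient_space M N) ((\<lambda>x. N +>\<^bsub>M\<^esub> x) ` S) \<longleftrightarrow>
    x \<in> subspace_span M (N \<union> S)" (is "?\<pi> x \<in> ?Q \<longleftrightarrow> x \<in> ?K")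
proof
  have NS: "N \<union> S \<subseteq> carrier M" and S': "?\<pi> ` S \<subseteq> carrier (quotient_space M N)"
    using S in_N(1) by (auto simp: quotient_carrier)
  note K = submodule_groundD[OF module_M subspace_span_submodule[OF module_M NS]]
  note Q = submodule_groundD[OF module_quotient subspace_span_submodule[OF module_quotient S']]
  have NK: "N \<subseteq> ?K" "S \<subseteq> ?K" using subspace_span_superset[of "N \<union> S" M] by auto
  {
    assume "?\<pi> x \<in> ?Q"
    \<comment> \<open>The image of \<open>?K\<close> is a submodule containing the generators, so
      \<open>x\<close> has the coset of some \<open>y\<close> in \<open>?K\<close>; their difference
      lies in \<open>N\<close> and thus in \<open>?K\<close>.\<close>
    have "submodule (?\<pi> ` ?K) ground (quotient_space M N)"
    proof (rule submodule_groundI[OF module_quotient])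
      fix a b c assume "a \<in> ?\<pi> ` ?K" "b \<in> ?\<pi> ` ?K"
      then show "a \<oplus>\<^bsub>quotient_space M N\<^esub> b \<in> ?\<pi> ` ?K"
        using K(1,3) by (auto simp: quotient_add subset_iff)
    next
      fix a c assume "a \<in> ?\<pi> ` ?K"
      then show "c \<odot>\<^bsub>quotient_space M N\<^esub> a \<in> ?\<pi> ` ?K"
        using K(1,4) by (auto simp: quotient_smult subset_iff)
    qed (use K(1,2) in \<open>auto simp: quotient_carrier quotient_zero\<close>)
    then have "?Q \<subseteq> ?\<pi> ` ?K"
      by (rule subspace_span_minimal) (use NK in auto)
    then obtain y where y: "y \<in> ?K" "?\<pi> x = ?\<pi> y"
      using \<open>?\<pi> x \<in> ?Q\<close> by auto
    then have "x \<ominus>\<^bsub>M\<^esub> y \<in> ?K"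
      using coset_eq_iff[OF x, of y] K(1) NK by auto
    then have "(x \<ominus>\<^bsub>M\<^esub> y) \<oplus>\<^bsub>M\<^esub> y \<in> ?K"
      using y K(3) by simp
    moreover have "y \<in> carrier M" using y K(1) by auto
    ultimately show "x \<in> ?K"
      using x by (simp add: a_minus_def M.a_assoc M.l_neg)
  next
    assume "x \<in> ?K"
    \<comment> \<open>Conversely the preimage of \<open>?Q\<close> is a submodule containing
      \<open>N\<close> and \<open>S\<close>.\<close>
    have "?K \<subseteq> {x \<in> carrier M. ?\<pi> x \<in> ?Q}"
    proof (rule subspace_span_minimal)
      show "submodule {x \<in> carrier M. ?\<pi> x \<in> ?Q} ground M"
        using Q(2-4) module_groundD(1-3)[OF module_M]
        by (intro submodule_groundI[OF module_M])
          (auto simp: quotient_add[symmetric] quotient_smult[symmetric] quotient_zero[symmetric])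
      have "?\<pi> x = \<zero>\<^bsub>quotient_space M N\<^esub>" if "x \<in> N" for x
        using N.a_rcos_const[OF that] by (simp add: quotient_space_def)
      then show "N \<union> S \<subseteq> {x \<in> carrier M. ?\<pi> x \<in> ?Q}"
        using NS Q(2) subspace_span_superset[of "?\<pi> ` S" "quotient_space M N"] by auto
    qed
    then show "?\<pi> x \<in> ?Q" using \<open>x \<in> ?K\<close> by auto
  }
qed

end

section \<open>Relations between tensors\<close>

lemma tuples_append:
  assumes "us \<in> tuples V i j" "vs \<in> tuples V j l"
  shows "us @ vs \<in> tuples V i l"
proof -
  have len: "int (length us) = j - i" using assms(1) by (simp add: tuples_def)
  have "(us @ vs) ! p \<in> carrier (iterated_dual V (i + int p))" if p: "p < length us + length vs" for p
  proof (cases "p < length us")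
    case True
    then show ?thesis using assms(1) by (simp add: tuples_def nth_append)
  next
    case False
    have "\<forall>q<length vs. vs ! q \<in> carrier (iterated_dual V (j + int q))"
      using assms(2) by (simp add: tuples_def)
    moreover have "p - length us < length vs"
      using p False by simp
    ultimately have "vs ! (p - length us) \<in> carrier (iterated_dual V (j + int (p - length us)))"
      by blast
    moreover have "j + int (p - length us) = i + int p"
      using len False by simp
    ultimately have "vs ! (p - length us) \<in> carrier (iterated_dual V (i + int p))"
      by (simp only:)
    then show ?thesis using False by (simp add: nth_append)
  qed
  then show ?thesis
    using assms by (simp add: tuples_def)
qed

lemma tuple_space_simps [simp]:
  "add (tuple_space V i j) = (+)" "zero (tuple_space V i j) = 0" "smult (tuple_space V i j) = word_scale"
  by (simp_all add: tuple_space_def)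

lemma tuple_space_carrier: "f \<in> carrier (tuple_space V i j) \<longleftrightarrow> Poly_Mapping.keys f \<subseteq> tuples V i j"
  by (simp add: tuple_space_def)

lemma module_tuple_space: "module ground (tuple_space V i j)"
proof (rule moduleI[OF cring_ground])
  have closed: "x + y \<in> carrier (tuple_space V i j)"
    if "x \<in> carrier (tuple_space V i j)" "y \<in> carrier (tuple_space V i j)" for x y
    using that keys_add[of x y] by (auto simp: tuple_space_carrier)
  have scale: "word_scale c x \<in> carrier (tuple_space V i j)" if "x \<in> carrier (tuple_space V i j)" for c x
    using that keys_word_scale[of c x] by (auto simp: tuple_space_carrier)
  show "abelian_group (tuple_space V i j)"
  proof (rule abelian_groupI)
    fix x assume x: "x \<in> carrier (tuple_space V i j)"
    have "word_scale (- 1) x + x = 0"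
      using word_scale_simps(2)[of "- 1" 1 x] by simp
    then show "\<exists>y\<in>carrier (tuple_space V i j). y \<oplus>\<^bsub>tuple_space V i j\<^esub> x = \<zero>\<^bsub>tuple_space V i j\<^esub>"
      using scale[OF x, of "- 1"] by auto
  qed (auto simp: closed ac_simps tuple_space_carrier[of 0])
  show "a \<odot>\<^bsub>tuple_space V i j\<^esub> x \<in> carrier (tuple_space V i j)"
    if "x \<in> carrier (tuple_space V i j)" for a x
    using scale[OF that] by simp
qed simp_all

lemma tuple_space_minus:
  assumes "x \<in> carrier (tuple_space V i j)" "y \<in> carrier (tuple_space V i j)"
  shows "x \<ominus>\<^bsub>tuple_space V i j\<^esub> y = x - y"
proof -
  interpret module ground "tuple_space V i j" by (rule module_tuple_space)
  have "(x \<ominus>\<^bsub>tuple_space V i j\<^esub> y) \<oplus>\<^bsub>tuple_space V i j\<^esub> y = x"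
    using assms by (simp del: tuple_space_simps add: a_minus_def M.a_assoc M.l_neg)
  then show ?thesis by (simp add: eq_diff_eq)
qed

lemma word_mult_tuple_space:
  "f \<in> carrier (tuple_space V i j) \<Longrightarrow> g \<in> carrier (tuple_space V j l) \<Longrightarrow>
    word_mult f g \<in> carrier (tuple_space V i l)"
  unfolding tuple_space_carrier
  by (rule keys_word_mult[of _ "tuples V i j" _ "tuples V j l"]) (auto intro: tuples_append)

lemma tuple_space_single: "w \<in> tuples V i j \<Longrightarrow> Poly_Mapping.single w c \<in> carrier (tuple_space V i j)"
  by (auto simp: tuple_space_carrier)

lemmas tuple_space_closed = module_groundD[OF module_tuple_space, simplified]

lemma tuple_space_closed_minus:
  "x \<in> carrier (tuple_space V i j) \<Longrightarrow> y \<in> carrier (tuple_space V i j) \<Longrightarrow>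
    x - y \<in> carrier (tuple_space V i j)"
  using keys_diff[of x y] by (auto simp: tuple_space_carrier)

text \<open>Isolates the theory of \<open>Snc V\<close> that rests on the iterated duals being
  vector spaces; coordinates enter in an extension of this locale.\<close>

locale dual_modules =
  fixes V :: "('k::field, 'v) module"
  assumes module_dual: "module ground (iterated_dual V i)"
begin

lemma tuples_update:
  assumes "us @ x # vs \<in> tuples V i j" "y \<in> carrier (iterated_dual V (i + int (length us)))"
  shows "us @ y # vs \<in> tuples V i j"
  using assms by (auto simp: tuples_def nth_append nth_Cons split: nat.splits if_splits)

lemma tuples_nth_mid:
  assumes "us @ x # vs \<in> tuples V i j"
  shows "x \<in> carrier (iterated_dual V (i + int (length us)))"
proof -
  have "\<forall>p<length (us @ x # vs). (us @ x # vs) ! p \<in> carrier (iterated_dual V (i + int p))"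
    using assms unfolding tuples_def mem_Collect_eq by (rule conjunct2)
  from this[rule_format, of "length us"] show ?thesis by simp
qed

text \<open>The generators from \<open>multilinear_relations\<close>, given inductively to obtain
  introduction and case rules.\<close>

inductive_set multilinear_generators :: "int \<Rightarrow> int \<Rightarrow> ('v list \<Rightarrow>\<^sub>0 'k) set" for i j where
  additive: "us @ x # vs \<in> tuples V i j \<Longrightarrow> us @ y # vs \<in> tuples V i j \<Longrightarrow>
    Poly_Mapping.single (us @ (x \<oplus>\<^bsub>iterated_dual V (i + int (length us))\<^esub> y) # vs) 1
      - Poly_Mapping.single (us @ x # vs) 1 - Poly_Mapping.single (us @ y # vs) 1
      \<in> multilinear_generators i j"
| homogeneous: "us @ x # vs \<in> tuples V i j \<Longrightarrow>
    Poly_Mapping.single (us @ (c \<odot>\<^bsub>iterated_dual V (i + int (length us))\<^esub> x) # vs) 1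
      - Poly_Mapping.single (us @ x # vs) c \<in> multilinear_generators i j"

lemma multilinear_relations_eq:
  "multilinear_relations V i j = subspace_span (tuple_space V i j) (multilinear_generators i j)"
proof -
  have "multilinear_generators i j =
    {Poly_Mapping.single (us @ (x \<oplus>\<^bsub>iterated_dual V (i + int (length us))\<^esub> y) # vs) 1
        - Poly_Mapping.single (us @ x # vs) 1 - Poly_Mapping.single (us @ y # vs) 1
      | us x y vs. us @ x # vs \<in> tuples V i j \<and> us @ y # vs \<in> tuples V i j} \<union>
     {Poly_Mapping.single (us @ (c \<odot>\<^bsub>iterated_dual V (i + int (length us))\<^esub> x) # vs) 1
        - Poly_Mapping.single (us @ x # vs) c
      | us c x vs. us @ x # vs \<in> tuples V i j}" (is "_ = ?S")
  proof (intro Set.equalityI subsetI)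
    fix f assume "f \<in> multilinear_generators i j"
    then show "f \<in> ?S" by cases blast+
  next
    fix f assume "f \<in> ?S"
    then show "f \<in> multilinear_generators i j" by (auto intro: multilinear_generators.intros)
  qed
  then show ?thesis by (simp only: multilinear_relations_def)
qed

lemma multilinear_generators_carrier: "multilinear_generators i j \<subseteq> carrier (tuple_space V i j)"
proof
  fix f assume "f \<in> multilinear_generators i j"
  then show "f \<in> carrier (tuple_space V i j)"
  proof cases
    case (additive us x vs y)
    then have "us @ (x \<oplus>\<^bsub>iterated_dual V (i + int (length us))\<^esub> y) # vs \<in> tuples V i j"
      using tuples_update tuples_nth_mid module_groundD(2)[OF module_dual] by metis
    then show ?thesis
      using additive by (simp add: tuple_space_closed_minus tuple_space_single)
  next
    case (homogeneous us x vs c)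
    then have "us @ (c \<odot>\<^bsub>iterated_dual V (i + int (length us))\<^esub> x) # vs \<in> tuples V i j"
      using tuples_update tuples_nth_mid module_groundD(3)[OF module_dual] by metis
    then show ?thesis
      using homogeneous by (simp add: tuple_space_closed_minus tuple_space_single)
  qed
qed

lemma submodule_multilinear: "submodule (multilinear_relations V i j) ground (tuple_space V i j)"
  unfolding multilinear_relations_eq
  by (rule subspace_span_submodule[OF module_tuple_space multilinear_generators_carrier])

lemmas multilinear_closed = submodule_groundD[OF module_tuple_space submodule_multilinear, simplified]

lemma generator_multilinear: "x \<in> multilinear_generators i j \<Longrightarrow> x \<in> multilinear_relations V i j"
  unfolding multilinear_relations_eq by (rule subsetD[OF subspace_span_superset])

lemma multilinear_induct [consumes 1, case_names zero gen add scale]: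
  assumes "m \<in> multilinear_relations V i j" "P 0" "\<And>x. x \<in> multilinear_generators i j \<Longrightarrow> P x"
    "\<And>x y. x \<in> multilinear_relations V i j \<Longrightarrow> y \<in> multilinear_relations V i j \<Longrightarrow> P x \<Longrightarrow> P y \<Longrightarrow> P (x + y)"
    "\<And>c x. x \<in> multilinear_relations V i j \<Longrightarrow> P x \<Longrightarrow> P (word_scale c x)"
  shows "P m"
  using subspace_span_induct[OF module_tuple_space multilinear_generators_carrier, of m i j P] assms
  unfolding multilinear_relations_eq by simp

lemma multilinear_generators_append:
  assumes f: "f \<in> multilinear_generators i j" and w: "w \<in> tuples V j l"
  shows "word_mult f (Poly_Mapping.single w 1) \<in> multilinear_generators i l"
  using f
proof cases
  case (additive us x vs y)
  then show ?thesis
    using multilinear_generators.additive[of us x "vs @ w" i l y]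
      tuples_append[OF additive(2) w] tuples_append[OF additive(3) w] by simp
next
  case (homogeneous us x vs c)
  then show ?thesis
    using multilinear_generators.homogeneous[of us x "vs @ w" i l c] tuples_append[OF homogeneous(2) w]
    by simp
qed

lemma multilinear_generators_prepend:
  assumes f: "f \<in> multilinear_generators j l" and w: "w \<in> tuples V i j"
  shows "word_mult (Poly_Mapping.single w 1) f \<in> multilinear_generators i l"
proof -
  \<comment> \<open>The modified entry moves right by \<open>length w = j - i\<close>, which
    compensates for the change of the starting index from \<open>j\<close> to \<open>i\<close>; the
    entry stays in the same iterated dual.\<close>
  have len: "i + (int (length w) + int k) = j + int k" for k
    using w by (simp add: tuples_def)
  show ?thesis
    using f
  proof cases
    case (additive us x vs y)
    then show ?thesis
      using multilinear_generators.additive[of "w @ us" x vs i l y]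
        tuples_append[OF w additive(2)] tuples_append[OF w additive(3)] by (simp add: len)
  next
    case (homogeneous us x vs c)
    then show ?thesis
      using multilinear_generators.homogeneous[of "w @ us" x vs i l c] tuples_append[OF w homogeneous(2)]
      by (simp add: len)
  qed
qed

lemma tuple_space_induct [consumes 1, case_names zero single add]:
  assumes "f \<in> carrier (tuple_space V i j)" and "P 0"
    and "\<And>w c. w \<in> tuples V i j \<Longrightarrow> P (word_scale c (Poly_Mapping.single w 1))"
    and "\<And>f g. f \<in> carrier (tuple_space V i j) \<Longrightarrow> g \<in> carrier (tuple_space V i j) \<Longrightarrow> P f \<Longrightarrow> P g \<Longrightarrow> P (f + g)"
  shows "P f"
proof -
  have "Poly_Mapping.keys f \<subseteq> tuples V i j" using assms(1) by (simp add: tuple_space_carrier)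
  then show ?thesis
    by (induction f rule: combination_induct) (use assms(2-) in \<open>auto simp: tuple_space_carrier\<close>)
qed

lemma multilinear_mult_right:
  assumes m: "m \<in> multilinear_relations V i j" and g: "g \<in> carrier (tuple_space V j l)"
  shows "word_mult m g \<in> multilinear_relations V i l"
  using m
proof (induction rule: multilinear_induct)
  case (gen x)
  show ?case
    using g
  proof (induction rule: tuple_space_induct)
    case (single w c)
    then have "word_mult x (Poly_Mapping.single w 1) \<in> multilinear_relations V i l"
      by (intro generator_multilinear multilinear_generators_append[OF gen])
    then show ?case
      by (simp only: word_mult_simps(6) multilinear_closed)
  qed (simp_all add: multilinear_closed)
qed (simp_all add: multilinear_closed)

lemma multilinear_mult_left:
  assumes m: "m \<in> multilinear_relations V j l" and g: "g \<in> carrier (tuple_space V i j)"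
  shows "word_mult g m \<in> multilinear_relations V i l"
  using m
proof (induction rule: multilinear_induct)
  case (gen x)
  show ?case
    using g
  proof (induction rule: tuple_space_induct)
    case (single w c)
    then have "word_mult (Poly_Mapping.single w 1) x \<in> multilinear_relations V i l"
      by (intro generator_multilinear multilinear_generators_prepend[OF gen])
    then show ?case
      by (simp only: word_mult_simps(3) multilinear_closed)
  qed (simp_all add: multilinear_closed)
qed (simp_all add: multilinear_closed)

sublocale tensor: quotient_by_submodule "tuple_space V i j" "multilinear_relations V i j" for i j
  by (rule quotient_by_submodule.intro) (rule module_tuple_space submodule_multilinear)+

lemma tensor_class_eq_iff:
  assumes "f \<in> carrier (tuple_space V i j)" "g \<in> carrier (tuple_space V i j)"
  shows "tensor_class V i j f = tensor_class V i j g \<longleftrightarrow> f - g \<in> multilinear_relations V i j"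
  using tensor.coset_eq_iff[OF assms] by (simp add: tensor_class_def tuple_space_minus[OF assms])

lemma tensor_space_carrier: "carrier (tensor_space V i j) = tensor_class V i j ` carrier (tuple_space V i j)"
  by (simp add: tensor_space_def tensor.quotient_carrier tensor_class_def)

lemma in_tensor_class:
  assumes "f \<in> carrier (tuple_space V i j)" "g \<in> tensor_class V i j f"
  shows "g \<in> carrier (tuple_space V i j)" "tensor_class V i j g = tensor_class V i j f"
  using tensor.in_coset[OF assms(1), of g] assms(2) by (simp_all add: tensor_class_def)

lemma tensor_class_self: "f \<in> carrier (tuple_space V i j) \<Longrightarrow> f \<in> tensor_class V i j f"
  unfolding tensor_class_def by (rule tensor.N.a_rcos_self)

lemma tensor_class_mult_cong:
  assumes "f \<in> carrier (tuple_space V i j)" "f' \<in> carrier (tuple_space V i j)"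
    "g \<in> carrier (tuple_space V j l)" "g' \<in> carrier (tuple_space V j l)"
    and "tensor_class V i j f' = tensor_class V i j f" "tensor_class V j l g' = tensor_class V j l g"
  shows "tensor_class V i l (word_mult f' g') = tensor_class V i l (word_mult f g)"
proof -
  \<comment> \<open>One factor is changed at a time; relations absorb tuples on either side.\<close>
  have "word_mult f' g' - word_mult f g = word_mult (f' - f) g' + word_mult f (g' - g)"
    by simp
  also have "\<dots> \<in> multilinear_relations V i l"
    using assms by (intro multilinear_closed multilinear_mult_left multilinear_mult_right)
      (simp_all add: tensor_class_eq_iff)
  finally show ?thesis
    using assms by (simp add: tensor_class_eq_iff word_mult_tuple_space)
qed

lemma tensor_mult_class:
  assumes f: "f \<in> carrier (tuple_space V i j)" and g: "g \<in> carrier (tuple_space V j l)"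
  shows "tensor_mult V i l (tensor_class V i j f) (tensor_class V j l g) = tensor_class V i l (word_mult f g)"
proof -
  have "tensor_class V i l (word_mult f' g') = tensor_class V i l (word_mult f g)"
    if "f' \<in> tensor_class V i j f" "g' \<in> tensor_class V j l g" for f' g'
    using in_tensor_class[OF f that(1)] in_tensor_class[OF g that(2)] f g
    by (intro tensor_class_mult_cong) auto
  then show ?thesis
    using tensor_class_self[OF f] tensor_class_self[OF g] unfolding tensor_mult_def by blast
qed

text \<open>Every basis contributes a combination. Their agreement is expressed later by their
  common image \<open>b\<close> in the free algebra.\<close>

definition canonical_tensors :: "int \<Rightarrow> ('v list \<Rightarrow>\<^sub>0 'k) set" where
  "canonical_tensors i = {\<Sum>b\<in>B. Poly_Mapping.single [b, b' b] 1 | B b'. is_basis (iterated_dual V i) B \<and>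
    (\<forall>b\<in>B. b' b \<in> carrier (iterated_dual V (i + 1)) \<and>
      (\<forall>c\<in>B. pairing V i c (b' b) = (if c = b then 1 else 0)))}"

text \<open>The full preimage of \<open>Q_space V i\<close> among combinations of tuples; adjoining
  the multilinear relations makes membership independent of the representative of a tensor.\<close>

definition Q_relations :: "int \<Rightarrow> ('v list \<Rightarrow>\<^sub>0 'k) set" where
  "Q_relations i = subspace_span (tuple_space V i (i + 2)) (multilinear_relations V i (i + 2) \<union> canonical_tensors i)"

definition R_generators :: "int \<Rightarrow> int \<Rightarrow> ('v list \<Rightarrow>\<^sub>0 'k) set" where
  "R_generators i j = (\<Union>p\<in>{i..j - 2}. {word_mult u (word_mult q v) | u q v.
    u \<in> carrier (tuple_space V i p) \<and> q \<in> Q_relations p \<and> v \<in> carrier (tuple_space V (p + 2) j)})"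

definition R_relations :: "int \<Rightarrow> int \<Rightarrow> ('v list \<Rightarrow>\<^sub>0 'k) set" where
  "R_relations i j = subspace_span (tuple_space V i j) (multilinear_relations V i j \<union> R_generators i j)"

lemma tuple_space_sum:
  "(\<And>x. x \<in> S \<Longrightarrow> h x \<in> carrier (tuple_space V i j)) \<Longrightarrow> sum h S \<in> carrier (tuple_space V i j)"
  by (induction S rule: infinite_finite_induct) (auto simp: tuple_space_closed)

lemma tuples_singleton: "x \<in> carrier (iterated_dual V i) \<Longrightarrow> [x] \<in> tuples V i (i + 1)"
  by (simp add: tuples_def)

lemma canonical_tensors_carrier: "canonical_tensors i \<subseteq> carrier (tuple_space V i (i + 2))"
proof
  fix f assume "f \<in> canonical_tensors i"
  then obtain B b' where f: "f = (\<Sum>b\<in>B. Poly_Mapping.single [b, b' b] 1)"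
    and B: "is_basis (iterated_dual V i) B" "\<forall>b\<in>B. b' b \<in> carrier (iterated_dual V (i + 1))"
    unfolding canonical_tensors_def by blast
  have "[b, b' b] \<in> tuples V i (i + 2)" if "b \<in> B" for b
    using B that tuples_append[OF tuples_singleton tuples_singleton, of b i "b' b"]
    by (auto simp: is_basis_def add.assoc)
  then show "f \<in> carrier (tuple_space V i (i + 2))"
    unfolding f by (intro tuple_space_sum tuple_space_single)
qed

lemma Q_generators_carrier:
  "multilinear_relations V i (i + 2) \<union> canonical_tensors i \<subseteq> carrier (tuple_space V i (i + 2))"
  using canonical_tensors_carrier multilinear_closed(1) by auto

lemma Q_space_alt:
  "Q_space V i = subspace_span (tensor_space V i (i + 2)) (tensor_class V i (i + 2) ` canonical_tensors i)"
proof -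
  have "{tensor_class V i (i + 2) (\<Sum>b\<in>B. Poly_Mapping.single [b, b' b] 1) | B b'. is_basis (iterated_dual V i) B \<and>
        (\<forall>b\<in>B. b' b \<in> carrier (iterated_dual V (i + 1)) \<and>
          (\<forall>c\<in>B. pairing V i c (b' b) = (if c = b then 1 else 0)))} =
      tensor_class V i (i + 2) ` canonical_tensors i"
    unfolding canonical_tensors_def by blast
  then show ?thesis
    by (simp only: Q_space_def)
qed

lemma Q_space_iff:
  assumes "f \<in> carrier (tuple_space V i (i + 2))"
  shows "tensor_class V i (i + 2) f \<in> Q_space V i \<longleftrightarrow> f \<in> Q_relations i"
  using tensor.coset_in_span_iff[OF canonical_tensors_carrier assms]
  by (simp add: Q_space_alt Q_relations_def tensor_class_def[abs_def] tensor_space_def)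

lemma Q_relations_carrier: "Q_relations i \<subseteq> carrier (tuple_space V i (i + 2))"
  unfolding Q_relations_def
  by (rule submodule_groundD(1)[OF module_tuple_space
      subspace_span_submodule[OF module_tuple_space Q_generators_carrier]])

lemma module_tensor_space: "module ground (tensor_space V i j)"
  unfolding tensor_space_def by (rule tensor.module_quotient)

lemma Q_space_eq: "Q_space V i = tensor_class V i (i + 2) ` Q_relations i"
proof (intro Set.equalityI subsetI)
  fix q assume q: "q \<in> Q_space V i"
  have "tensor_class V i (i + 2) ` canonical_tensors i \<subseteq> carrier (tensor_space V i (i + 2))"
    using canonical_tensors_carrier by (auto simp: tensor_space_carrier)
  then have "Q_space V i \<subseteq> carrier (tensor_space V i (i + 2))"
    unfolding Q_space_alt
    by (intro submodule_groundD(1)[OF module_tensor_space subspace_span_submodule[OF module_tensor_space]])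
  then obtain f where "f \<in> carrier (tuple_space V i (i + 2))" "q = tensor_class V i (i + 2) f"
    using q by (auto simp: tensor_space_carrier)
  then show "q \<in> tensor_class V i (i + 2) ` Q_relations i"
    using q Q_space_iff by blast
next
  fix q assume "q \<in> tensor_class V i (i + 2) ` Q_relations i"
  then show "q \<in> Q_space V i"
    using Q_space_iff Q_relations_carrier by blast
qed

lemma R_generators_carrier: "R_generators i j \<subseteq> carrier (tuple_space V i j)"
proof
  fix f assume "f \<in> R_generators i j"
  then obtain p u q v where f: "f = word_mult u (word_mult q v)" and u: "u \<in> carrier (tuple_space V i p)"
    and q: "q \<in> Q_relations p" and v: "v \<in> carrier (tuple_space V (p + 2) j)"
    unfolding R_generators_def by blast
  show "f \<in> carrier (tuple_space V i j)"
    unfolding f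
    by (rule word_mult_tuple_space[OF u word_mult_tuple_space[OF subsetD[OF Q_relations_carrier q] v]])
qed

lemma R_relations_carrier:
  "multilinear_relations V i j \<union> R_generators i j \<subseteq> carrier (tuple_space V i j)"
  using R_generators_carrier multilinear_closed(1) by auto

lemma submodule_R_relations: "submodule (R_relations i j) ground (tuple_space V i j)"
  unfolding R_relations_def by (rule subspace_span_submodule[OF module_tuple_space R_relations_carrier])

lemmas R_relations_closed = submodule_groundD[OF module_tuple_space submodule_R_relations, simplified]

text \<open>Products of classes are classes of products, so the generators can be multiplied as
  combinations of tuples before passing to tensors.\<close>

lemma R_space_eq: "R_space V i j = subspace_span (tensor_space V i j) (tensor_class V i j ` R_generators i j)"
proof -
  have "{tensor_mult V i j u (tensor_mult V p j q v) | u q v. u \<in> carrier (tensor_space V i p) \<and>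
      q \<in> Q_space V p \<and> v \<in> carrier (tensor_space V (p + 2) j)} =
    tensor_class V i j ` {word_mult u (word_mult q v) | u q v.
      u \<in> carrier (tuple_space V i p) \<and> q \<in> Q_relations p \<and> v \<in> carrier (tuple_space V (p + 2) j)}"
    (is "?A = _ ` ?B") for p
  proof -
    have eq: "tensor_mult V i j (tensor_class V i p u) (tensor_mult V p j (tensor_class V p (p + 2) q) (tensor_class V (p + 2) j v))
        = tensor_class V i j (word_mult u (word_mult q v))"
      if "u \<in> carrier (tuple_space V i p)" "q \<in> Q_relations p" "v \<in> carrier (tuple_space V (p + 2) j)" for u q v
    proof -
      have q: "q \<in> carrier (tuple_space V p (p + 2))" using that(2) Q_relations_carrier by blast
      show ?thesis
        by (simp only: tensor_mult_class[OF q that(3)] tensor_mult_class[OF that(1) word_mult_tuple_space[OF q that(3)]])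
    qed
    show ?thesis
    proof (intro Set.equalityI subsetI)
      fix a assume "a \<in> ?A"
      then obtain U Q W where a: "a = tensor_mult V i j U (tensor_mult V p j Q W)"
        and "U \<in> carrier (tensor_space V i p)" "Q \<in> Q_space V p" "W \<in> carrier (tensor_space V (p + 2) j)"
        by blast
      then obtain u q v where *: "u \<in> carrier (tuple_space V i p)" "q \<in> Q_relations p"
          "v \<in> carrier (tuple_space V (p + 2) j)"
        and UQW: "U = tensor_class V i p u" "Q = tensor_class V p (p + 2) q" "W = tensor_class V (p + 2) j v"
        unfolding Q_space_eq tensor_space_carrier by auto
      have "a = tensor_class V i j (word_mult u (word_mult q v))"
        unfolding a UQW by (rule eq[OF *])
      then show "a \<in> tensor_class V i j ` ?B" using * by blast
    next
      fix a assume "a \<in> tensor_class V i j ` ?B"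
      then obtain u q v where *: "u \<in> carrier (tuple_space V i p)" "q \<in> Q_relations p"
          "v \<in> carrier (tuple_space V (p + 2) j)" "a = tensor_class V i j (word_mult u (word_mult q v))"
        by blast
      have "tensor_class V i p u \<in> carrier (tensor_space V i p)" "tensor_class V p (p + 2) q \<in> Q_space V p"
        "tensor_class V (p + 2) j v \<in> carrier (tensor_space V (p + 2) j)"
        using *(1-3) by (auto simp: tensor_space_carrier Q_space_eq)
      then show "a \<in> ?A"
        unfolding *(4) eq[OF *(1-3), symmetric] by blast
    qed
  qed
  then show ?thesis
    unfolding R_space_def R_generators_def image_UN by simp
qed

lemma R_space_iff:
  assumes "f \<in> carrier (tuple_space V i j)"
  shows "tensor_class V i j f \<in> R_space V i j \<longleftrightarrow> f \<in> R_relations i j"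
  using tensor.coset_in_span_iff[OF R_generators_carrier assms]
  by (simp add: R_space_eq R_relations_def tensor_class_def[abs_def] tensor_space_def)

lemma R_relations_induct [consumes 1, case_names multilinear gen add scale]:
  assumes "m \<in> R_relations i j" "\<And>x. x \<in> multilinear_relations V i j \<Longrightarrow> P x"
    "\<And>p u q v. i \<le> p \<Longrightarrow> p + 2 \<le> j \<Longrightarrow> u \<in> carrier (tuple_space V i p) \<Longrightarrow> q \<in> Q_relations p \<Longrightarrow>
      v \<in> carrier (tuple_space V (p + 2) j) \<Longrightarrow> P (word_mult u (word_mult q v))"
    "\<And>x y. P x \<Longrightarrow> P y \<Longrightarrow> P (x + y)" "\<And>c x. P x \<Longrightarrow> P (word_scale c x)"
  shows "P m"
proof -
  have "m \<in> subspace_span (tuple_space V i j) (multilinear_relations V i j \<union> R_generators i j)"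
    using assms(1) by (simp only: R_relations_def)
  then show ?thesis
  proof (induction rule: subspace_span_induct[OF module_tuple_space R_relations_carrier,
        consumes 1, case_names zero gen add smult])
    case zero
    then show ?case using assms(2)[OF multilinear_closed(2)] by simp
  next
    case (gen x)
    show ?case
    proof (cases "x \<in> multilinear_relations V i j")
      case False
      then obtain p u q v where x: "x = word_mult u (word_mult q v)" and "p \<in> {i..j - 2}"
        "u \<in> carrier (tuple_space V i p)" "q \<in> Q_relations p" "v \<in> carrier (tuple_space V (p + 2) j)"
        using gen unfolding R_generators_def by blast
      then show ?thesis
        unfolding x by (intro assms(3)[of p]) simp_all
    qed (rule assms(2))
  next
    case (add x y)
    then show ?case using assms(4) by simp
  next
    case (smult c x)
    then show ?case using assms(5) by simp
  qed
qed

lemma multilinear_subset_R: "multilinear_relations V i j \<subseteq> R_relations i j"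
  and R_generators_subset: "R_generators i j \<subseteq> R_relations i j"
  using subspace_span_superset[of "multilinear_relations V i j \<union> R_generators i j" "tuple_space V i j"]
  by (simp_all add: R_relations_def)

lemma tuple_space_empty: "j < i \<Longrightarrow> f \<in> carrier (tuple_space V i j) \<Longrightarrow> f = 0"
  by (auto simp: tuple_space_carrier tuples_def)

lemma R_relations_mult_right:
  assumes "m \<in> R_relations i j" and g: "g \<in> carrier (tuple_space V j l)"
  shows "word_mult m g \<in> R_relations i l"
  using assms(1)
proof (induction rule: R_relations_induct)
  case (multilinear x)
  then show ?case using multilinear_mult_right[OF _ g] multilinear_subset_R by blast
next
  case (gen p u q v)
  show ?case
  proof (cases "l < j")
    \<comment> \<open>Here \<open>p\<close> may lie outside \<open>{i..l - 2}\<close>, but no tuple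
      runs from \<open>j\<close> to a smaller \<open>l\<close>, so \<open>g\<close> is zero.\<close>
    case True
    then show ?thesis using tuple_space_empty[OF _ g] R_relations_closed(2) by simp
  next
    case False
    then have "p \<in> {i..l - 2}" using gen by simp
    then have "word_mult u (word_mult q (word_mult v g)) \<in> R_generators i l"
      unfolding R_generators_def using gen word_mult_tuple_space[OF gen(5) g] by blast
    then show ?thesis using R_generators_subset by (auto simp: word_mult_assoc)
  qed
qed (simp_all add: R_relations_closed)

lemma R_relations_mult_left:
  assumes "m \<in> R_relations j l" and g: "g \<in> carrier (tuple_space V i j)"
  shows "word_mult g m \<in> R_relations i l"
  using assms(1)
proof (induction rule: R_relations_induct)
  case (multilinear x)
  then show ?case using multilinear_mult_left[OF _ g] multilinear_subset_R by blast
next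
  case (gen p u q v)
  show ?case
  proof (cases "j < i")
    case True
    then show ?thesis using tuple_space_empty[OF _ g] R_relations_closed(2) by simp
  next
    case False
    then have "p \<in> {i..l - 2}" using gen by simp
    then have "word_mult (word_mult g u) (word_mult q v) \<in> R_generators i l"
      unfolding R_generators_def using gen word_mult_tuple_space[OF g gen(3)] by blast
    then show ?thesis using R_generators_subset by (auto simp: word_mult_assoc)
  qed
qed (simp_all add: R_relations_closed)

section \<open>Elements of the noncommutative symmetric algebra\<close>

sublocale sym: quotient_by_submodule "tensor_space V i j" "R_space V i j" for i j
proof (rule quotient_by_submodule.intro)
  show module: "module ground (tensor_space V i j)"
    unfolding tensor_space_def by (rule tensor.module_quotient)
  show "submodule (R_space V i j) ground (tensor_space V i j)"
    unfolding R_space_eq using R_generators_carrier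
    by (intro subspace_span_submodule[OF module]) (auto simp: tensor_space_carrier)
qed

text \<open>Elements of \<open>A_ij\<close> are cosets of cosets; this names them by combinations of
  tuples, on which all later comparisons take place.\<close>

definition sym_class :: "int \<Rightarrow> int \<Rightarrow> ('v list \<Rightarrow>\<^sub>0 'k) \<Rightarrow> ('v list \<Rightarrow>\<^sub>0 'k) set set" where
  "sym_class i j f = R_space V i j +>\<^bsub>tensor_space V i j\<^esub> tensor_class V i j f"

lemma tensor_class_carrier:
  "f \<in> carrier (tuple_space V i j) \<Longrightarrow> tensor_class V i j f \<in> carrier (tensor_space V i j)"
  by (auto simp: tensor_space_carrier)

lemma zpart_carrier: "carrier (zpart (Snc V) i j) = sym_class i j ` carrier (tuple_space V i j)"
  by (simp add: Snc_def sym.quotient_carrier tensor_space_carrier image_image sym_class_def)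

lemma tensor_class_add:
  assumes "f \<in> carrier (tuple_space V i j)" "g \<in> carrier (tuple_space V i j)"
  shows "tensor_class V i j f \<oplus>\<^bsub>tensor_space V i j\<^esub> tensor_class V i j g = tensor_class V i j (f + g)"
  using tensor.quotient_add[OF assms] by (simp add: tensor_class_def tensor_space_def)

lemma sym_class_eq_iff:
  assumes f: "f \<in> carrier (tuple_space V i j)" and g: "g \<in> carrier (tuple_space V i j)"
  shows "sym_class i j f = sym_class i j g \<longleftrightarrow> f - g \<in> R_relations i j"
proof -
  have d: "f - g \<in> carrier (tuple_space V i j)" using f g by (rule tuple_space_closed_minus)
  \<comment> \<open>Writing the class of \<open>f\<close> as a sum lets the group laws of the
    quotient compute the difference of classes.\<close>
  have f_eq: "tensor_class V i j f = tensor_class V i j (f - g) \<oplus>\<^bsub>tensor_space V i j\<^esub> tensor_class V i j g"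
    using tensor_class_add[OF d g] by simp
  have "tensor_class V i j f \<ominus>\<^bsub>tensor_space V i j\<^esub> tensor_class V i j g = tensor_class V i j (f - g)"
    using tensor_class_carrier[OF d] tensor_class_carrier[OF g]
    unfolding f_eq by (simp add: a_minus_def sym.M.a_assoc sym.M.r_neg)
  then show ?thesis
    using sym.coset_eq_iff[OF tensor_class_carrier[OF f] tensor_class_carrier[OF g]] R_space_iff[OF d]
    by (simp add: sym_class_def)
qed

lemma zpart_add:
  assumes "f \<in> carrier (tuple_space V i j)" "g \<in> carrier (tuple_space V i j)"
  shows "sym_class i j f \<oplus>\<^bsub>zpart (Snc V) i j\<^esub> sym_class i j g = sym_class i j (f + g)"
  using sym.quotient_add[OF tensor_class_carrier[OF assms(1)] tensor_class_carrier[OF assms(2)]]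
  by (simp add: Snc_def sym_class_def tensor_class_add assms)

lemma sym_class_mult_cong:
  assumes f: "f \<in> carrier (tuple_space V i j)" "f' \<in> carrier (tuple_space V i j)"
    and g: "g \<in> carrier (tuple_space V j l)" "g' \<in> carrier (tuple_space V j l)"
    and "sym_class i j f' = sym_class i j f" "sym_class j l g' = sym_class j l g"
  shows "sym_class i l (word_mult f' g') = sym_class i l (word_mult f g)"
proof -
  have "word_mult f' g' - word_mult f g = word_mult (f' - f) g' + word_mult f (g' - g)"
    by simp
  also have "\<dots> \<in> R_relations i l"
    using assms by (intro R_relations_closed R_relations_mult_left R_relations_mult_right)
      (simp_all add: sym_class_eq_iff)
  finally show ?thesis
    using assms by (simp add: sym_class_eq_iff word_mult_tuple_space)
qed

lemma in_sym_class:
  assumes f: "f \<in> carrier (tuple_space V i j)" and s: "s \<in> sym_class i j f"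
  obtains f' where "f' \<in> carrier (tuple_space V i j)" "s = tensor_class V i j f'" "sym_class i j f' = sym_class i j f"
proof -
  have "s \<in> carrier (tensor_space V i j)"
    "R_space V i j +>\<^bsub>tensor_space V i j\<^esub> s = sym_class i j f"
    using sym.in_coset[OF tensor_class_carrier[OF f]] s by (simp_all add: sym_class_def)
  then show ?thesis using that by (auto simp: tensor_space_carrier sym_class_def)
qed

lemma zmult_class:
  assumes f: "f \<in> carrier (tuple_space V i j)" and g: "g \<in> carrier (tuple_space V j l)"
  shows "zmult (Snc V) i j l (sym_class i j f) (sym_class j l g) = sym_class i l (word_mult f g)"
proof -
  have *: "R_space V i l +>\<^bsub>tensor_space V i l\<^esub> tensor_mult V i l s t = sym_class i l (word_mult f g)"
    if s: "s \<in> sym_class i j f" and t: "t \<in> sym_class j l g" for s t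
  proof -
    obtain f' g' where "f' \<in> carrier (tuple_space V i j)" "s = tensor_class V i j f'" "sym_class i j f' = sym_class i j f"
      "g' \<in> carrier (tuple_space V j l)" "t = tensor_class V j l g'" "sym_class j l g' = sym_class j l g"
      using in_sym_class[OF f s] in_sym_class[OF g t] by metis
    then show ?thesis
      using sym_class_mult_cong[OF f(1) _ g] by (simp add: tensor_mult_class sym_class_def)
  qed
  have "tensor_class V i j f \<in> sym_class i j f" "tensor_class V j l g \<in> sym_class j l g"
    unfolding sym_class_def by (rule sym.N.a_rcos_self, rule tensor_class_carrier, fact)+
  then show ?thesis
    using * unfolding Snc_def by auto
qed

lemma zunit_class: "zunit (Snc V) i = sym_class i i (Poly_Mapping.single [] 1)"
  by (simp add: Snc_def sym_class_def)

end

section \<open>Coordinates on the iterated duals\<close>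

text \<open>Coordinates take values in the span of the letters instead of tuples of scalars, so that
  they can be twisted by \<open>\<tau>\<close> and multiplied as words.\<close>

definition coordinatization :: "nat \<Rightarrow> ('k::field, 'v) module \<Rightarrow> ('v \<Rightarrow> (nat list \<Rightarrow>\<^sub>0 'k)) \<Rightarrow> bool" where
  "coordinatization n U m \<longleftrightarrow> module ground U \<and> bij_betw m (carrier U) (free_grade n 1) \<and>
    (\<forall>x\<in>carrier U. \<forall>y\<in>carrier U. m (x \<oplus>\<^bsub>U\<^esub> y) = m x + m y) \<and>
    (\<forall>c. \<forall>x\<in>carrier U. m (c \<odot>\<^bsub>U\<^esub> x) = word_scale c (m x))"

definition basis_vector :: "('k::field, 'v) module \<Rightarrow> ('v \<Rightarrow> (nat list \<Rightarrow>\<^sub>0 'k)) \<Rightarrow> nat \<Rightarrow> 'v" where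
  "basis_vector U m a = inv_into (carrier U) m (letter a)"

text \<open>The coordinates on the dual for which the basis dual to \<open>basis_vector\<close>
  corresponds to the letters.\<close>

definition dual_coord ::
  "nat \<Rightarrow> ('k::field, 'v) module \<Rightarrow> ('v \<Rightarrow> (nat list \<Rightarrow>\<^sub>0 'k)) \<Rightarrow> 'v \<Rightarrow> (nat list \<Rightarrow>\<^sub>0 'k)" where
  "dual_coord n U m w = (\<Sum>a=1..n. word_scale (functional_of U w (basis_vector U m a)) (letter a))"

lemma coordinatization_inv_into:
  assumes U: "module ground U" and bij: "bij_betw p (free_grade n 1) (carrier U)"
    and add: "\<And>f g. f \<in> free_grade n 1 \<Longrightarrow> g \<in> free_grade n 1 \<Longrightarrow> p (f + g) = p f \<oplus>\<^bsub>U\<^esub> p g"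
    and scale: "\<And>c f. f \<in> free_grade n 1 \<Longrightarrow> p (word_scale c f) = c \<odot>\<^bsub>U\<^esub> p f"
  shows "coordinatization n U (inv_into (free_grade n 1) p)"
proof -
  let ?m = "inv_into (free_grade n 1) p"
  have m: "?m x \<in> free_grade n 1" "p (?m x) = x" if "x \<in> carrier U" for x
    using bij_betw_apply[OF bij_betw_inv_into[OF bij] that] bij_betw_inv_into_right[OF bij that] by auto
  have mp: "?m (p f) = f" if "f \<in> free_grade n 1" for f
    using bij_betw_inv_into_left[OF bij that] .
  have "?m (x \<oplus>\<^bsub>U\<^esub> y) = ?m x + ?m y" if "x \<in> carrier U" "y \<in> carrier U" for x y
    using add[OF m(1)[OF that(1)] m(1)[OF that(2)]] mp[OF free_grade_add[OF m(1)[OF that(1)] m(1)[OF that(2)]]]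
    by (simp add: m that)
  moreover have "?m (c \<odot>\<^bsub>U\<^esub> x) = word_scale c (?m x)" if "x \<in> carrier U" for c x
    using scale[OF m(1)[OF that]] mp[OF free_grade_scale[OF m(1)[OF that]]]
    by (simp add: m that)
  ultimately show ?thesis
    using U bij_betw_inv_into[OF bij] by (simp add: coordinatization_def)
qed

lemma coordinatization_exists:
  fixes V :: "('k::field, 'v) module"
  assumes "vector_space_of_dim V n"
  shows "\<exists>m. coordinatization n V m"
proof -
  obtain B where V: "module ground V" and B: "is_basis V B" "card B = n"
    using assms by (auto simp: vector_space_of_dim_def)
  interpret V: module "ground :: 'k ring" V by (fact V)
  have fin: "finite B" and sub: "B \<subseteq> carrier V"
    and uniq: "\<And>v. v \<in> carrier V \<Longrightarrow> \<exists>!a. a \<in> extensional B \<and> v = (\<Oplus>\<^bsub>V\<^esub>b\<in>B. a b \<odot>\<^bsub>V\<^esub> b)"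
    using B(1) by (auto simp: is_basis_def)
  obtain h where h: "bij_betw h {1..n} B"
    using ex_bij_betw_nat_finite_1[OF fin] B(2) by auto
  define g where "g = inv_into {1..n} h"
  have g: "g b \<in> {1..n}" "h (g b) = b" if "b \<in> B" for b
    using bij_betw_apply[OF bij_betw_inv_into[OF h] that] bij_betw_inv_into_right[OF h that]
    by (auto simp: g_def)
  have gh: "h a \<in> B" "g (h a) = a" if "a \<in> {1..n}" for a
    using bij_betw_apply[OF h that] bij_betw_inv_into_left[OF h that] by (auto simp: g_def)
  define p where "p f = (\<Oplus>\<^bsub>V\<^esub>b\<in>B. coord f (g b) \<odot>\<^bsub>V\<^esub> b)" for f :: "nat list \<Rightarrow>\<^sub>0 'k"
  have scale: "c \<odot>\<^bsub>V\<^esub> b \<in> carrier V" if "b \<in> B" for c b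
    using module_groundD(3)[OF V] that sub by auto
  have p_closed: "p f \<in> carrier V" for f
    unfolding p_def using scale by (intro V.finsum_closed) auto
  have "p (f + f') = p f \<oplus>\<^bsub>V\<^esub> p f'" for f f'
  proof -
    have "p (f + f') = (\<Oplus>\<^bsub>V\<^esub>b\<in>B. coord f (g b) \<odot>\<^bsub>V\<^esub> b \<oplus>\<^bsub>V\<^esub> coord f' (g b) \<odot>\<^bsub>V\<^esub> b)"
      unfolding p_def
    proof (rule V.finsum_cong')
      fix b assume "b \<in> B"
      then show "coord (f + f') (g b) \<odot>\<^bsub>V\<^esub> b = coord f (g b) \<odot>\<^bsub>V\<^esub> b \<oplus>\<^bsub>V\<^esub> coord f' (g b) \<odot>\<^bsub>V\<^esub> b"
        using V.smult_l_distr[of "coord f (g b)" "coord f' (g b)" b] sub by (auto simp: lookup_add)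
    qed (use scale in auto)
    also have "\<dots> = p f \<oplus>\<^bsub>V\<^esub> p f'"
      unfolding p_def using scale by (intro V.finsum_addf) auto
    finally show ?thesis .
  qed
  moreover have "p (word_scale c f) = c \<odot>\<^bsub>V\<^esub> p f" for c f
  proof -
    have "c \<odot>\<^bsub>V\<^esub> p f = (\<Oplus>\<^bsub>V\<^esub>b\<in>B. c \<odot>\<^bsub>V\<^esub> (coord f (g b) \<odot>\<^bsub>V\<^esub> b))"
      unfolding p_def using scale by (intro V.finsum_smult_ldistr[OF fin]) auto
    also have "\<dots> = p (word_scale c f)"
      unfolding p_def
    proof (rule V.finsum_cong')
      fix b assume "b \<in> B"
      then show "c \<odot>\<^bsub>V\<^esub> (coord f (g b) \<odot>\<^bsub>V\<^esub> b) = coord (word_scale c f) (g b) \<odot>\<^bsub>V\<^esub> b"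
        using V.smult_assoc1[of c "coord f (g b)" b] sub by auto
    qed (use scale in auto)
    finally show ?thesis ..
  qed
  moreover have "bij_betw p (free_grade n 1) (carrier V)"
    unfolding bij_betw_def
  proof
    show "inj_on p (free_grade n 1)"
    proof (rule inj_onI)
      fix f f' assume f: "f \<in> free_grade n 1" "f' \<in> free_grade n 1" and eq: "p f = p f'"
      \<comment> \<open>\<open>is_basis\<close> asserts uniqueness among coefficient functions
        extensional on \<open>B\<close>, so the coefficients are restricted before being
        compared.\<close>
      define r where "r f = restrict (\<lambda>b. coord f (g b)) B" for f :: "nat list \<Rightarrow>\<^sub>0 'k"
      have r: "r f \<in> extensional B" "p f = (\<Oplus>\<^bsub>V\<^esub>b\<in>B. r f b \<odot>\<^bsub>V\<^esub> b)" for f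
        unfolding p_def r_def using scale by (auto intro!: V.finsum_cong')
      have r': "p f = (\<Oplus>\<^bsub>V\<^esub>b\<in>B. r f' b \<odot>\<^bsub>V\<^esub> b)"
        unfolding eq by (rule r)
      have "r f = r f'"
        using ex1E[OF uniq[OF p_closed[of f]]] r[of f] r(1)[of f'] r' by blast
      then have r_eq: "r f b = r f' b" for b by simp
      have "coord f (g b) = coord f' (g b)" if "b \<in> B" for b
        using r_eq[of b] that by (simp add: r_def)
      then have "coord f a = coord f' a" if "a \<in> {1..n}" for a
        using gh[OF that] by metis
      then show "f = f'" using f by (intro free_grade_one_eqI[OF f])
    qed
    have "v \<in> p ` free_grade n 1" if v: "v \<in> carrier V" for v
    proof -
      obtain a where a: "v = (\<Oplus>\<^bsub>V\<^esub>b\<in>B. a b \<odot>\<^bsub>V\<^esub> b)" using uniq[OF v] by blast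
      have "coord (\<Sum>x=1..n. word_scale (a (h x)) (letter x)) (g b) = a b" if "b \<in> B" for b
        by (simp only: coord_sum_letter[OF g(1)[OF that]] g(2)[OF that])
      then have "p (\<Sum>x=1..n. word_scale (a (h x)) (letter x)) = v"
        unfolding a p_def using scale by (intro V.finsum_cong') (auto simp del: word_scale_simps)
      then show ?thesis
        using imageI[OF letter_sum_grade[of "\<lambda>x. a (h x)" n], of p] by simp
    qed
    then show "p ` free_grade n 1 = carrier V" using p_closed by auto
  qed
  ultimately show ?thesis
    using coordinatization_inv_into[OF V, of p n] by blast
qed

section \<open>A coordinatized space and its dual\<close>

context
  fixes U :: "('k::field, 'v) module" and m :: "'v \<Rightarrow> (nat list \<Rightarrow>\<^sub>0 'k)" and n :: nat
  assumes m: "coordinatization n U m"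
begin

lemma coordinatization_module: "module ground U"
  using m by (simp add: coordinatization_def)

interpretation U: module "ground :: 'k ring" U
  by (rule coordinatization_module)

lemma coordinatization_bij: "bij_betw m (carrier U) (free_grade n 1)"
  using m by (simp add: coordinatization_def)

lemma coordinatization_add: "x \<in> carrier U \<Longrightarrow> y \<in> carrier U \<Longrightarrow> m (x \<oplus>\<^bsub>U\<^esub> y) = m x + m y"
  using m by (simp add: coordinatization_def)

lemma coordinatization_scale: "x \<in> carrier U \<Longrightarrow> m (c \<odot>\<^bsub>U\<^esub> x) = word_scale c (m x)"
  using m by (simp add: coordinatization_def)

lemma coordinatization_grade: "x \<in> carrier U \<Longrightarrow> m x \<in> free_grade n 1"
  using bij_betw_apply[OF coordinatization_bij] .

lemma coordinatization_eqI: "x \<in> carrier U \<Longrightarrow> y \<in> carrier U \<Longrightarrow> m x = m y \<Longrightarrow> x = y"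
  using coordinatization_bij by (auto simp: bij_betw_def inj_on_def)

lemma coordinatization_zero: "m \<zero>\<^bsub>U\<^esub> = 0"
  using coordinatization_add[OF U.zero_closed U.zero_closed] by simp

lemma coordinatization_finsum:
  assumes "finite B" "B \<subseteq> carrier U"
  shows "m (\<Oplus>\<^bsub>U\<^esub>b\<in>B. a b \<odot>\<^bsub>U\<^esub> b) = (\<Sum>b\<in>B. word_scale (a b) (m b))"
  using assms
proof (induction B rule: finite_induct)
  case empty
  then show ?case by (simp add: coordinatization_zero)
next
  case (insert x B)
  have scale: "a b \<odot>\<^bsub>U\<^esub> b \<in> carrier U" if "b \<in> insert x B" for b
    using module_groundD(3)[OF coordinatization_module] that insert.prems by auto
  then have "(\<Oplus>\<^bsub>U\<^esub>b\<in>insert x B. a b \<odot>\<^bsub>U\<^esub> b) = a x \<odot>\<^bsub>U\<^esub> x \<oplus>\<^bsub>U\<^esub> (\<Oplus>\<^bsub>U\<^esub>b\<in>B. a b \<odot>\<^bsub>U\<^esub> b)"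
    using insert by (intro U.finsum_insert) auto
  moreover have "(\<Oplus>\<^bsub>U\<^esub>b\<in>B. a b \<odot>\<^bsub>U\<^esub> b) \<in> carrier U"
    using scale by (intro U.finsum_closed) auto
  ultimately show ?case
    using insert scale by (simp add: coordinatization_add coordinatization_scale)
qed

lemma basis_vector: "a \<in> {1..n} \<Longrightarrow> basis_vector U m a \<in> carrier U \<and> m (basis_vector U m a) = letter a"
  using bij_betw_apply[OF bij_betw_inv_into[OF coordinatization_bij] letter_grade]
    bij_betw_inv_into_right[OF coordinatization_bij letter_grade]
  by (auto simp: basis_vector_def)

text \<open>A functional is determined by its values on the basis. The induction runs over the
  coordinates of \<open>u\<close>, pulled back along the inverse of \<open>m\<close>, because degree
  one elements have an induction rule.\<close>

lemma functional_expand: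
  assumes \<phi>: "\<phi> \<in> functionals U" and u: "u \<in> carrier U"
  shows "\<phi> u = (\<Sum>a=1..n. coord (m u) a * \<phi> (basis_vector U m a))"
proof -
  let ?i = "inv_into (carrier U) m"
  have i: "?i f \<in> carrier U" "m (?i f) = f" if "f \<in> free_grade n 1" for f
    using bij_betw_apply[OF bij_betw_inv_into[OF coordinatization_bij] that]
      bij_betw_inv_into_right[OF coordinatization_bij that] by auto
  have \<phi>_add: "\<phi> (x \<oplus>\<^bsub>U\<^esub> y) = \<phi> x + \<phi> y" if "x \<in> carrier U" "y \<in> carrier U" for x y
    using \<phi> that by (simp add: functionals_def)
  have \<phi>_scale: "\<phi> (c \<odot>\<^bsub>U\<^esub> x) = c * \<phi> x" if "x \<in> carrier U" for c x
    using \<phi> that by (simp add: functionals_def)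
  have "\<phi> (?i f) = (\<Sum>a=1..n. coord f a * \<phi> (?i (letter a)))" if "f \<in> free_grade n 1" for f
    using that
  proof (induction f rule: free_grade_induct)
    case zero
    have "?i 0 = \<zero>\<^bsub>U\<^esub>"
      using i[OF free_grade_zero] by (intro coordinatization_eqI) (simp_all add: coordinatization_zero)
    have "\<phi> \<zero>\<^bsub>U\<^esub> = \<phi> \<zero>\<^bsub>U\<^esub> + \<phi> \<zero>\<^bsub>U\<^esub>"
      using \<phi>_add[OF U.zero_closed U.zero_closed] by (simp only: U.l_zero[OF U.zero_closed])
    then have "\<phi> \<zero>\<^bsub>U\<^esub> = 0" by (simp only: add_cancel_right_right)
    then show ?case using \<open>?i 0 = \<zero>\<^bsub>U\<^esub>\<close> by simp
  next
    case (single w c)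
    then obtain a where a: "w = [a]" "a \<in> {1..n}"
      by (auto simp: length_Suc_conv)
    have "?i (Poly_Mapping.single w c) = c \<odot>\<^bsub>U\<^esub> ?i (letter a)"
      using i[OF letter_grade[OF a(2)]] i[OF free_grade_single[OF single, of c]] a
        module_groundD(3)[OF coordinatization_module]
      by (intro coordinatization_eqI) (simp_all add: coordinatization_scale)
    then have "\<phi> (?i (Poly_Mapping.single w c)) = c * \<phi> (?i (letter a))"
      using \<phi>_scale i[OF letter_grade[OF a(2)]] by simp
    also have "\<dots> = (\<Sum>b=1..n. if b = a then c * \<phi> (?i (letter b)) else 0)"
      using a(2) by simp
    also have "\<dots> = (\<Sum>b=1..n. coord (Poly_Mapping.single w c) b * \<phi> (?i (letter b)))"
      using a(1) by (intro sum.cong) (auto simp: lookup_single when_def)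
    finally show ?case .
  next
    case (add f g)
    have "?i (f + g) = ?i f \<oplus>\<^bsub>U\<^esub> ?i g"
      using i[OF add(1)] i[OF add(2)] i[OF free_grade_add[OF add(1,2)]]
      by (intro coordinatization_eqI) (simp_all add: coordinatization_add)
    then show ?case
      using add i by (simp add: \<phi>_add lookup_add sum.distrib algebra_simps)
  qed
  from this[OF coordinatization_grade[OF u]] show ?thesis
    using bij_betw_inv_into_left[OF coordinatization_bij u] by (simp add: basis_vector_def)
qed

lemma basis_vector_inj: "inj_on (basis_vector U m) {1..n}"
proof (rule inj_onI)
  fix a b assume "a \<in> {1..n}" "b \<in> {1..n}" "basis_vector U m a = basis_vector U m b"
  then have "(letter a :: nat list \<Rightarrow>\<^sub>0 'k) = letter b" using basis_vector by metis
  then show "a = b" using coord_letter[of a a] coord_letter[of b a] by (metis zero_neq_one)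
qed

text \<open>Serves two purposes: a basis makes \<open>dual_code\<close> injective, and this
  particular one later exhibits a canonical tensor.\<close>

lemma is_basis_basis_vector: "is_basis U (basis_vector U m ` {1..n})"
  unfolding is_basis_def
proof (intro conjI ballI)
  let ?B = "basis_vector U m ` {1..n}"
  show "finite ?B" by simp
  show B: "?B \<subseteq> carrier U" using basis_vector by auto
  fix v assume v: "v \<in> carrier U"
  have fin: "finite ?B" by simp
  have sum_eq: "m (\<Oplus>\<^bsub>U\<^esub>b\<in>?B. a b \<odot>\<^bsub>U\<^esub> b) = (\<Sum>x=1..n. word_scale (a (basis_vector U m x)) (letter x))" for a
    unfolding coordinatization_finsum[OF fin B] sum.reindex[OF basis_vector_inj] o_def
    using basis_vector by (intro sum.cong) auto
  have closed: "(\<Oplus>\<^bsub>U\<^esub>b\<in>?B. a b \<odot>\<^bsub>U\<^esub> b) \<in> carrier U" for a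
    using B module_groundD(3)[OF coordinatization_module] by (intro U.finsum_closed) blast
  \<comment> \<open>Through \<open>m\<close> the equation of vectors becomes one of coordinates,
    which yields existence and uniqueness of the coefficients together.\<close>
  have iff: "v = (\<Oplus>\<^bsub>U\<^esub>b\<in>?B. a b \<odot>\<^bsub>U\<^esub> b) \<longleftrightarrow> (\<forall>x\<in>{1..n}. a (basis_vector U m x) = coord (m v) x)" for a
  proof
    assume "v = (\<Oplus>\<^bsub>U\<^esub>b\<in>?B. a b \<odot>\<^bsub>U\<^esub> b)"
    then have "m v = (\<Sum>x=1..n. word_scale (a (basis_vector U m x)) (letter x))" using sum_eq by metis
    then show "\<forall>x\<in>{1..n}. a (basis_vector U m x) = coord (m v) x"
      using coord_sum_letter[of _ n "\<lambda>x. a (basis_vector U m x)"] by metis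
  next
    assume *: "\<forall>x\<in>{1..n}. a (basis_vector U m x) = coord (m v) x"
    have "m (\<Oplus>\<^bsub>U\<^esub>b\<in>?B. a b \<odot>\<^bsub>U\<^esub> b) = m v"
      unfolding sum_eq
      by (rule free_grade_one_eqI[OF letter_sum_grade coordinatization_grade[OF v]])
        (use * in \<open>simp only: coord_sum_letter\<close>)
    then show "v = (\<Oplus>\<^bsub>U\<^esub>b\<in>?B. a b \<odot>\<^bsub>U\<^esub> b)"
      by (rule coordinatization_eqI[OF closed v, symmetric])
  qed
  define c where "c = restrict (\<lambda>b. coord (m v) (inv_into {1..n} (basis_vector U m) b)) ?B"
  have c: "c (basis_vector U m x) = coord (m v) x" if "x \<in> {1..n}" for x
    using that inv_into_f_f[OF basis_vector_inj that] by (simp add: c_def)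
  show "\<exists>!a. a \<in> extensional ?B \<and> v = (\<Oplus>\<^bsub>U\<^esub>b\<in>?B. a b \<odot>\<^bsub>U\<^esub> b)"
    unfolding iff
  proof (rule ex1I[of _ c])
    show "c \<in> extensional ?B \<and> (\<forall>x\<in>{1..n}. c (basis_vector U m x) = coord (m v) x)"
      using c by (simp add: c_def)
    fix a assume a: "a \<in> extensional ?B \<and> (\<forall>x\<in>{1..n}. a (basis_vector U m x) = coord (m v) x)"
    show "a = c"
      by (rule extensionalityI[of _ ?B]) (use a c in \<open>auto simp: c_def\<close>)
  qed
qed

lemma functional_of_code: "\<phi> \<in> functionals U \<Longrightarrow> functional_of U (dual_code U \<phi>) = \<phi>"
  unfolding functional_of_def
  by (rule inv_into_f_f[OF inj_on_dual_code[OF coordinatization_module is_basis_basis_vector]])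

lemma functional_of_functional: "w \<in> carrier (dual U) \<Longrightarrow> functional_of U w \<in> functionals U"
  by (auto simp: dual_def functional_of_code)

lemma code_functional_of: "w \<in> carrier (dual U) \<Longrightarrow> dual_code U (functional_of U w) = w"
  by (auto simp: dual_def functional_of_code)

lemma dual_closed: "\<phi> \<in> functionals U \<Longrightarrow> dual_code U \<phi> \<in> carrier (dual U)"
  by (simp add: dual_def)

lemma functionals_closed:
  shows "(\<lambda>x\<in>carrier U. 0) \<in> functionals U"
    and "\<phi> \<in> functionals U \<Longrightarrow> \<psi> \<in> functionals U \<Longrightarrow> (\<lambda>x\<in>carrier U. \<phi> x + \<psi> x) \<in> functionals U"
    and "\<phi> \<in> functionals U \<Longrightarrow> (\<lambda>x\<in>carrier U. c * \<phi> x) \<in> functionals U"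
  using module_groundD[OF coordinatization_module] by (auto simp: functionals_def algebra_simps)

lemma dual_simps:
  "\<zero>\<^bsub>dual U\<^esub> = dual_code U (\<lambda>x\<in>carrier U. 0)"
  "w \<oplus>\<^bsub>dual U\<^esub> w' = dual_code U (\<lambda>x\<in>carrier U. functional_of U w x + functional_of U w' x)"
  "c \<odot>\<^bsub>dual U\<^esub> w = dual_code U (\<lambda>x\<in>carrier U. c * functional_of U w x)"
  by (simp_all add: dual_def)

lemma functional_of_simps:
  assumes "w \<in> carrier (dual U)"
  shows "w' \<in> carrier (dual U) \<Longrightarrow>
      functional_of U (w \<oplus>\<^bsub>dual U\<^esub> w') = (\<lambda>x\<in>carrier U. functional_of U w x + functional_of U w' x)"
    and "functional_of U (c \<odot>\<^bsub>dual U\<^esub> w) = (\<lambda>x\<in>carrier U. c * functional_of U w x)"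
  using assms by (simp_all add: dual_simps functional_of_code functionals_closed functional_of_functional)

lemma functional_of_zero: "functional_of U \<zero>\<^bsub>dual U\<^esub> = (\<lambda>x\<in>carrier U. 0)"
  by (simp add: dual_simps functional_of_code functionals_closed)

lemma dual_eqI:
  assumes w: "w \<in> carrier (dual U)" "w' \<in> carrier (dual U)"
    and eq: "\<And>x. x \<in> carrier U \<Longrightarrow> functional_of U w x = functional_of U w' x"
  shows "w = w'"
proof -
  have "functional_of U w = functional_of U w'"
    using functional_of_functional[OF w(1)] functional_of_functional[OF w(2)] eq
    by (intro extensionalityI[of _ "carrier U"]) (auto simp: functionals_def)
  then show ?thesis using code_functional_of w by metis
qed

lemma dual_closed_simps:
  "\<zero>\<^bsub>dual U\<^esub> \<in> carrier (dual U)"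
  "w \<in> carrier (dual U) \<Longrightarrow> w' \<in> carrier (dual U) \<Longrightarrow> w \<oplus>\<^bsub>dual U\<^esub> w' \<in> carrier (dual U)"
  "w \<in> carrier (dual U) \<Longrightarrow> c \<odot>\<^bsub>dual U\<^esub> w \<in> carrier (dual U)"
  by (simp_all add: dual_simps dual_closed functionals_closed functional_of_functional)

text \<open>Each law is checked on values: \<open>dual_eqI\<close> reduces an equation of codes to
  functionals, and decoding makes the operations pointwise.\<close>

lemma module_dual: "module ground (dual U)"
proof (rule moduleI[OF cring_ground])
  note simps = functional_of_simps functional_of_zero dual_closed_simps algebra_simps
  show "abelian_group (dual U)"
  proof (rule abelian_groupI)
    fix w assume w: "w \<in> carrier (dual U)"
    have "(- 1) \<odot>\<^bsub>dual U\<^esub> w \<oplus>\<^bsub>dual U\<^esub> w = \<zero>\<^bsub>dual U\<^esub>"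
      by (rule dual_eqI) (use w in \<open>simp_all add: simps\<close>)
    then show "\<exists>w'\<in>carrier (dual U). w' \<oplus>\<^bsub>dual U\<^esub> w = \<zero>\<^bsub>dual U\<^esub>"
      using dual_closed_simps(3)[OF w] by blast
  qed (auto intro!: dual_eqI simp: simps)
  fix c d w w'
  assume w: "w \<in> carrier (dual U)" and w': "w' \<in> carrier (dual U)"
  show "c \<odot>\<^bsub>dual U\<^esub> (w \<oplus>\<^bsub>dual U\<^esub> w') = c \<odot>\<^bsub>dual U\<^esub> w \<oplus>\<^bsub>dual U\<^esub> c \<odot>\<^bsub>dual U\<^esub> w'"
    by (rule dual_eqI) (use w w' in \<open>simp_all add: simps\<close>)
next
  note simps = functional_of_simps functional_of_zero dual_closed_simps algebra_simps
  fix c d w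
  assume w: "w \<in> carrier (dual U)"
  show "c \<odot>\<^bsub>dual U\<^esub> w \<in> carrier (dual U)"
    using w by (rule dual_closed_simps)
  show "(c \<oplus>\<^bsub>ground\<^esub> d) \<odot>\<^bsub>dual U\<^esub> w = c \<odot>\<^bsub>dual U\<^esub> w \<oplus>\<^bsub>dual U\<^esub> d \<odot>\<^bsub>dual U\<^esub> w"
    by (rule dual_eqI) (use w in \<open>simp_all add: simps\<close>)
  show "(c \<otimes>\<^bsub>ground\<^esub> d) \<odot>\<^bsub>dual U\<^esub> w = c \<odot>\<^bsub>dual U\<^esub> (d \<odot>\<^bsub>dual U\<^esub> w)"
    by (rule dual_eqI) (use w in \<open>simp_all add: simps\<close>)
  show "\<one>\<^bsub>ground\<^esub> \<odot>\<^bsub>dual U\<^esub> w = w"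
    by (rule dual_eqI) (use w in \<open>simp_all add: simps\<close>)
qed

lemma dual_coord_grade: "dual_coord n U m w \<in> free_grade n 1"
  unfolding dual_coord_def by (rule letter_sum_grade)

lemma coord_dual_coord: "a \<in> {1..n} \<Longrightarrow> coord (dual_coord n U m w) a = functional_of U w (basis_vector U m a)"
  unfolding dual_coord_def by (rule coord_sum_letter)

text \<open>In these coordinates evaluation is the standard bilinear form on the span of the
  letters.\<close>

lemma functional_of_coord:
  assumes "w \<in> carrier (dual U)" "u \<in> carrier U"
  shows "functional_of U w u = (\<Sum>a=1..n. coord (dual_coord n U m w) a * coord (m u) a)"
  using functional_expand[OF functional_of_functional[OF assms(1)] assms(2)]
  by (simp add: coord_dual_coord mult.commute)

lemma coordinatization_dual: "coordinatization n (dual U) (dual_coord n U m)"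
  unfolding coordinatization_def
proof (intro conjI ballI allI)
  show "module ground (dual U)" by (rule module_dual)
  show "bij_betw (dual_coord n U m) (carrier (dual U)) (free_grade n 1)"
    unfolding bij_betw_def
  proof
    show "inj_on (dual_coord n U m) (carrier (dual U))"
      by (intro inj_onI dual_eqI) (simp_all add: functional_of_coord)
    have "f \<in> dual_coord n U m ` carrier (dual U)" if f: "f \<in> free_grade n 1" for f
    proof -
      \<comment> \<open>Surjectivity: the functional with prescribed coordinates \<open>f\<close> is
        the standard form with \<open>f\<close>.\<close>
      let ?\<phi> = "\<lambda>u\<in>carrier U. \<Sum>a=1..n. coord f a * coord (m u) a"
      have \<phi>: "?\<phi> \<in> functionals U"
        using module_groundD[OF coordinatization_module]
        by (auto simp: functionals_def coordinatization_add coordinatization_scale lookup_add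
            sum.distrib sum_distrib_left algebra_simps)
      have eq: "dual_coord n U m (dual_code U ?\<phi>) = f"
      proof (rule free_grade_one_eqI[OF dual_coord_grade f])
        fix a assume a: "a \<in> {1..n}"
        have "coord (dual_coord n U m (dual_code U ?\<phi>)) a = (\<Sum>b=1..n. coord f b * coord (letter a) b)"
          unfolding coord_dual_coord[OF a] functional_of_code[OF \<phi>] using basis_vector[OF a] by simp
        also have "\<dots> = (\<Sum>b=1..n. if b = a then coord f b else 0)"
          by (intro sum.cong) (auto simp: coord_letter)
        also have "\<dots> = coord f a" using a by simp
        finally show "coord (dual_coord n U m (dual_code U ?\<phi>)) a = coord f a" .
      qed
      show ?thesis
        using imageI[OF dual_closed[OF \<phi>], of "dual_coord n U m"] unfolding eq .
    qed
    then show "dual_coord n U m ` carrier (dual U) = free_grade n 1"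
      using dual_coord_grade by auto
  qed
next
  fix x y assume xy: "x \<in> carrier (dual U)" "y \<in> carrier (dual U)"
  show "dual_coord n U m (x \<oplus>\<^bsub>dual U\<^esub> y) = dual_coord n U m x + dual_coord n U m y"
    by (rule free_grade_one_eqI[OF dual_coord_grade free_grade_add[OF dual_coord_grade dual_coord_grade]])
      (use xy basis_vector in \<open>simp add: coord_dual_coord functional_of_simps lookup_add\<close>)
next
  fix c x assume "x \<in> carrier (dual U)"
  then show "dual_coord n U m (c \<odot>\<^bsub>dual U\<^esub> x) = word_scale c (dual_coord n U m x)"
    using basis_vector by (simp add: dual_coord_def functional_of_simps word_scale_sum)
qed

lemma coordinatization_compose:
  assumes bij: "bij_betw \<tau> (free_grade n 1) (free_grade n 1)"
    and add: "\<And>f g. f \<in> free_grade n 1 \<Longrightarrow> g \<in> free_grade n 1 \<Longrightarrow> \<tau> (f + g) = \<tau> f + \<tau> g"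
    and scale: "\<And>c f. f \<in> free_grade n 1 \<Longrightarrow> \<tau> (word_scale c f) = word_scale c (\<tau> f)"
  shows "coordinatization n U (\<lambda>x. \<tau> (m x))"
  using bij_betw_trans[OF coordinatization_bij bij] coordinatization_module
  by (simp add: coordinatization_def coordinatization_add coordinatization_scale coordinatization_grade
      add scale o_def)

end

section \<open>Coordinates on all iterated duals, adapted to the twist\<close>

locale twist =
  fixes n :: nat and \<tau> :: "(nat list \<Rightarrow>\<^sub>0 'k::field) \<Rightarrow> (nat list \<Rightarrow>\<^sub>0 'k)"
  assumes \<tau>_bij: "bij_betw \<tau> (free_grade n 1) (free_grade n 1)"
    and \<tau>_add: "f \<in> free_grade n 1 \<Longrightarrow> g \<in> free_grade n 1 \<Longrightarrow> \<tau> (f + g) = \<tau> f + \<tau> g"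
    and \<tau>_scale: "f \<in> free_grade n 1 \<Longrightarrow> \<tau> (word_scale c f) = word_scale c (\<tau> f)"
begin

abbreviation \<tau>_inv :: "(nat list \<Rightarrow>\<^sub>0 'k) \<Rightarrow> (nat list \<Rightarrow>\<^sub>0 'k)" where
  "\<tau>_inv \<equiv> inv_into (free_grade n 1) \<tau>"

lemma \<tau>_\<tau>_inv: "f \<in> free_grade n 1 \<Longrightarrow> \<tau> (\<tau>_inv f) = f"
  and \<tau>_inv_\<tau>: "f \<in> free_grade n 1 \<Longrightarrow> \<tau>_inv (\<tau> f) = f"
  and \<tau>_inv_grade: "f \<in> free_grade n 1 \<Longrightarrow> \<tau>_inv f \<in> free_grade n 1"
  using bij_betw_inv_into_right[OF \<tau>_bij] bij_betw_inv_into_left[OF \<tau>_bij]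
    bij_betw_apply[OF bij_betw_inv_into[OF \<tau>_bij]]
  by auto

lemma \<tau>_grade: "f \<in> free_grade n 1 \<Longrightarrow> \<tau> f \<in> free_grade n 1"
  using bij_betw_apply[OF \<tau>_bij] .

lemma \<tau>_inv_add:
  assumes "f \<in> free_grade n 1" "g \<in> free_grade n 1"
  shows "\<tau>_inv (f + g) = \<tau>_inv f + \<tau>_inv g"
  using \<tau>_inv_\<tau>[OF free_grade_add[OF \<tau>_inv_grade[OF assms(1)] \<tau>_inv_grade[OF assms(2)]]]
  by (simp add: \<tau>_add \<tau>_inv_grade \<tau>_\<tau>_inv assms)

lemma \<tau>_inv_scale:
  assumes "f \<in> free_grade n 1"
  shows "\<tau>_inv (word_scale c f) = word_scale c (\<tau>_inv f)"
  using \<tau>_inv_\<tau>[OF free_grade_scale[OF \<tau>_inv_grade[OF assms]]]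
  by (simp add: \<tau>_scale \<tau>_inv_grade \<tau>_\<tau>_inv assms)

text \<open>Going up, dual coordinates are followed by \<open>\<tau>\<close>: the basis dual to the
  one labelled by the letters is sent to the elements \<open>\<tau> (letter a)\<close>.\<close>

primrec coord_pos :: "('k, 'v) module \<Rightarrow> ('v \<Rightarrow> (nat list \<Rightarrow>\<^sub>0 'k)) \<Rightarrow> nat \<Rightarrow> 'v \<Rightarrow> (nat list \<Rightarrow>\<^sub>0 'k)" where
  "coord_pos V m 0 = m"
| "coord_pos V m (Suc k) = (\<lambda>x. \<tau> (dual_coord n ((dual ^^ k) V) (coord_pos V m k) x))"

text \<open>Going down, the coordinates on the second factor of the pairing are known. Applying
  \<open>\<tau>_inv\<close> to them first and then dualizing solves the same condition for the first
  factor.\<close>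

primrec coord_neg :: "('k, 'v) module \<Rightarrow> ('v \<Rightarrow> (nat list \<Rightarrow>\<^sub>0 'k)) \<Rightarrow> nat \<Rightarrow> 'v \<Rightarrow> (nat list \<Rightarrow>\<^sub>0 'k)" where
  "coord_neg V m 0 = m"
| "coord_neg V m (Suc k) = dual_coord n ((dual ^^ k) V) (\<lambda>x. \<tau>_inv (coord_neg V m k x))"

context
  fixes V :: "('k, 'v) module" and m :: "'v \<Rightarrow> (nat list \<Rightarrow>\<^sub>0 'k)"
  assumes m: "coordinatization n V m"
begin

lemma coordinatization_coord_pos: "coordinatization n ((dual ^^ k) V) (coord_pos V m k)"
proof (induction k)
  case (Suc k)
  show ?case
    using coordinatization_compose[OF coordinatization_dual[OF Suc] \<tau>_bij \<tau>_add \<tau>_scale] by simp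
qed (simp add: m)

lemma coordinatization_\<tau>_inv: "coordinatization n U m' \<Longrightarrow> coordinatization n U (\<lambda>x. \<tau>_inv (m' x))"
  using coordinatization_compose[OF _ bij_betw_inv_into[OF \<tau>_bij] \<tau>_inv_add \<tau>_inv_scale] .

lemma coordinatization_coord_neg: "coordinatization n ((dual ^^ k) V) (coord_neg V m k)"
proof (induction k)
  case (Suc k)
  show ?case
    using coordinatization_dual[OF coordinatization_\<tau>_inv[OF Suc]] by simp
qed (simp add: m)

definition twisted_coord :: "int \<Rightarrow> 'v \<Rightarrow> (nat list \<Rightarrow>\<^sub>0 'k)" where
  "twisted_coord i = (if 0 \<le> i then coord_pos V m (nat i) else coord_neg V m (nat (- i)))"

lemma coordinatization_twisted_coord: "coordinatization n (iterated_dual V i) (twisted_coord i)"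
  using coordinatization_coord_pos[of "nat i"] coordinatization_coord_neg[of "nat (- i)"]
  by (auto simp: iterated_dual_def twisted_coord_def abs_if)

text \<open>The condition that both recursions are designed to meet. For nonnegative
  \<open>i\<close> the functional is \<open>w\<close>, for negative \<open>i\<close> it is
  \<open>u\<close>, as in the definition of \<open>pairing\<close>.\<close>

lemma pairing_twisted_coord:
  assumes u: "u \<in> carrier (iterated_dual V i)" and w: "w \<in> carrier (iterated_dual V (i + 1))"
  shows "pairing V i u w = (\<Sum>a=1..n. coord (twisted_coord i u) a * coord (\<tau>_inv (twisted_coord (i + 1) w)) a)"
proof (cases "0 \<le> i")
  case True
  define k where "k = nat i"
  have i: "i = int k" "nat (i + 1) = Suc k" using True by (simp_all add: k_def)
  have n: "nat \<bar>i\<bar> = k" "nat \<bar>i + 1\<bar> = Suc k" using True by (simp_all add: k_def)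
  have U: "iterated_dual V i = (dual ^^ k) V" "iterated_dual V (i + 1) = dual ((dual ^^ k) V)"
    by (simp_all only: iterated_dual_def n funpow.simps o_apply)
  have grade: "dual_coord n ((dual ^^ k) V) (coord_pos V m k) w \<in> free_grade n 1"
    by (rule dual_coord_grade[OF coordinatization_coord_pos])
  have "pairing V i u w = functional_of ((dual ^^ k) V) w u"
    using True by (simp add: pairing_def U)
  also have "\<dots> = (\<Sum>a=1..n. coord (dual_coord n ((dual ^^ k) V) (coord_pos V m k) w) a * coord (coord_pos V m k u) a)"
    using u w by (intro functional_of_coord[OF coordinatization_coord_pos]) (simp_all add: U)
  also have "\<dots> = (\<Sum>a=1..n. coord (twisted_coord i u) a * coord (\<tau>_inv (twisted_coord (i + 1) w)) a)"
    using i grade by (simp add: twisted_coord_def \<tau>_inv_\<tau> mult.commute)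
  finally show ?thesis .
next
  case False
  \<comment> \<open>The number of dualizations leading to index \<open>i + 1\<close>; one more leads
    to \<open>i\<close>.\<close>
  define k where "k = nat (- i - 1)"
  have i: "i = - int (Suc k)" using False by (simp add: k_def)
  have n: "nat \<bar>i\<bar> = Suc k" "nat \<bar>i + 1\<bar> = k" by (simp_all add: i)
  have U: "iterated_dual V i = dual ((dual ^^ k) V)" "iterated_dual V (i + 1) = (dual ^^ k) V"
    by (simp_all only: iterated_dual_def n funpow.simps o_apply)
  \<comment> \<open>For \<open>k = 0\<close> the index \<open>i + 1\<close> is 0 and falls under the
    nonnegative branch; both recursions start with \<open>m\<close> there.\<close>
  have c: "twisted_coord i = dual_coord n ((dual ^^ k) V) (\<lambda>x. \<tau>_inv (coord_neg V m k x))"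
    "twisted_coord (i + 1) = coord_neg V m k"
    by (cases k; simp add: i twisted_coord_def nat_add_distrib)+
  have "pairing V i u w = functional_of ((dual ^^ k) V) u w"
    using False by (simp add: pairing_def U)
  also have "\<dots> = (\<Sum>a=1..n. coord (twisted_coord i u) a * coord (\<tau>_inv (twisted_coord (i + 1) w)) a)"
    unfolding c using u w
    by (intro functional_of_coord[OF coordinatization_\<tau>_inv[OF coordinatization_coord_neg]]) (simp_all add: U)
  finally show ?thesis .
qed

end

end

section \<open>The comparison of the two algebras\<close>

context
  fixes I :: "(nat list \<Rightarrow>\<^sub>0 'k::field) set" and n :: nat
  assumes I: "ideal I (free_algebra n)"
begin

interpretation ideal I "free_algebra n"
  by (rule I)

lemma ideal_free_algebra_coset_eq_iff:
  assumes f: "f \<in> carrier (free_algebra n)" and g: "g \<in> carrier (free_algebra n)"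
  shows "I +>\<^bsub>free_algebra n\<^esub> f = I +>\<^bsub>free_algebra n\<^esub> g \<longleftrightarrow> f - g \<in> I"
proof -
  have "f \<in> I +>\<^bsub>free_algebra n\<^esub> g \<longleftrightarrow> f - g \<in> I"
    using a_rcos_module_minus[OF ring_free_algebra g f] a_minus_free_algebra[OF f g] by simp
  then show ?thesis
    using a_rcos_self[OF f] a_repr_independence[OF _ g a_subgroup] by metis
qed

lemma ideal_free_algebra_closed:
  "0 \<in> I"
  "f \<in> I \<Longrightarrow> g \<in> I \<Longrightarrow> f + g \<in> I"
  "f \<in> I \<Longrightarrow> g \<in> carrier (free_algebra n) \<Longrightarrow> word_mult f g \<in> I"
  "f \<in> I \<Longrightarrow> g \<in> carrier (free_algebra n) \<Longrightarrow> word_mult g f \<in> I"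
  using additive_subgroup.zero_closed[OF is_additive_subgroup] additive_subgroup.a_closed[OF is_additive_subgroup]
    I_l_closed I_r_closed
  by simp_all

lemma ideal_free_algebra_scale: "f \<in> I \<Longrightarrow> word_scale c f \<in> I"
  using ideal_free_algebra_closed(4)[of f "Poly_Mapping.single [] c"]
  by (simp add: word_mult_scalar carrier_free_algebra)

end

lemma tuples_Cons: "v # vs \<in> tuples V i j \<longleftrightarrow> v \<in> carrier (iterated_dual V i) \<and> vs \<in> tuples V (i + 1) j"
proof
  assume "v # vs \<in> tuples V i j"
  then have len: "int (length vs) + 1 = j - i"
    and nth: "\<forall>p<Suc (length vs). (v # vs) ! p \<in> carrier (iterated_dual V (i + int p))"
    by (simp_all add: tuples_def)
  have "vs ! p \<in> carrier (iterated_dual V (i + 1 + int p))" if "p < length vs" for p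
    using nth[rule_format, of "Suc p"] that by (simp add: add.assoc)
  then show "v \<in> carrier (iterated_dual V i) \<and> vs \<in> tuples V (i + 1) j"
    using len nth[rule_format, of 0] by (simp add: tuples_def)
next
  assume *: "v \<in> carrier (iterated_dual V i) \<and> vs \<in> tuples V (i + 1) j"
  have "(v # vs) ! p \<in> carrier (iterated_dual V (i + int p))" if "p < Suc (length vs)" for p
    using * that by (cases p) (auto simp: tuples_def add.assoc)
  then show "v # vs \<in> tuples V i j"
    using * by (simp add: tuples_def)
qed

text \<open>The image of a pure tensor. The entry at position \<open>p\<close> of a tuple starting
  at \<open>i\<close> lies in \<open>iterated_dual V (i + p)\<close>, so each step uses the
  coordinates of the next index.\<close>

primrec word_image :: "(int \<Rightarrow> 'v \<Rightarrow> (nat list \<Rightarrow>\<^sub>0 'k::field)) \<Rightarrow> int \<Rightarrow> 'v list \<Rightarrow> (nat list \<Rightarrow>\<^sub>0 'k)" where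
  "word_image l i [] = Poly_Mapping.single [] 1"
| "word_image l i (v # vs) = word_mult (l i v) (word_image l (i + 1) vs)"

lemma word_image_append:
  "word_image l i (us @ vs) = word_mult (word_image l i us) (word_image l (i + int (length us)) vs)"
  by (induction us arbitrary: i) (simp_all add: word_mult_assoc add.assoc)

text \<open>The element \<open>b\<close> is the same for all \<open>i\<close> and for all bases, so
  one relation of the graded algebra accounts for every \<open>Q_i\<close>. Existence of canonical
  tensors puts the lifts of \<open>b\<close> into the relations.\<close>

locale coordinatized = dual_modules V
  for V :: "('k::field, 'v) module" +
  fixes n :: nat and l :: "int \<Rightarrow> 'v \<Rightarrow> (nat list \<Rightarrow>\<^sub>0 'k)" and b :: "nat list \<Rightarrow>\<^sub>0 'k"
  assumes l: "coordinatization n (iterated_dual V i) (l i)"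
    and canonical_image: "t \<in> canonical_tensors i \<Longrightarrow> lin_ext (word_image l i) t = b"
    and canonical_exists: "canonical_tensors i \<noteq> {}"
begin

abbreviation ev :: "int \<Rightarrow> ('v list \<Rightarrow>\<^sub>0 'k) \<Rightarrow> (nat list \<Rightarrow>\<^sub>0 'k)" where
  "ev i \<equiv> lin_ext (word_image l i)"

abbreviation I where
  "I \<equiv> Idl\<^bsub>free_algebra n\<^esub> {b}"

lemma word_image_grade: "vs \<in> tuples V i j \<Longrightarrow> word_image l i vs \<in> free_grade n (j - i)"
proof (induction vs arbitrary: i)
  case Nil
  then show ?case by (simp add: tuples_def free_grade_single)
next
  case (Cons v vs)
  then have "word_mult (l i v) (word_image l (i + 1) vs) \<in> free_grade n (1 + (j - (i + 1)))"
    using coordinatization_grade[OF l] by (intro free_grade_mult) (simp_all add: tuples_Cons)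
  then show ?case by simp
qed

lemma ev_grade:
  assumes "f \<in> carrier (tuple_space V i j)"
  shows "ev i f \<in> free_grade n (j - i)"
  using assms
proof (induction f rule: tuple_space_induct)
  case (single w c)
  then show ?case using free_grade_scale[OF word_image_grade[OF single]] by simp
qed (simp_all add: free_grade_add)

lemma ev_carrier: "f \<in> carrier (tuple_space V i j) \<Longrightarrow> ev i f \<in> carrier (free_algebra n)"
  using ev_grade free_grade_carrier by blast

lemma ev_mult:
  assumes "f \<in> carrier (tuple_space V i j)"
  shows "ev i (word_mult f g) = word_mult (ev i f) (ev j g)"
  using assms
proof (induction f rule: tuple_space_induct)
  case (single w c)
  have "i + int (length w) = j" using single by (simp add: tuples_def)
  then show ?case
    by (induction g rule: word_induct) (simp_all add: word_image_append mult.commute)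
qed simp_all

lemma ev_multilinear_generator:
  assumes "f \<in> multilinear_generators i j"
  shows "ev i f = 0"
  using assms
proof cases
  case (additive us x vs y)
  have "l (i + int (length us)) (x \<oplus>\<^bsub>iterated_dual V (i + int (length us))\<^esub> y) =
      l (i + int (length us)) x + l (i + int (length us)) y"
    using coordinatization_add[OF l] tuples_nth_mid[OF additive(2)] tuples_nth_mid[OF additive(3)] by simp
  then show ?thesis by (simp add: additive(1) word_image_append)
next
  case (homogeneous us x vs c)
  have "l (i + int (length us)) (c \<odot>\<^bsub>iterated_dual V (i + int (length us))\<^esub> x) =
      word_scale c (l (i + int (length us)) x)"
    using coordinatization_scale[OF l] tuples_nth_mid[OF homogeneous(2)] by simp
  then show ?thesis by (simp add: homogeneous(1) word_image_append)
qed

lemma ev_multilinear: "m \<in> multilinear_relations V i j \<Longrightarrow> ev i m = 0"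
  by (induction rule: multilinear_induct) (simp_all add: ev_multilinear_generator)

lemma b_grade: "b \<in> free_grade n 2"
proof -
  obtain t where t: "t \<in> canonical_tensors 0" using canonical_exists by blast
  have "ev 0 t \<in> free_grade n (0 + 2 - 0)"
    by (rule ev_grade[OF subsetD[OF canonical_tensors_carrier t]])
  then show ?thesis using canonical_image[OF t] by simp
qed

lemma ideal_I: "ideal I (free_algebra n)"
  using ring.genideal_ideal[OF ring_free_algebra, of "{b}"] free_grade_carrier[OF b_grade] by simp

lemma b_in_I: "b \<in> I"
  using ring.genideal_self'[OF ring_free_algebra free_grade_carrier[OF b_grade]] .

lemmas I_closed = ideal_free_algebra_closed[OF ideal_I] ideal_free_algebra_scale[OF ideal_I]

lemma ev_Q_relations:
  assumes "q \<in> Q_relations i"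
  shows "ev i q \<in> I"
  using assms unfolding Q_relations_def
proof (induction rule: subspace_span_induct[OF module_tuple_space Q_generators_carrier,
      consumes 1, case_names zero gen add smult])
  case (gen x)
  then show ?case
    using ev_multilinear canonical_image b_in_I I_closed(1) by auto
qed (simp_all add: I_closed)

text \<open>Evaluation is multiplicative, so a generator goes to a two-sided multiple of the image
  of an element of \<open>Q_relations\<close>.\<close>

lemma ev_R_relations:
  assumes "f \<in> R_relations i j"
  shows "ev i f \<in> I"
  using assms
proof (induction rule: R_relations_induct)
  case (multilinear x)
  then show ?case by (simp add: ev_multilinear I_closed)
next
  case (gen p u q v)
  have q: "q \<in> carrier (tuple_space V p (p + 2))"
    using gen(4) Q_relations_carrier by blast
  have "ev i (word_mult u (word_mult q v)) = word_mult (ev i u) (word_mult (ev p q) (ev (p + 2) v))"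
    by (simp add: ev_mult[OF gen(3)] ev_mult[OF q])
  then show ?case
    using I_closed(3,4) ev_Q_relations[OF gen(4)] ev_carrier[OF gen(3)] ev_carrier[OF gen(5)] by simp
qed (simp_all add: I_closed)

text \<open>A section of \<open>word_image\<close> on words: a letter is replaced by the basis
  vector that it labels in the iterated dual belonging to its position.\<close>

primrec word_tuple :: "int \<Rightarrow> nat list \<Rightarrow> 'v list" where
  "word_tuple i [] = []"
| "word_tuple i (a # w) = basis_vector (iterated_dual V i) (l i) a # word_tuple (i + 1) w"

lemma length_word_tuple [simp]: "length (word_tuple i w) = length w"
  by (induction w arbitrary: i) simp_all

lemma word_tuple_append: "word_tuple i (u @ w) = word_tuple i u @ word_tuple (i + int (length u)) w"
  by (induction u arbitrary: i) (simp_all add: add.assoc)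

lemma word_tuple_tuples: "w \<in> lists {1..n} \<Longrightarrow> word_tuple i w \<in> tuples V i (i + int (length w))"
proof (induction w arbitrary: i)
  case Nil
  then show ?case by (simp add: tuples_def)
next
  case (Cons a w)
  then have "a \<in> {1..n}" by simp
  then have "basis_vector (iterated_dual V i) (l i) a \<in> carrier (iterated_dual V i)"
    using basis_vector[OF l] by blast
  moreover have "word_tuple (i + 1) w \<in> tuples V (i + 1) (i + 1 + int (length w))"
    using Cons by simp
  ultimately show ?case
    by (simp add: tuples_Cons add.assoc)
qed

lemma word_image_word_tuple:
  "w \<in> lists {1..n} \<Longrightarrow> word_image l i (word_tuple i w) = Poly_Mapping.single w 1"
proof (induction w arbitrary: i)
  case (Cons a w)
  then have "a \<in> {1..n}" by simp
  then have "l i (basis_vector (iterated_dual V i) (l i) a) = letter a"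
    using basis_vector[OF l] by blast
  then show ?case using Cons by simp
qed simp

abbreviation lift :: "int \<Rightarrow> (nat list \<Rightarrow>\<^sub>0 'k) \<Rightarrow> ('v list \<Rightarrow>\<^sub>0 'k)" where
  "lift i \<equiv> lin_ext (\<lambda>w. Poly_Mapping.single (word_tuple i w) 1)"

lemma lift_carrier:
  assumes "f \<in> free_grade n d"
  shows "lift i f \<in> carrier (tuple_space V i (i + d))"
  using assms
proof (induction f rule: free_grade_induct)
  case (single w c)
  then show ?case using word_tuple_tuples[of w i] by (simp add: tuple_space_single)
qed (simp_all add: tuple_space_closed)

lemma ev_lift:
  assumes "f \<in> free_grade n d"
  shows "ev i (lift i f) = f"
  using assms
  by (induction f rule: free_grade_induct) (simp_all add: word_image_word_tuple)

lemma lift_mult: "f \<in> free_grade n d \<Longrightarrow> lift i (word_mult f g) = word_mult (lift i f) (lift (i + d) g)"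
proof (induction f rule: free_grade_induct)
  case (single w c)
  then show ?case
    by (induction g rule: word_induct) (simp_all add: word_tuple_append mult.commute)
qed simp_all

text \<open>Modulo multilinearity the first entry may be expanded in basis vectors. The induction
  runs over the coordinates of \<open>v\<close>: the three cases correspond to zero, a scalar
  multiple of a basis vector, and a sum.\<close>

lemma multilinear_first:
  assumes vs: "vs \<in> tuples V (i + 1) j" and v: "v \<in> carrier (iterated_dual V i)"
  shows "Poly_Mapping.single (v # vs) 1 - word_mult (lift i (l i v)) (Poly_Mapping.single vs 1)
    \<in> multilinear_relations V i j"
proof -
  let ?U = "iterated_dual V i"
  let ?M = "multilinear_relations V i j"
  let ?inv = "inv_into (carrier ?U) (l i)"
  let ?D = "\<lambda>f. Poly_Mapping.single (?inv f # vs) 1 - word_mult (lift i f) (Poly_Mapping.single vs 1)"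
  have inv: "?inv f \<in> carrier ?U" "l i (?inv f) = f" if "f \<in> free_grade n 1" for f
    using bij_betw_apply[OF bij_betw_inv_into[OF coordinatization_bij[OF l]] that]
      bij_betw_inv_into_right[OF coordinatization_bij[OF l] that] by auto
  have tup: "x # vs \<in> tuples V i j" if "x \<in> carrier ?U" for x
    using that vs by (simp add: tuples_Cons)
  have sum: "Poly_Mapping.single ((x \<oplus>\<^bsub>?U\<^esub> y) # vs) 1 - Poly_Mapping.single (x # vs) 1 -
      Poly_Mapping.single (y # vs) 1 \<in> ?M" if "x \<in> carrier ?U" "y \<in> carrier ?U" for x y
    using generator_multilinear[OF multilinear_generators.additive[of "[]" x vs i j y]] tup that by simp
  have scale: "Poly_Mapping.single ((c \<odot>\<^bsub>?U\<^esub> x) # vs) 1 - Poly_Mapping.single (x # vs) c \<in> ?M"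
    if "x \<in> carrier ?U" for x c
    using generator_multilinear[OF multilinear_generators.homogeneous[of "[]" x vs i j c]] tup that by simp
  have inv_scale: "?inv (word_scale c f) = c \<odot>\<^bsub>?U\<^esub> ?inv f" if "f \<in> free_grade n 1" for c f
    using inv[OF that] inv[OF free_grade_scale[OF that]] module_groundD(3)[OF module_dual]
    by (intro coordinatization_eqI[OF l[of i]]) (simp_all add: coordinatization_scale[OF l])
  have inv_add: "?inv (f + g) = ?inv f \<oplus>\<^bsub>?U\<^esub> ?inv g" if "f \<in> free_grade n 1" "g \<in> free_grade n 1" for f g
    using inv[OF that(1)] inv[OF that(2)] inv[OF free_grade_add[OF that]] module_groundD(2)[OF module_dual]
    by (intro coordinatization_eqI[OF l[of i]]) (simp_all add: coordinatization_add[OF l])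
  have "?D f \<in> ?M" if "f \<in> free_grade n 1" for f
    using that
  proof (induction f rule: free_grade_induct)
    case zero
    have "?inv (word_scale 0 0) = 0 \<odot>\<^bsub>?U\<^esub> ?inv 0"
      by (rule inv_scale) simp
    then show ?case
      using scale[OF inv(1)[OF free_grade_zero], of 0] by simp
  next
    case (single w c)
    then obtain a where a: "w = [a]" "a \<in> {1..n}"
      by (auto simp: length_Suc_conv)
    have "?inv (word_scale c (letter a)) = c \<odot>\<^bsub>?U\<^esub> ?inv (letter a)"
      by (rule inv_scale) (rule letter_grade[OF a(2)])
    then show ?case
      using scale[OF inv(1)[OF letter_grade[OF a(2)]], of c] by (simp add: a(1) basis_vector_def)
  next
    case (add f g)
    have "?D (f + g) = (Poly_Mapping.single (?inv (f + g) # vs) 1 - Poly_Mapping.single (?inv f # vs) 1 -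
        Poly_Mapping.single (?inv g # vs) 1) + (?D f + ?D g)"
      by simp
    also have "\<dots> \<in> ?M"
      unfolding inv_add[OF add(1,2)]
      using add.IH sum[OF inv(1)[OF add(1)] inv(1)[OF add(2)]]
      by (intro multilinear_closed)
    finally show ?case .
  qed
  from this[OF coordinatization_grade[OF l v]] show ?thesis
    using bij_betw_inv_into_left[OF coordinatization_bij[OF l] v] by simp
qed

text \<open>The first entry is expanded by \<open>multilinear_first\<close>, the remaining ones by
  induction; the two differences telescope because lifting is multiplicative.\<close>

lemma lift_word_image:
  "vs \<in> tuples V i j \<Longrightarrow> Poly_Mapping.single vs 1 - lift i (word_image l i vs) \<in> multilinear_relations V i j"
proof (induction vs arbitrary: i)
  case Nil
  then show ?case by (simp add: multilinear_closed)
next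
  case (Cons v vs)
  then have v: "v \<in> carrier (iterated_dual V i)" and vs: "vs \<in> tuples V (i + 1) j"
    by (simp_all add: tuples_Cons)
  note grade = coordinatization_grade[OF l v]
  have "Poly_Mapping.single (v # vs) 1 - lift i (word_image l i (v # vs)) =
      (Poly_Mapping.single (v # vs) 1 - word_mult (lift i (l i v)) (Poly_Mapping.single vs 1)) +
      word_mult (lift i (l i v)) (Poly_Mapping.single vs 1 - lift (i + 1) (word_image l (i + 1) vs))"
    by (simp add: lift_mult[OF grade])
  also have "\<dots> \<in> multilinear_relations V i j"
    by (intro multilinear_closed multilinear_first multilinear_mult_left[OF Cons.IH lift_carrier[OF grade]] v vs)
  finally show ?case .
qed

text \<open>Together with \<open>ev_lift\<close> this identifies the tensor space
  \<open>T_ij\<close> with the degree \<open>j - i\<close> part of the free algebra.\<close>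

lemma lift_ev:
  assumes "t \<in> carrier (tuple_space V i j)"
  shows "t - lift i (ev i t) \<in> multilinear_relations V i j"
  using assms
proof (induction t rule: tuple_space_induct)
  case (single w c)
  have "word_scale c (Poly_Mapping.single w 1 - lift i (word_image l i w)) \<in> multilinear_relations V i j"
    by (intro multilinear_closed lift_word_image single)
  then show ?case by simp
next
  case (add f g)
  have "f + g - lift i (ev i (f + g)) = (f - lift i (ev i f)) + (g - lift i (ev i g))"
    by simp
  then show ?case
    using add by (simp only: multilinear_closed)
qed (simp add: multilinear_closed)

text \<open>The lift of the degree \<open>d\<close> part. Lifting a nonhomogeneous element as a
  whole would mix tuples of different lengths, which lie in no single
  \<open>tuple_space\<close>.\<close>

abbreviation lift_part :: "int \<Rightarrow> int \<Rightarrow> (nat list \<Rightarrow>\<^sub>0 'k) \<Rightarrow> ('v list \<Rightarrow>\<^sub>0 'k)" where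
  "lift_part i d \<equiv> lin_ext (\<lambda>w. if int (length w) = d then Poly_Mapping.single (word_tuple i w) 1 else 0)"

lemma lift_part_homogeneous:
  assumes "f \<in> free_grade n e"
  shows "lift_part i d f = (if d = e then lift i f else 0)"
  using assms by (induction f rule: free_grade_induct) simp_all

lemma canonical_R_relations:
  assumes t: "t \<in> canonical_tensors i"
  shows "t \<in> R_relations i (i + 2)"
proof -
  have "t \<in> Q_relations i"
    using t subspace_span_superset[of "multilinear_relations V i (i + 2) \<union> canonical_tensors i"]
    unfolding Q_relations_def by blast
  moreover have "Poly_Mapping.single [] 1 \<in> carrier (tuple_space V j j)" for j
    by (intro tuple_space_single) (simp add: tuples_def)
  \<comment> \<open>A canonical tensor is the generator at position \<open>p = i\<close> with the
    empty word, that is the scalar 1, on both sides.\<close>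
  ultimately have "word_mult (Poly_Mapping.single [] 1) (word_mult t (Poly_Mapping.single [] 1)) \<in>
      {word_mult u (word_mult q v) | u q v. u \<in> carrier (tuple_space V i i) \<and> q \<in> Q_relations i \<and>
        v \<in> carrier (tuple_space V (i + 2) (i + 2))}"
    by blast
  then have "word_mult (Poly_Mapping.single [] 1) (word_mult t (Poly_Mapping.single [] 1)) \<in> R_generators i (i + 2)"
    unfolding R_generators_def by (intro UN_I[of i]) simp_all
  then show ?thesis
    using subsetD[OF R_generators_subset] by simp
qed

text \<open>A canonical tensor is a relation and differs from the lift of its image, which is
  \<open>b\<close>, by a multilinear relation.\<close>

lemma lift_b: "lift i b \<in> R_relations i (i + 2)"
proof -
  obtain t where t: "t \<in> canonical_tensors i" using canonical_exists by blast
  define s where "s = t - lift i (ev i t)"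
  have "s \<in> R_relations i (i + 2)"
    using lift_ev[OF subsetD[OF canonical_tensors_carrier t]] multilinear_subset_R[of i "i + 2"]
    by (auto simp: s_def)
  then have "t + word_scale (- 1) s \<in> R_relations i (i + 2)"
    by (intro R_relations_closed(3) R_relations_closed(4) canonical_R_relations[OF t])
  moreover have "t + word_scale (- 1) s = lift i b"
    unfolding canonical_image[OF t, symmetric] s_def
    by (rule poly_mapping_eqI) (simp add: lookup_add lookup_minus)
  ultimately show ?thesis by simp
qed

section \<open>Homogeneous parts of the ideal generated by \<open>b\<close>\<close>

lemma lift_part_single_left:
  "lift_part i d (word_mult (Poly_Mapping.single u c) f) =
    word_mult (Poly_Mapping.single (word_tuple i u) c) (lift_part (i + int (length u)) (d - int (length u)) f)"
  by (induction f rule: word_induct) (auto simp: word_tuple_append mult.commute)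

text \<open>On the left only words of length \<open>d - length u\<close> survive, so the starting
  index of \<open>u\<close> is known in advance.\<close>

lemma lift_part_single_right:
  "lift_part i d (word_mult f (Poly_Mapping.single u c)) =
    word_mult (lift_part i (d - int (length u)) f) (Poly_Mapping.single (word_tuple (i + (d - int (length u))) u) c)"
  by (induction f rule: word_induct) (auto simp: word_tuple_append mult.commute)

text \<open>
  Elements of the ideal generated by \<open>b\<close> need not be homogeneous, hence the condition on all
  homogeneous parts.
\<close>

definition J :: "(nat list \<Rightarrow>\<^sub>0 'k) set" where
  "J = {f \<in> carrier (free_algebra n). \<forall>i d. lift_part i d f \<in> R_relations i (i + d)}"

lemma J_closed:
  "0 \<in> J" "f \<in> J \<Longrightarrow> g \<in> J \<Longrightarrow> f + g \<in> J" "f \<in> J \<Longrightarrow> word_scale c f \<in> J"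
proof -
  show "0 \<in> J" by (simp add: J_def carrier_free_algebra R_relations_closed)
  show "f + g \<in> J" if fg: "f \<in> J" "g \<in> J"
  proof -
    have "Poly_Mapping.keys (f + g) \<subseteq> lists {1..n}"
      using fg keys_add[of f g] unfolding J_def carrier_free_algebra by blast
    then show ?thesis using fg by (simp add: J_def carrier_free_algebra R_relations_closed)
  qed
  show "word_scale c f \<in> J" if "f \<in> J"
    using that by (simp add: J_def word_scale_closed R_relations_closed)
qed

text \<open>A word multiplied from the left moves the other factor to a later starting index and a
  smaller degree, which is why \<open>J\<close> imposes its condition for all \<open>i\<close> and
  \<open>d\<close>.\<close>

lemma J_mult_left:
  assumes f: "f \<in> J" and g: "g \<in> carrier (free_algebra n)"
  shows "word_mult g f \<in> J"
proof -
  interpret ring "free_algebra n :: (nat list \<Rightarrow>\<^sub>0 'k) ring" by (rule ring_free_algebra)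
  have "Poly_Mapping.keys g \<subseteq> lists {1..n}" using g by (simp add: carrier_free_algebra)
  then show ?thesis
  proof (induction g rule: combination_induct)
    case (single u c)
    have "Poly_Mapping.single u c \<in> carrier (free_algebra n)"
      using single by (auto simp: carrier_free_algebra)
    then have "word_mult (Poly_Mapping.single u c) f \<in> carrier (free_algebra n)"
      using f m_closed[of "Poly_Mapping.single u c" f] by (simp add: J_def)
    moreover have "lift_part i d (word_mult (Poly_Mapping.single u c) f) \<in> R_relations i (i + d)" for i d
    proof -
      have "lift_part (i + int (length u)) (d - int (length u)) f \<in>
          R_relations (i + int (length u)) ((i + int (length u)) + (d - int (length u)))"
        using f by (simp only: J_def mem_Collect_eq)
      then have "lift_part (i + int (length u)) (d - int (length u)) f \<in> R_relations (i + int (length u)) (i + d)"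
        by simp
      then show ?thesis
        unfolding lift_part_single_left
        by (rule R_relations_mult_left) (rule tuple_space_single[OF word_tuple_tuples[OF single]])
    qed
    ultimately show ?case by (simp add: J_def)
  qed (simp_all add: J_closed)
qed

lemma J_mult_right:
  assumes f: "f \<in> J" and g: "g \<in> carrier (free_algebra n)"
  shows "word_mult f g \<in> J"
proof -
  interpret ring "free_algebra n :: (nat list \<Rightarrow>\<^sub>0 'k) ring" by (rule ring_free_algebra)
  have "Poly_Mapping.keys g \<subseteq> lists {1..n}" using g by (simp add: carrier_free_algebra)
  then show ?thesis
  proof (induction g rule: combination_induct)
    case (single u c)
    have "Poly_Mapping.single u c \<in> carrier (free_algebra n)"
      using single by (auto simp: carrier_free_algebra)
    then have "word_mult f (Poly_Mapping.single u c) \<in> carrier (free_algebra n)"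
      using f m_closed[of f "Poly_Mapping.single u c"] by (simp add: J_def)
    moreover have "lift_part i d (word_mult f (Poly_Mapping.single u c)) \<in> R_relations i (i + d)" for i d
    proof -
      have "lift_part i (d - int (length u)) f \<in> R_relations i (i + (d - int (length u)))"
        using f by (simp only: J_def mem_Collect_eq)
      moreover have "word_tuple (i + (d - int (length u))) u \<in> tuples V (i + (d - int (length u))) (i + d)"
        using word_tuple_tuples[OF single, of "i + (d - int (length u))"] by simp
      ultimately show ?thesis
        unfolding lift_part_single_right by (intro R_relations_mult_right tuple_space_single)
    qed
    ultimately show ?case by (simp add: J_def)
  qed (simp_all add: J_closed)
qed

lemma ideal_J: "ideal J (free_algebra n)"
proof (rule idealI[OF ring_free_algebra])
  interpret ring "free_algebra n :: (nat list \<Rightarrow>\<^sub>0 'k) ring" by (rule ring_free_algebra)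
  show "subgroup J (add_monoid (free_algebra n))"
  proof (rule add.subgroupI)
    show "J \<subseteq> carrier (free_algebra n)" by (auto simp: J_def)
    show "J \<noteq> {}" using J_closed(1) by blast
    show "f \<oplus>\<^bsub>free_algebra n\<^esub> g \<in> J" if "f \<in> J" "g \<in> J" for f g
      using J_closed(2)[OF that] by simp
    show "\<ominus>\<^bsub>free_algebra n\<^esub> f \<in> J" if f: "f \<in> J" for f
    proof -
      have "f \<in> carrier (free_algebra n)" using f by (simp add: J_def)
      moreover have "word_scale (- 1) f + f = 0"
        using word_scale_simps(2)[of "- 1" 1 f] by simp
      ultimately have "word_scale (- 1) f = \<ominus>\<^bsub>free_algebra n\<^esub> f"
        using word_scale_closed[of f n "- 1"] by (intro minus_equality[symmetric]) simp_all
      then show ?thesis using J_closed(3)[OF f, of "- 1"] by simp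
    qed
  qed
qed (simp_all add: J_mult_left J_mult_right)

lemma b_in_J: "b \<in> J"
  using lift_b free_grade_carrier[OF b_grade] R_relations_closed(2)
  by (auto simp: J_def lift_part_homogeneous[OF b_grade])

text \<open>A generated ideal is an intersection and offers no normal form for its elements.
  Minimality is used instead: \<open>J\<close> is an ideal containing \<open>b\<close>, so it
  contains \<open>I\<close>.\<close>

lemma lift_ideal:
  assumes "f \<in> I" "f \<in> free_grade n d"
  shows "lift i f \<in> R_relations i (i + d)"
proof -
  have "I \<subseteq> J"
    using ring.genideal_minimal[OF ring_free_algebra ideal_J] b_in_J by simp
  then have "lift_part i d f \<in> R_relations i (i + d)"
    using assms(1) by (auto simp: J_def)
  then show ?thesis by (simp add: lift_part_homogeneous[OF assms(2)])
qed

text \<open>The injectivity half of the comparison. Modulo multilinear relations \<open>f\<close> is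
  the lift of its evaluation, so \<open>lift_ideal\<close> applies to it.\<close>

lemma ev_in_ideal_iff:
  assumes f: "f \<in> carrier (tuple_space V i j)"
  shows "ev i f \<in> I \<longleftrightarrow> f \<in> R_relations i j"
proof
  assume "ev i f \<in> I"
  then have "lift i (ev i f) \<in> R_relations i j"
    using lift_ideal[OF _ ev_grade[OF f], of i] by simp
  moreover have "f - lift i (ev i f) \<in> R_relations i j"
    using lift_ev[OF f] multilinear_subset_R by blast
  ultimately have "(f - lift i (ev i f)) + lift i (ev i f) \<in> R_relations i j"
    by (intro R_relations_closed)
  then show "f \<in> R_relations i j" by simp
qed (rule ev_R_relations)

text \<open>An element of \<open>A_ij\<close> is a coset of tensor classes, so a combination of
  tuples representing it is chosen; \<open>ev_coset_eq_iff\<close> shows that the choice does not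
  matter.\<close>

definition comparison :: "int \<Rightarrow> int \<Rightarrow> ('v list \<Rightarrow>\<^sub>0 'k) set set \<Rightarrow> (nat list \<Rightarrow>\<^sub>0 'k) set" where
  "comparison i j C = I +>\<^bsub>free_algebra n\<^esub> ev i (SOME f. f \<in> carrier (tuple_space V i j) \<and> sym_class i j f = C)"

lemma ev_coset_eq_iff:
  assumes "f \<in> carrier (tuple_space V i j)" "g \<in> carrier (tuple_space V i j)"
  shows "I +>\<^bsub>free_algebra n\<^esub> ev i f = I +>\<^bsub>free_algebra n\<^esub> ev i g \<longleftrightarrow> sym_class i j f = sym_class i j g"
  using ideal_free_algebra_coset_eq_iff[OF ideal_I ev_carrier[OF assms(1)] ev_carrier[OF assms(2)]]
    ev_in_ideal_iff[OF tuple_space_closed_minus[OF assms]] sym_class_eq_iff[OF assms]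
  by simp

lemma comparison_sym_class:
  assumes "f \<in> carrier (tuple_space V i j)"
  shows "comparison i j (sym_class i j f) = I +>\<^bsub>free_algebra n\<^esub> ev i f"
proof -
  let ?g = "SOME g. g \<in> carrier (tuple_space V i j) \<and> sym_class i j g = sym_class i j f"
  have "?g \<in> carrier (tuple_space V i j) \<and> sym_class i j ?g = sym_class i j f"
    by (rule someI[of _ f]) (use assms in simp)
  then show ?thesis
    unfolding comparison_def using ev_coset_eq_iff assms by blast
qed

text \<open>\<open>P1_algebra\<close> with the relator replaced by \<open>b\<close>; the two
  coincide once \<open>b\<close> is recognised as the relator.\<close>

definition quotient_algebra :: "(nat list \<Rightarrow>\<^sub>0 'k) set graded_ring" where
  "quotient_algebra = ring.extend (free_algebra n Quot I)
    \<lparr> grade = (\<lambda>d. (\<lambda>f. I +>\<^bsub>free_algebra n\<^esub> f) ` free_grade n d) \<rparr>"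

lemma quotient_algebra_simps:
  "grade quotient_algebra d = (\<lambda>f. I +>\<^bsub>free_algebra n\<^esub> f) ` free_grade n d"
  "\<one>\<^bsub>quotient_algebra\<^esub> = I +>\<^bsub>free_algebra n\<^esub> Poly_Mapping.single [] 1"
  "f \<in> carrier (free_algebra n) \<Longrightarrow> g \<in> carrier (free_algebra n) \<Longrightarrow>
    (I +>\<^bsub>free_algebra n\<^esub> f) \<oplus>\<^bsub>quotient_algebra\<^esub> (I +>\<^bsub>free_algebra n\<^esub> g) = I +>\<^bsub>free_algebra n\<^esub> (f + g)"
  "f \<in> carrier (free_algebra n) \<Longrightarrow> g \<in> carrier (free_algebra n) \<Longrightarrow>
    (I +>\<^bsub>free_algebra n\<^esub> f) \<otimes>\<^bsub>quotient_algebra\<^esub> (I +>\<^bsub>free_algebra n\<^esub> g) =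
      I +>\<^bsub>free_algebra n\<^esub> (word_mult f g)"
  using ideal.a_rcos_sum[OF ideal_I] ideal.rcoset_mult_add[OF ideal_I]
  by (simp_all add: quotient_algebra_def ring.defs FactRing_def)

text \<open>Injectivity on each part is \<open>ev_in_ideal_iff\<close> in the form of cosets,
  surjectivity is \<open>ev_lift\<close>, and multiplicativity is inherited from
  \<open>ev_mult\<close>.\<close>

lemma regrading_comparison: "regrading quotient_algebra (Snc V) comparison"
proof
  fix i j
  have rep: "\<exists>f\<in>carrier (tuple_space V i j). x = sym_class i j f" if "x \<in> carrier (zpart (Snc V) i j)" for x i j
    using that by (auto simp: zpart_carrier)
  show "bij_betw (comparison i j) (carrier (zpart (Snc V) i j)) (grade quotient_algebra (j - i))"
    unfolding bij_betw_def
  proof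
    show "inj_on (comparison i j) (carrier (zpart (Snc V) i j))"
    proof (rule inj_onI)
      fix x y assume "x \<in> carrier (zpart (Snc V) i j)" "y \<in> carrier (zpart (Snc V) i j)"
        and eq: "comparison i j x = comparison i j y"
      then obtain f g where "f \<in> carrier (tuple_space V i j)" "x = sym_class i j f"
        "g \<in> carrier (tuple_space V i j)" "y = sym_class i j g"
        using rep by metis
      then show "x = y" using eq ev_coset_eq_iff by (simp add: comparison_sym_class)
    qed
    show "comparison i j ` carrier (zpart (Snc V) i j) = grade quotient_algebra (j - i)"
    proof (intro Set.equalityI subsetI)
      fix y assume "y \<in> comparison i j ` carrier (zpart (Snc V) i j)"
      then obtain x where x: "x \<in> carrier (zpart (Snc V) i j)" "y = comparison i j x" by blast
      from rep[OF x(1)] obtain f where "f \<in> carrier (tuple_space V i j)" "y = I +>\<^bsub>free_algebra n\<^esub> ev i f"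
        using comparison_sym_class x(2) by blast
      then show "y \<in> grade quotient_algebra (j - i)"
        using ev_grade by (auto simp: quotient_algebra_simps)
    next
      fix y assume "y \<in> grade quotient_algebra (j - i)"
      then obtain f where f: "f \<in> free_grade n (j - i)" and y: "y = I +>\<^bsub>free_algebra n\<^esub> f"
        by (auto simp: quotient_algebra_simps)
      have lf: "lift i f \<in> carrier (tuple_space V i j)"
        using lift_carrier[OF f, of i] by simp
      have "y = comparison i j (sym_class i j (lift i f))"
        by (simp add: comparison_sym_class[OF lf] ev_lift[OF f] y)
      then show "y \<in> comparison i j ` carrier (zpart (Snc V) i j)"
        using lf by (auto simp: zpart_carrier)
    qed
  qed
  fix x y assume "x \<in> carrier (zpart (Snc V) i j)" "y \<in> carrier (zpart (Snc V) i j)"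
  then obtain f g where *: "f \<in> carrier (tuple_space V i j)" "x = sym_class i j f"
    "g \<in> carrier (tuple_space V i j)" "y = sym_class i j g"
    using rep by metis
  then show "x \<oplus>\<^bsub>zpart (Snc V) i j\<^esub> y \<in> carrier (zpart (Snc V) i j)"
    by (simp add: zpart_add zpart_carrier tuple_space_closed)
  show "comparison i j (x \<oplus>\<^bsub>zpart (Snc V) i j\<^esub> y) = comparison i j x \<oplus>\<^bsub>quotient_algebra\<^esub> comparison i j y"
    using * ev_carrier by (simp add: zpart_add comparison_sym_class tuple_space_closed quotient_algebra_simps)
next
  fix x y i j k
  assume "x \<in> carrier (zpart (Snc V) i j)" "y \<in> carrier (zpart (Snc V) j k)"
  then obtain f g where *: "f \<in> carrier (tuple_space V i j)" "x = sym_class i j f"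
    "g \<in> carrier (tuple_space V j k)" "y = sym_class j k g"
    by (auto simp: zpart_carrier)
  note fg = word_mult_tuple_space[OF *(1,3)]
  show "zmult (Snc V) i j k x y \<in> carrier (zpart (Snc V) i k)"
    using * fg by (simp add: zmult_class zpart_carrier)
  show "comparison i k (zmult (Snc V) i j k x y) = comparison i j x \<otimes>\<^bsub>quotient_algebra\<^esub> comparison j k y"
    using * ev_carrier
    by (simp add: zmult_class comparison_sym_class fg ev_mult[OF *(1)] quotient_algebra_simps)
next
  fix i
  have one: "Poly_Mapping.single [] 1 \<in> carrier (tuple_space V i i)"
    by (intro tuple_space_single) (simp add: tuples_def)
  show "zunit (Snc V) i \<in> carrier (zpart (Snc V) i i)"
    using one by (simp add: zunit_class zpart_carrier)
  show "comparison i i (zunit (Snc V) i) = \<one>\<^bsub>quotient_algebra\<^esub>"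
    by (simp add: zunit_class comparison_sym_class[OF one] quotient_algebra_simps)
qed

end

text \<open>The map is \<open>\<sigma>\<close> after the involution reversing the order of the
  letters, and each of the two is a linear bijection of the degree one part.\<close>

lemma graded_automorphism_twist:
  assumes "graded_automorphism n \<sigma>"
  shows "twist n (\<lambda>f. \<Sum>a=1..n. word_scale (coord f a) (\<sigma> (letter (n + 1 - a))))"
proof -
  have \<sigma>: "bij_betw \<sigma> (carrier (free_algebra n)) (carrier (free_algebra n))"
    and \<sigma>_grade: "\<sigma> ` free_grade n d = free_grade n d"
    and \<sigma>_scalar: "\<sigma> (Poly_Mapping.single [] c) = Poly_Mapping.single [] c"
    and hom: "\<sigma> \<in> ring_hom (free_algebra n) (free_algebra n)" for c d
    using assms by (auto simp: graded_automorphism_def ring_iso_def)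
  have \<sigma>_add: "\<sigma> (f + g) = \<sigma> f + \<sigma> g" if "f \<in> free_grade n d" "g \<in> free_grade n d" for f g d
    using ring_hom_add[OF hom] that free_grade_carrier by fastforce
  \<comment> \<open>Scaling is multiplication by a constant of the free algebra, and
    \<open>\<sigma>\<close> fixes constants.\<close>
  have \<sigma>_scale: "\<sigma> (word_scale c f) = word_scale c (\<sigma> f)" if "f \<in> free_grade n d" for c f d
    using ring_hom_mult[OF hom, of "Poly_Mapping.single [] c" f] that free_grade_carrier[OF that]
    by (simp add: word_mult_scalar \<sigma>_scalar carrier_free_algebra)
  have "\<sigma> (word_scale 0 0) = word_scale 0 (\<sigma> 0)"
    by (rule \<sigma>_scale) (rule free_grade_zero)
  then have \<sigma>_zero: "\<sigma> 0 = 0" by simp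
  have \<sigma>_sum: "\<sigma> (sum h S) = (\<Sum>x\<in>S. \<sigma> (h x))" if "\<And>x. x \<in> S \<Longrightarrow> h x \<in> free_grade n 1" for h and S :: "nat set"
    using that
  proof (induction S rule: infinite_finite_induct)
    case (insert x F)
    have "\<sigma> (h x + sum h F) = \<sigma> (h x) + \<sigma> (sum h F)"
      by (rule \<sigma>_add[where d = 1]) (use insert.prems in \<open>auto intro: free_grade_sum\<close>)
    then show ?case using insert by simp
  qed (simp_all add: \<sigma>_zero)
  define rev where "rev f = (\<Sum>a=1..n. word_scale (coord f a) (letter (n + 1 - a)))" for f :: "nat list \<Rightarrow>\<^sub>0 'a"
  have letter: "letter (n + 1 - a) \<in> free_grade n 1" if "a \<in> {1..n}" for a
    using that by (intro letter_grade) auto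
  have rev_grade: "rev f \<in> free_grade n 1" for f
    unfolding rev_def by (intro free_grade_sum free_grade_scale letter)
  have coord_rev: "coord (rev f) a = coord f (n + 1 - a)" if "a \<in> {1..n}" for f a
  proof -
    have "coord (rev f) a = (\<Sum>x=1..n. if x = n + 1 - a then coord f x else 0)"
      unfolding rev_def lookup_sum using that by (intro sum.cong) (auto simp: lookup_single when_def)
    moreover have "n + 1 - a \<in> {1..n}" using that by auto
    ultimately show ?thesis by (simp only: sum.delta[OF finite_atLeastAtMost] if_True)
  qed
  have rev_rev: "rev (rev f) = f" if "f \<in> free_grade n 1" for f
  proof (rule free_grade_one_eqI[OF rev_grade that])
    fix a assume a: "a \<in> {1..n}"
    then have "n + 1 - a \<in> {1..n}" by auto
    then show "coord (rev (rev f)) a = coord f a"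
      using coord_rev[OF a, of "rev f"] coord_rev[of "n + 1 - a" f] a by simp
  qed
  have eq: "(\<Sum>a=1..n. word_scale (coord f a) (\<sigma> (letter (n + 1 - a)))) = \<sigma> (rev f)" for f
  proof -
    have "\<sigma> (rev f) = (\<Sum>a=1..n. \<sigma> (word_scale (coord f a) (letter (n + 1 - a))))"
      unfolding rev_def by (intro \<sigma>_sum free_grade_scale letter)
    also have "\<dots> = (\<Sum>a=1..n. word_scale (coord f a) (\<sigma> (letter (n + 1 - a))))"
      by (intro sum.cong HOL.refl \<sigma>_scale[where d = 1] letter)
    finally show ?thesis ..
  qed
  have rev_add: "rev (f + g) = rev f + rev g" for f g
    by (simp add: rev_def lookup_add sum.distrib single_add)
  have rev_scale: "rev (word_scale c f) = word_scale c (rev f)" for c f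
    by (simp add: rev_def word_scale_sum)
  have "bij_betw rev (free_grade n 1) (free_grade n 1)"
    by (rule bij_betw_byWitness[of _ rev]) (auto simp: rev_rev rev_grade)
  moreover have "bij_betw \<sigma> (free_grade n 1) (free_grade n 1)"
    using bij_betw_subset[OF \<sigma> _ \<sigma>_grade] free_grade_carrier by blast
  ultimately have "bij_betw (\<lambda>f. \<sigma> (rev f)) (free_grade n 1) (free_grade n 1)"
    using bij_betw_trans[of rev _ _ \<sigma>] by (simp add: o_def)
  then show ?thesis
    unfolding eq by unfold_locales (simp_all add: rev_add rev_scale \<sigma>_add[OF rev_grade rev_grade] \<sigma>_scale[OF rev_grade])
qed

section \<open>Canonical tensors evaluate to the quadratic relation\<close>

context twist
begin

lemma \<tau>_expand:
  assumes "f \<in> free_grade n 1"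
  shows "\<tau> f = (\<Sum>a=1..n. word_scale (coord f a) (\<tau> (letter a)))"
proof -
  have zero: "\<tau> 0 = 0" using \<tau>_scale[OF free_grade_zero, of 0] by simp
  have "\<tau> (\<Sum>a\<in>S. word_scale (coord f a) (letter a)) = (\<Sum>a\<in>S. word_scale (coord f a) (\<tau> (letter a)))"
    if "S \<subseteq> {1..n}" for S
    using finite_subset[OF that finite_atLeastAtMost] that
  proof (induction S rule: finite_induct)
    case (insert a S)
    have a: "letter a \<in> free_grade n 1" using insert.prems by (intro letter_grade) simp
    have "(\<Sum>a\<in>S. word_scale (coord f a) (letter a)) \<in> free_grade n 1"
      using insert.prems by (intro free_grade_sum free_grade_scale letter_grade) auto
    note \<tau>_add[OF free_grade_scale[OF a] this]
    then show ?case
      using insert by (simp add: \<tau>_scale[OF a] del: word_scale_simps)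
  qed (simp add: zero)
  from this[OF order_refl] show ?thesis
    using free_grade_one_expand[OF assms] by simp
qed

text \<open>The letters and the elements \<open>\<tau> (letter a)\<close> are dual for the pairing
  in twisted coordinates. A canonical tensor does not depend on the pair of dual bases, so each one
  evaluates to the sum built from this pair.\<close>

lemma coordinatized_twisted:
  fixes V :: "('k, 'v) module"
  assumes m: "coordinatization n V m"
  shows "coordinatized V n (twisted_coord V m) (\<Sum>a=1..n. word_mult (letter a) (\<tau> (letter a)))"
proof -
  let ?l = "twisted_coord V m"
  note l = coordinatization_twisted_coord[OF m]
  have dual_modules: "dual_modules V"
    by (rule dual_modules.intro) (rule coordinatization_module[OF l])
  then interpret dual_modules V .
  have y_grade: "\<tau>_inv (?l i w) \<in> free_grade n 1" if "w \<in> carrier (iterated_dual V i)" for i w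
    by (rule \<tau>_inv_grade[OF coordinatization_grade[OF l that]])
  show ?thesis
  proof (intro coordinatized.intro coordinatized_axioms.intro)
    show "dual_modules V" by (rule dual_modules)
    show "coordinatization n (iterated_dual V i) (?l i)" for i by (rule l)
  next
    fix i
    let ?X = "basis_vector (iterated_dual V i) (?l i)"
    \<comment> \<open>The dual basis of \<open>?X\<close>: its coordinates are
      \<open>\<tau> (letter a)\<close>, and the \<open>\<tau>_inv\<close> in
      \<open>pairing_twisted_coord\<close> turns them back into letters.\<close>
    let ?Y = "\<lambda>a. inv_into (carrier (iterated_dual V (i + 1))) (?l (i + 1)) (\<tau> (letter a))"
    have X: "?X a \<in> carrier (iterated_dual V i)" "?l i (?X a) = letter a" if "a \<in> {1..n}" for a
      using basis_vector[OF l that] by auto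
    have Y: "?Y a \<in> carrier (iterated_dual V (i + 1))" "?l (i + 1) (?Y a) = \<tau> (letter a)" if "a \<in> {1..n}" for a
      using bij_betw_apply[OF bij_betw_inv_into[OF coordinatization_bij[OF l]] \<tau>_grade[OF letter_grade[OF that]]]
        bij_betw_inv_into_right[OF coordinatization_bij[OF l] \<tau>_grade[OF letter_grade[OF that]]] by auto
    have inj: "inj_on ?X {1..n}" by (rule basis_vector_inj[OF l])
    define b' where "b' x = ?Y (inv_into {1..n} ?X x)" for x
    have b': "b' (?X a) = ?Y a" if "a \<in> {1..n}" for a
      using inv_into_f_f[OF inj that] by (simp add: b'_def)
    have "pairing V i (?X c) (?Y a) = (if c = a then 1 else 0)" if c: "c \<in> {1..n}" and a: "a \<in> {1..n}" for a c
    proof -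
      have "pairing V i (?X c) (?Y a) = (\<Sum>x=1..n. coord (letter c) x * coord (letter a) x)"
        using pairing_twisted_coord[OF m X(1)[OF c] Y(1)[OF a]] X(2)[OF c] Y(2)[OF a]
          \<tau>_inv_\<tau>[OF letter_grade[OF a]] by simp
      also have "\<dots> = (\<Sum>x=1..n. if x = c then coord (letter a) x else 0)"
        by (intro sum.cong) (auto simp: coord_letter)
      finally show ?thesis using c by (simp add: coord_letter)
    qed
    then have "(\<Sum>x\<in>?X ` {1..n}. Poly_Mapping.single [x, b' x] 1) \<in> canonical_tensors i"
      unfolding canonical_tensors_def using is_basis_basis_vector[OF l] b' Y inj_on_eq_iff[OF inj]
      by (intro CollectI exI[of _ "?X ` {1..n}"] exI[of _ b']) auto
    then show "canonical_tensors i \<noteq> {}" by blast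
  next
    fix t i assume "t \<in> canonical_tensors i"
    then obtain B b' where t: "t = (\<Sum>b\<in>B. Poly_Mapping.single [b, b' b] 1)"
      and B: "is_basis (iterated_dual V i) B"
      and b'_closed: "\<And>b. b \<in> B \<Longrightarrow> b' b \<in> carrier (iterated_dual V (i + 1))"
      and dual: "\<And>b c. b \<in> B \<Longrightarrow> c \<in> B \<Longrightarrow> pairing V i c (b' b) = (if c = b then 1 else 0)"
      unfolding canonical_tensors_def by blast
    have fin: "finite B" and sub: "B \<subseteq> carrier (iterated_dual V i)"
      using B by (auto simp: is_basis_def)
    define y where "y b = \<tau>_inv (?l (i + 1) (b' b))" for b
    have y: "y b \<in> free_grade n 1" "?l (i + 1) (b' b) = \<tau> (y b)" if "b \<in> B" for b
      using y_grade[OF b'_closed[OF that]] \<tau>_\<tau>_inv[OF coordinatization_grade[OF l b'_closed[OF that]]]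
      by (simp_all add: y_def)
    have pair: "pairing V i u (b' b) = (\<Sum>a=1..n. coord (?l i u) a * coord (y b) a)"
      if "u \<in> carrier (iterated_dual V i)" "b \<in> B" for u b
      unfolding y_def by (rule pairing_twisted_coord[OF m that(1) b'_closed[OF that(2)]])
    \<comment> \<open>Completeness of dual bases: a vector is recovered from its pairings with the
      elements \<open>b' b\<close>. For the vector labelled by \<open>letter c\<close> that pairing
      is coordinate \<open>c\<close> of \<open>y b\<close>.\<close>
    have letter_eq: "(\<Sum>b\<in>B. word_scale (coord (y b) c) (?l i b)) = letter c" if c: "c \<in> {1..n}" for c
    proof -
      let ?X = "basis_vector (iterated_dual V i) (?l i) c"
      have X: "?X \<in> carrier (iterated_dual V i)" "?l i ?X = letter c"
        using basis_vector[OF l c] by auto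
      obtain k where k: "?X = (\<Oplus>\<^bsub>iterated_dual V i\<^esub>b\<in>B. k b \<odot>\<^bsub>iterated_dual V i\<^esub> b)"
        using B X(1) unfolding is_basis_def by blast
      have lc: "letter c = (\<Sum>b\<in>B. word_scale (k b) (?l i b))"
        using coordinatization_finsum[OF l fin sub, of k] X(2) by (simp add: k[symmetric])
      have "k b = coord (y b) c" if b: "b \<in> B" for b
      proof -
        \<comment> \<open>Pairing the expansion of the vector labelled by \<open>letter c\<close>
          with \<open>b' b\<close> isolates the coefficient \<open>k b\<close>.\<close>
        have "coord (y b) c = (\<Sum>a=1..n. if a = c then coord (y b) a else 0)"
          using c by simp
        also have "\<dots> = (\<Sum>a=1..n. coord (letter c) a * coord (y b) a)"
          by (intro sum.cong) (auto simp: coord_letter)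
        also have "\<dots> = (\<Sum>a=1..n. \<Sum>e\<in>B. k e * (coord (?l i e) a * coord (y b) a))"
          unfolding lc by (simp add: lookup_sum sum_distrib_right mult.assoc)
        also have "\<dots> = (\<Sum>e\<in>B. k e * pairing V i e (b' b))"
          using pair[OF _ b] sub by (subst sum.swap) (auto simp: sum_distrib_left intro!: sum.cong)
        also have "\<dots> = (\<Sum>e\<in>B. if e = b then k e else 0)"
          using dual[OF b] by (intro sum.cong) auto
        also have "\<dots> = k b" using b fin by simp
        finally show ?thesis ..
      qed
      then show ?thesis unfolding lc by (intro sum.cong) auto
    qed
    \<comment> \<open>Expanding \<open>\<tau> (y b)\<close> in the elements
      \<open>\<tau> (letter c)\<close> and exchanging the sums leaves the inner sum of
      \<open>letter_eq\<close>, so the basis \<open>B\<close> disappears.\<close>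
    have "lin_ext (word_image ?l i) t = (\<Sum>b\<in>B. word_mult (?l i b) (\<tau> (y b)))"
      unfolding t lin_ext_sum using y(2) by (intro sum.cong) auto
    also have "\<dots> = (\<Sum>b\<in>B. \<Sum>c=1..n. word_mult (word_scale (coord (y b) c) (?l i b)) (\<tau> (letter c)))"
      using \<tau>_expand[OF y(1)] by (intro sum.cong) (simp_all add: word_mult_sum_right)
    also have "\<dots> = (\<Sum>c=1..n. word_mult (\<Sum>b\<in>B. word_scale (coord (y b) c) (?l i b)) (\<tau> (letter c)))"
      unfolding word_mult_sum_left by (rule sum.swap)
    also have "\<dots> = (\<Sum>c=1..n. word_mult (letter c) (\<tau> (letter c)))"
      using letter_eq by (intro sum.cong) simp_all
    finally show "lin_ext (word_image ?l i) t = (\<Sum>a=1..n. word_mult (letter a) (\<tau> (letter a)))" .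
  qed
qed

end

lemma regrading_exists:
  fixes V :: "('k::field, 'v) module" and \<sigma> :: "(nat list \<Rightarrow>\<^sub>0 'k) \<Rightarrow> (nat list \<Rightarrow>\<^sub>0 'k)"
  assumes V: "vector_space_of_dim V n" and \<sigma>: "graded_automorphism n \<sigma>"
  shows "\<exists>\<phi>. regrading (P1_algebra n \<sigma>) (Snc V) \<phi>"
proof -
  let ?\<tau> = "\<lambda>f. \<Sum>a=1..n. word_scale (coord f a) (\<sigma> (letter (n + 1 - a)))"
  interpret twist n ?\<tau> by (rule graded_automorphism_twist[OF \<sigma>])
  obtain m where m: "coordinatization n V m" using coordinatization_exists[OF V] by blast
  interpret coordinatized V n "twisted_coord V m" "\<Sum>a=1..n. word_mult (letter a) (?\<tau> (letter a))"
    by (rule coordinatized_twisted[OF m])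
  \<comment> \<open>This identifies the element \<open>b\<close> of the locale with
    \<open>relator n \<sigma>\<close>, term by term.\<close>
  have "?\<tau> (letter a) = \<sigma> (letter (n + 1 - a))" if "a \<in> {1..n}" for a
  proof -
    have "?\<tau> (letter a) = (\<Sum>x=1..n. if x = a then \<sigma> (letter (n + 1 - x)) else 0)"
      by (intro sum.cong) (auto simp: coord_letter)
    then show ?thesis using that by simp
  qed
  then have "(\<Sum>a=1..n. word_mult (letter a) (?\<tau> (letter a))) = relator n \<sigma>"
    unfolding relator_def by (intro sum.cong) (simp_all only: HOL.refl)
  then have "quotient_algebra = P1_algebra n \<sigma>"
    unfolding quotient_algebra_def P1_algebra_def Let_def by (simp only:)
  then show ?thesis using regrading_comparison by metis
qed

theorem corollary1p3:
  fixes V :: "('k::field, 'v) module"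
    and n :: nat
    and \<sigma> :: "(nat list \<Rightarrow>\<^sub>0 'k) \<Rightarrow> (nat list \<Rightarrow>\<^sub>0 'k)"
  assumes "n \<ge> 2"
    and "vector_space_of_dim V n"
    and "graded_automorphism n \<sigma>"
  shows "equivalent_categories (P1 TYPE('u) n \<sigma>) (Pnc TYPE('u) V)"
proof -
  obtain \<phi> where "regrading (P1_algebra n \<sigma>) (Snc V) \<phi>"
    using regrading_exists[OF assms(2,3)] by blast
  then show ?thesis
    unfolding P1_def Pnc_def by (rule regrading.equivalent_cohproj)
qed

end
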